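(* Let $p$ be a prime and $n\geq 1$. Suppose $\alpha\in H^\ast(GL_2(\mathbb{F}_p);\mathbb{F}_p)$ is any class for which $\chi_\alpha(\rho_{\mathbb{F}_p^n})\neq0$ in $H^\ast(\mathbb{F}_p^n;\mathbb{F}_p)$. Then $$\chi_\alpha(\rho_{\mathrm{can}})\neq0\in H^\ast(GL_{p^n}(\mathbb{Z});\mathbb{F}_p)\quad\text{and}\quad \chi_\alpha(\pi_{\mathrm{ab}}^\ast(\rho_{\mathrm{can}}))\neq0\in H^\ast(\mathrm{Aut}(F_{p^n});\mathbb{F}_p).$$ Moreover, if $\chi_\alpha(\rho_{\mathbb{F}_p^n})$ is non-nilpotent, so are $\chi_\alpha(\rho_{\mathrm{can}})$ and $\chi_\alpha(\pi_{\mathrm{ab}}^\ast(\rho_{\mathrm{can}}))$.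
   Context: Cohomology is taken with coefficients in $\mathbb{F}_p$; a representation of a group means a finite-dimensional representation over $\mathbb{F}_p$. Characteristic classes. For $N\geq2$ let $P\leq GL_N(\mathbb{F}_p)$ be the subgroup of block matrices $\begin{bmatrix}A&*\\0&B\end{bmatrix}$ with $A\in GL_2(\mathbb{F}_p)$, $B\in GL_{N-2}(\mathbb{F}_p)$; let $i\colon P\to GL_N(\mathbb{F}_p)$ be the inclusion and $\pi\colon P\to GL_2(\mathbb{F}_p)$ the projection onto the block $A$. For $\alpha\in H^{>0}(GL_2(\mathbb{F}_p))$ put $\chi_\alpha^{(N)}=i_!(\pi^\ast\alpha)$, where $i_!$ is the transfer; put $\chi_\alpha^{(N)}=0$ when $\deg\alpha=0$. For a representation $\rho$ of a group $G$ of dimension $N\geq2$, put $\chi_\alpha(\rho)=\rho^\ast(\chi_\alpha^{(N)})\in H^\ast(G)$, where on the right $\rho\colon G\to GL_N(\mathbb{F}_p)$ is the associated homomorphism (well defined up to conjugacy). Representations. The basic representation $\rho_V$ of an $\mathbb{F}_p$-vector space $V$ (a group under addition) is $\rho_V=\mathbb{F}_p\oplus V^\ast$ with $v\cdot(c,u)=(c+u(v),u)$. $\rho_{\mathrm{can}}\colon GL_{p^n}(\mathbb{Z})\to GL_{p^n}(\mathbb{F}_p)$ is reduction mod $p$. $F_m$ is the free group on $m$ generators and $\pi_{\mathrm{ab}}\colon\mathrm{Aut}(F_{p^n})\to GL_{p^n}(\mathbb{Z})$ is the map given by abelianization. *)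

theory Defs
  imports "HOL-Algebra.QuotRing" "HOL-Algebra.Bij" "Jordan_Normal_Form.Matrix"
    "Berlekamp_Zassenhaus.Finite_Field"
begin

section \<open>The mod-\<open>p\<close> cohomology ring of a discrete group\<close>

text \<open>Cohomology is computed from the homogeneous bar resolution.  A \<open>k\<close>-cochain of \<open>G\<close> with
  trivial coefficients is a function \<open>f(x\<^sub>0,\<dots>,x\<^sub>k)\<close> that is invariant under left translation by
  \<open>G\<close>.  All degrees are kept together: an element of the direct sum of the cochain groups is
  one function on lists, whose degree-\<open>k\<close> component is its restriction to the lists of length
  \<open>k + 1\<close>.  It vanishes on the empty list, on lists leaving \<open>carrier G\<close>, and on all
  sufficiently long lists, so the quotient below is the direct sum of all \<open>H\<^sup>k\<close>.\<close>

definition cochains :: "('g, 'm) monoid_scheme \<Rightarrow> ('g list \<Rightarrow> 'k::comm_ring_1) set" where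
  "cochains G = {f.
     (\<forall>xs. f xs \<noteq> 0 \<longrightarrow> xs \<noteq> [] \<and> set xs \<subseteq> carrier G) \<and>
     (\<exists>b. \<forall>xs. f xs \<noteq> 0 \<longrightarrow> length xs \<le> b) \<and>
     (\<forall>g\<in>carrier G. \<forall>xs. set xs \<subseteq> carrier G \<longrightarrow> f (map (\<lambda>x. g \<otimes>\<^bsub>G\<^esub> x) xs) = f xs)}"

definition differential ::
  "('g, 'm) monoid_scheme \<Rightarrow> ('g list \<Rightarrow> 'k::comm_ring_1) \<Rightarrow> 'g list \<Rightarrow> 'k" where
  "differential G f xs =
     (if set xs \<subseteq> carrier G
      then \<Sum>i<length xs. (- 1) ^ i * f (take i xs @ drop (Suc i) xs) else 0)"

definition cup :: "('g list \<Rightarrow> 'k::comm_ring_1) \<Rightarrow> ('g list \<Rightarrow> 'k) \<Rightarrow> 'g list \<Rightarrow> 'k" where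
  "cup f h xs = (\<Sum>i<length xs. f (take (Suc i) xs) * h (drop i xs))"

definition cocycle_ring ::
  "('g, 'm) monoid_scheme \<Rightarrow> ('g list \<Rightarrow> 'k::comm_ring_1) ring" where
  "cocycle_ring G =
     \<lparr>carrier = {f \<in> cochains G. differential G f = (\<lambda>_. 0)},
      monoid.mult = cup,
      one = (\<lambda>xs. if length xs = 1 \<and> set xs \<subseteq> carrier G then 1 else 0),
      zero = (\<lambda>_. 0),
      add = (\<lambda>f h xs. f xs + h xs)\<rparr>"

definition coboundaries :: "('g, 'm) monoid_scheme \<Rightarrow> ('g list \<Rightarrow> 'k::comm_ring_1) set" where
  "coboundaries G = differential G ` cochains G"

definition cohomology ::
  "('g, 'm) monoid_scheme \<Rightarrow> ('g list \<Rightarrow> 'k::comm_ring_1) set ring" where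
  "cohomology G = cocycle_ring G Quot coboundaries G"

definition cohomology_class ::
  "('g, 'm) monoid_scheme \<Rightarrow> ('g list \<Rightarrow> 'k::comm_ring_1) \<Rightarrow> ('g list \<Rightarrow> 'k) set" where
  "cohomology_class G f = coboundaries G +>\<^bsub>cocycle_ring G\<^esub> f"

definition nilpotent :: "('a, 'm) ring_scheme \<Rightarrow> 'a \<Rightarrow> bool" where
  "nilpotent R x \<longleftrightarrow> (\<exists>k::nat. x [^]\<^bsub>R\<^esub> k = \<zero>\<^bsub>R\<^esub>)"


section \<open>Operations on cohomology\<close>

text \<open>An operation on cochains that takes cocycles to cocycles and coboundaries to coboundaries
  induces one on classes; the union below then consists of one and the same coset.\<close>

definition on_classes ::
  "('g, 'm) monoid_scheme \<Rightarrow> (('h list \<Rightarrow> 'k) \<Rightarrow> 'g list \<Rightarrow> 'k) \<Rightarrow>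
   ('h list \<Rightarrow> 'k::comm_ring_1) set \<Rightarrow> ('g list \<Rightarrow> 'k) set" where
  "on_classes G T X = (\<Union>f\<in>X. cohomology_class G (T f))"

definition pullback ::
  "('g, 'm) monoid_scheme \<Rightarrow> ('g \<Rightarrow> 'h) \<Rightarrow>
   ('h list \<Rightarrow> 'k::comm_ring_1) set \<Rightarrow> ('g list \<Rightarrow> 'k) set" where
  "pullback G \<phi> =
     on_classes G (\<lambda>f xs. if set xs \<subseteq> carrier G then f (map \<phi> xs) else 0)"

text \<open>The component of a class in positive degrees.\<close>

definition positive_part ::
  "('g, 'm) monoid_scheme \<Rightarrow> ('g list \<Rightarrow> 'k::comm_ring_1) set \<Rightarrow> ('g list \<Rightarrow> 'k) set" where
  "positive_part G = on_classes G (\<lambda>f xs. if length xs \<ge> 2 then f xs else 0)"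

text \<open>Transfer from a subgroup \<open>P\<close> of finite index.  Choose a representative \<open>t\<^sub>C\<close> in every
  coset \<open>C = P t\<^sub>C\<close>.  The \<open>P\<close>-equivariant retraction \<open>r (p t\<^sub>C) = p\<close> of \<open>G\<close> onto \<open>P\<close> extends a
  cochain \<open>f\<close> of \<open>P\<close> to a \<open>P\<close>-invariant function \<open>f \<circ> r\<close> on tuples from \<open>G\<close>, that is, it
  compares the bar resolutions of \<open>P\<close> and of \<open>G\<close> as resolutions over \<open>P\<close>.  The norm
  \<open>\<Sum>\<^sub>C t\<^sub>C\<inverse> (f \<circ> r)\<close> over the cosets is then \<open>G\<close>-invariant.\<close>

definition coset_rep :: "'g set \<Rightarrow> 'g" where
  "coset_rep C = (SOME t. t \<in> C)"

definition coset_retraction :: "('g, 'm) monoid_scheme \<Rightarrow> 'g set \<Rightarrow> 'g \<Rightarrow> 'g" where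
  "coset_retraction G P x = x \<otimes>\<^bsub>G\<^esub> inv\<^bsub>G\<^esub> (coset_rep (P #>\<^bsub>G\<^esub> x))"

definition transfer ::
  "('g, 'm) monoid_scheme \<Rightarrow> 'g set \<Rightarrow> ('g list \<Rightarrow> 'k::comm_ring_1) set \<Rightarrow> ('g list \<Rightarrow> 'k) set" where
  "transfer G P =
     on_classes G (\<lambda>f xs.
       if set xs \<subseteq> carrier G
       then \<Sum>C\<in>rcosets\<^bsub>G\<^esub> P. f (map (\<lambda>x. coset_retraction G P (coset_rep C \<otimes>\<^bsub>G\<^esub> x)) xs)
       else 0)"


section \<open>The characteristic classes\<close>

definition GL :: "nat \<Rightarrow> 'a::comm_ring_1 mat monoid" where
  "GL N = units_of (ring_mat TYPE('a) N ())"

definition parabolic :: "nat \<Rightarrow> 'a::comm_ring_1 mat set" where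
  "parabolic N =
     {four_block_mat A X (0\<^sub>m (N - 2) 2) B | A X B.
        A \<in> carrier (GL 2) \<and> X \<in> carrier_mat 2 (N - 2) \<and> B \<in> carrier (GL (N - 2))}"

definition upper_left_block :: "'a mat \<Rightarrow> 'a mat" where
  "upper_left_block M = mat 2 2 (\<lambda>(i, j). M $$ (i, j))"

text \<open>The class \<open>\<alpha>\<close> need not be homogeneous; \<open>chi_univ\<close> is additive in \<open>\<alpha>\<close>
  and ignores its component of degree \<open>0\<close>.\<close>

definition chi_univ ::
  "nat \<Rightarrow> ('a::comm_ring_1 mat list \<Rightarrow> 'a) set \<Rightarrow> ('a mat list \<Rightarrow> 'a) set" where
  "chi_univ N \<alpha> =
     transfer (GL N) (parabolic N)
       (pullback (GL N\<lparr>carrier := parabolic N\<rparr>) upper_left_block (positive_part (GL 2) \<alpha>))"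

text \<open>An \<open>N\<close>-dimensional representation of \<open>G\<close> is given by a homomorphism \<open>\<rho>\<close> from \<open>G\<close> to
  \<open>GL N\<close>, acting on column vectors from the left.\<close>

definition chi ::
  "('g, 'm) monoid_scheme \<Rightarrow> nat \<Rightarrow> ('g \<Rightarrow> 'a mat) \<Rightarrow>
   ('a::comm_ring_1 mat list \<Rightarrow> 'a) set \<Rightarrow> ('g list \<Rightarrow> 'a) set" where
  "chi G N \<rho> \<alpha> = pullback G \<rho> (chi_univ N \<alpha>)"


section \<open>The representations\<close>

text \<open>For \<open>V = F\<^sup>n\<close>, identify \<open>V\<^sup>*\<close> with \<open>F\<^sup>n\<close> by the dual basis, so that \<open>u\<close> stands for the
  functional \<open>v \<mapsto> u \<bullet> v\<close>.\<close>

definition basic_rep :: "nat \<Rightarrow> 'a::comm_ring_1 vec \<Rightarrow> 'a mat" where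
  "basic_rep n v = four_block_mat (1\<^sub>m 1) (mat_of_row v) (0\<^sub>m n 1) (1\<^sub>m n)"

lemma basic_rep_action:
  fixes v u :: "'a::comm_ring_1 vec"
  assumes "v \<in> carrier_vec n" "u \<in> carrier_vec n"
  shows "basic_rep n v *\<^sub>v vCons c u = vCons (c + u \<bullet> v) u"
proof -
  have c: "vCons c u = vec 1 (\<lambda>_. c) @\<^sub>v u" for c
    by (rule eq_vecI) (auto simp: vec_index_vCons)
  have "basic_rep n v *\<^sub>v vCons c u =
      (1\<^sub>m 1 *\<^sub>v vec 1 (\<lambda>_. c) + mat_of_row v *\<^sub>v u) @\<^sub>v (0\<^sub>m n 1 *\<^sub>v vec 1 (\<lambda>_. c) + 1\<^sub>m n *\<^sub>v u)"
    unfolding basic_rep_def c using assms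
    by (intro four_block_mat_mult_vec) auto
  also have "1\<^sub>m 1 *\<^sub>v vec 1 (\<lambda>_. c) + mat_of_row v *\<^sub>v u = vec 1 (\<lambda>_. c + u \<bullet> v)"
    using assms by (intro eq_vecI) (auto simp: comm_scalar_prod[of v n u])
  also have "0\<^sub>m n 1 *\<^sub>v vec 1 (\<lambda>_. c) + 1\<^sub>m n *\<^sub>v u = u"
    using assms by auto
  finally show ?thesis unfolding c .
qed

lemma basic_rep_hom: "basic_rep n \<in> hom (monoid_vec TYPE('a::comm_ring_1) n) (GL (n + 1))"
proof -
  let ?\<rho> = "basic_rep n :: 'a vec \<Rightarrow> 'a mat"
  have carr: "?\<rho> v \<in> carrier_mat (Suc n) (Suc n)" if "v \<in> carrier_vec n" for v
    using that four_block_carrier_mat[of "1\<^sub>m 1" 1 1 "1\<^sub>m n" n n] unfolding basic_rep_def by simp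
  have row_add: "mat_of_row (v + w) = mat_of_row v + mat_of_row w"
    if "v \<in> carrier_vec n" "w \<in> carrier_vec n" for v w :: "'a vec"
    using that by (intro eq_matI) auto
  have add: "?\<rho> (v + w) = ?\<rho> v * ?\<rho> w" if v: "v \<in> carrier_vec n" and w: "w \<in> carrier_vec n" for v w
  proof -
    have "?\<rho> v * ?\<rho> w = four_block_mat (1\<^sub>m 1 * 1\<^sub>m 1 + mat_of_row v * 0\<^sub>m n 1)
        (1\<^sub>m 1 * mat_of_row w + mat_of_row v * 1\<^sub>m n) (0\<^sub>m n 1 * 1\<^sub>m 1 + 1\<^sub>m n * 0\<^sub>m n 1)
        (0\<^sub>m n 1 * mat_of_row w + 1\<^sub>m n * 1\<^sub>m n)"
      unfolding basic_rep_def using v w by (intro mult_four_block_mat) auto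
    also have "1\<^sub>m 1 * 1\<^sub>m 1 + mat_of_row v * 0\<^sub>m n 1 = 1\<^sub>m 1"
      using v by (simp add: right_mult_zero_mat[of _ 1 n])
    also have "1\<^sub>m 1 * mat_of_row w + mat_of_row v * 1\<^sub>m n = mat_of_row (v + w)"
      using v w by (simp add: row_add left_mult_one_mat[of _ 1 n] right_mult_one_mat[of _ 1 n]
          comm_add_mat[of _ 1 n])
    also have "0\<^sub>m n 1 * 1\<^sub>m 1 + 1\<^sub>m n * 0\<^sub>m n 1 = (0\<^sub>m n 1 :: 'a mat)" by simp
    also have "0\<^sub>m n 1 * mat_of_row w + 1\<^sub>m n * 1\<^sub>m n = 1\<^sub>m n"
      using w by (simp add: left_mult_zero_mat[of _ 1 n])
    finally show ?thesis unfolding basic_rep_def by simp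
  qed
  have zero: "?\<rho> (0\<^sub>v n) = 1\<^sub>m (Suc n)"
  proof -
    have "mat_of_row (0\<^sub>v n) = (0\<^sub>m 1 n :: 'a mat)" by (intro eq_matI) auto
    then show ?thesis unfolding basic_rep_def using four_block_one_mat[of 1 n] by simp
  qed
  have "?\<rho> v \<in> carrier (GL (n + 1))" if v: "v \<in> carrier_vec n" for v
  proof -
    have "?\<rho> v * ?\<rho> (- v) = 1\<^sub>m (Suc n)" "?\<rho> (- v) * ?\<rho> v = 1\<^sub>m (Suc n)"
      using v add[of v "- v"] add[of "- v" v] zero
      by (simp_all add: uminus_l_inv_vec[of v n] uminus_r_inv_vec[of v n])
    then show ?thesis
      using carr[OF v] carr[of "- v"] v
      by (auto simp: GL_def units_of_def Units_def ring_mat_def intro!: bexI[of _ "?\<rho> (- v)"])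
  qed
  then show ?thesis
    using add by (auto simp: hom_def monoid_vec_def GL_def units_of_def ring_mat_def)
qed

abbreviation rho_can :: "int mat \<Rightarrow> 'a::comm_ring_1 mat" where
  "rho_can \<equiv> map_mat of_int"


subsection \<open>Free groups and abelianization\<close>

text \<open>The letters \<open>(i, True)\<close> and \<open>(i, False)\<close> stand for the generator \<open>x\<^sub>i\<close> and its inverse; elements
  of the free group are the reduced words.\<close>

type_synonym letter = "nat \<times> bool"

definition inv_letter :: "letter \<Rightarrow> letter" where
  "inv_letter x = (fst x, \<not> snd x)"

definition reduced :: "letter list \<Rightarrow> bool" where
  "reduced w \<longleftrightarrow> successively (\<lambda>x y. y \<noteq> inv_letter x) w"

fun push :: "letter \<Rightarrow> letter list \<Rightarrow> letter list" where
  "push x [] = [x]"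
| "push x (y # w) = (if y = inv_letter x then w else x # y # w)"

definition free_group :: "nat \<Rightarrow> letter list monoid" where
  "free_group m =
     \<lparr>carrier = {w. reduced w \<and> fst ` set w \<subseteq> {..<m}}, monoid.mult = foldr push, one = []\<rparr>"

lemma inv_letter_invol [simp]: "inv_letter (inv_letter x) = x"
  by (simp add: inv_letter_def)

lemma push_reduced: "reduced w \<Longrightarrow> reduced (push x w)"
  by (cases w) (auto simp: reduced_def successively_Cons)

lemma push_Cons_reduced: "reduced (x # w) \<Longrightarrow> push x w = x # w"
  by (cases w) (auto simp: reduced_def)

lemma push_push_inv: "reduced w \<Longrightarrow> push x (push (inv_letter x) w) = w"
  by (cases w) (auto simp: push_Cons_reduced)

lemma foldr_push_reduced: "reduced w \<Longrightarrow> reduced (foldr push v w)"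
  by (induction v) (auto simp: push_reduced)

lemma foldr_push_assoc:
  assumes "reduced w"
  shows "foldr push (foldr push u v) w = foldr push u (foldr push v w)"
proof (induction u)
  case (Cons x u)
  have "foldr push (push x z) w = push x (foldr push z w)" for z
    using push_push_inv[OF foldr_push_reduced[OF assms]] by (cases z) auto
  then show ?case using Cons by simp
qed simp

lemma group_free_group: "group (free_group m)"
proof (rule groupI)
  fix u v w
  assume u: "u \<in> carrier (free_group m)" and v: "v \<in> carrier (free_group m)"
    and w: "w \<in> carrier (free_group m)"
  have letters: "fst ` set (foldr push u v) \<subseteq> fst ` set u \<union> fst ` set v" for u v
  proof (induction u)
    case (Cons x u)
    have "fst ` set (push x z) \<subseteq> insert (fst x) (fst ` set z)" for z by (cases z) auto
    from this[of "foldr push u v"] Cons show ?case by auto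
  qed simp
  have "fst ` set (foldr push u v) \<subseteq> {..<m}"
    using letters[of u v] u v unfolding free_group_def by simp blast
  then show "u \<otimes>\<^bsub>free_group m\<^esub> v \<in> carrier (free_group m)"
    using v by (simp add: free_group_def foldr_push_reduced)
  show "u \<otimes>\<^bsub>free_group m\<^esub> v \<otimes>\<^bsub>free_group m\<^esub> w = u \<otimes>\<^bsub>free_group m\<^esub> (v \<otimes>\<^bsub>free_group m\<^esub> w)"
    using w by (simp add: free_group_def foldr_push_assoc)
  let ?i = "rev (map inv_letter u)"
  have inverse: "foldr push (rev (map inv_letter z)) z = []" for z
    by (induction z) auto
  have "reduced ?i = successively (\<lambda>x y. inv_letter x \<noteq> y) u"
    by (simp add: reduced_def successively_rev successively_map)
  also have "(\<lambda>x y. inv_letter x \<noteq> y) = (\<lambda>x y. y \<noteq> inv_letter x)"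
    by (intro ext) auto
  finally have "reduced ?i"
    using u by (simp add: free_group_def reduced_def)
  then show "\<exists>y\<in>carrier (free_group m). y \<otimes>\<^bsub>free_group m\<^esub> u = \<one>\<^bsub>free_group m\<^esub>"
    using u inverse by (intro bexI[of _ ?i]) (auto simp: free_group_def inv_letter_def image_image)
qed (auto simp: free_group_def reduced_def)

definition exponent_sum :: "nat \<Rightarrow> letter list \<Rightarrow> int" where
  "exponent_sum i w = int (count_list w (i, True)) - int (count_list w (i, False))"

definition abelianize :: "nat \<Rightarrow> letter list \<Rightarrow> int vec" where
  "abelianize m w = vec m (\<lambda>i. exponent_sum i w)"

text \<open>The matrix, with respect to the images of the generators, of the endomorphism of the
  abelianization \<open>\<int>\<^sup>m\<close> induced by \<open>\<phi>\<close>.\<close>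

definition pi_ab :: "nat \<Rightarrow> (letter list \<Rightarrow> letter list) \<Rightarrow> int mat" where
  "pi_ab m \<phi> = mat_of_cols m (map (\<lambda>j. abelianize m (\<phi> [(j, True)])) [0..<m])"

lemma abelianize_hom: "abelianize m \<in> hom (free_group m) (monoid_vec TYPE(int) m)"
proof -
  have push: "exponent_sum i (push x w) = exponent_sum i [x] + exponent_sum i w" for i x w
    by (cases w; cases x; cases "snd x") (auto simp: exponent_sum_def inv_letter_def)
  have cons: "exponent_sum i (x # w) = exponent_sum i [x] + exponent_sum i w" for i x w
    by (simp add: exponent_sum_def)
  have "exponent_sum i (foldr push v w) = exponent_sum i v + exponent_sum i w" for i v w
  proof (induction v)
    case Nil
    then show ?case by (simp add: exponent_sum_def)
  next
    case (Cons x v)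
    then show ?case using cons[of i x v] push[of i x] by simp
  qed
  then show ?thesis
    by (auto simp: hom_def free_group_def monoid_vec_def abelianize_def)
qed

lemma abelianize_natural:
  assumes "\<phi> \<in> carrier (AutoGroup (free_group m))" "w \<in> carrier (free_group m)"
  shows "abelianize m (\<phi> w) = pi_ab m \<phi> *\<^sub>v abelianize m w"
proof -
  let ?F = "free_group m" and ?ab = "abelianize m" and ?A = "pi_ab m \<phi>"
  interpret group ?F by (rule group_free_group)
  have hom: "\<phi> \<in> hom ?F ?F"
    using assms(1) by (simp add: AutoGroup_def auto_def)
  have \<phi>_closed: "\<phi> v \<in> carrier ?F" if "v \<in> carrier ?F" for v
    using hom that by (auto simp: hom_def)
  have \<phi>_push: "?ab (\<phi> (push x v)) = ?ab (\<phi> [x]) + ?ab (\<phi> v)"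
    if "[x] \<in> carrier ?F" "v \<in> carrier ?F" for x v
  proof -
    have "\<phi> ([x] \<otimes>\<^bsub>?F\<^esub> v) = \<phi> [x] \<otimes>\<^bsub>?F\<^esub> \<phi> v"
      using hom that by (auto simp: hom_def)
    moreover have "?ab (\<phi> [x] \<otimes>\<^bsub>?F\<^esub> \<phi> v) = ?ab (\<phi> [x]) + ?ab (\<phi> v)"
      using abelianize_hom[of m] \<phi>_closed that by (auto simp: hom_def monoid_vec_def)
    ultimately show ?thesis by (simp add: free_group_def)
  qed
  have ab_push: "?ab (push x v) = ?ab [x] + ?ab v"
    if "[x] \<in> carrier ?F" "v \<in> carrier ?F" for x v
    using abelianize_hom[of m] that by (auto simp: hom_def monoid_vec_def free_group_def)
  have A: "?A \<in> carrier_mat m m"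
    using mat_of_cols_carrier[of m "map (\<lambda>j. ?ab (\<phi> [(j, True)])) [0..<m]"] by (simp add: pi_ab_def)
  have ab_carrier: "?ab v \<in> carrier_vec m" for v by (simp add: abelianize_def)
  have nil: "[] \<in> carrier ?F" by (simp add: free_group_def reduced_def)
  have "\<phi> [] = []"
    using hom_one[OF hom is_group is_group] by (simp add: free_group_def)
  then have \<phi>_nil: "?ab (\<phi> []) = 0\<^sub>v m"
    by (intro eq_vecI) (auto simp: abelianize_def exponent_sum_def)
  have ab_nil: "?ab [] = 0\<^sub>v m"
    by (intro eq_vecI) (auto simp: abelianize_def exponent_sum_def)
  have single: "[(j, b)] \<in> carrier ?F" if "j < m" for j b
    using that by (simp add: free_group_def reduced_def)
  have pos: "?ab (\<phi> [(j, True)]) = ?A *\<^sub>v ?ab [(j, True)]" if j: "j < m" for j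
  proof -
    have "?ab [(j, True)] = unit_vec m j"
      using j by (intro eq_vecI) (auto simp: abelianize_def exponent_sum_def)
    moreover have "?A *\<^sub>v unit_vec m j = col ?A j"
      using A j by (intro eq_vecI) auto
    moreover have "col ?A j = ?ab (\<phi> [(j, True)])"
      using j ab_carrier by (simp add: pi_ab_def)
    ultimately show ?thesis by simp
  qed
  have neg: "?ab (\<phi> [(j, False)]) = ?A *\<^sub>v ?ab [(j, False)]" if j: "j < m" for j
  proof -
    have "push (j, True) [(j, False)] = []" by (simp add: inv_letter_def)
    then have "?ab (\<phi> [(j, True)]) + ?ab (\<phi> [(j, False)]) = 0\<^sub>v m"
        "?ab [(j, True)] + ?ab [(j, False)] = 0\<^sub>v m"
      using \<phi>_push[of "(j, True)" "[(j, False)]"] ab_push[of "(j, True)" "[(j, False)]"]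
        single[OF j] \<phi>_nil ab_nil by auto
    moreover have "?A *\<^sub>v 0\<^sub>v m = 0\<^sub>v m" using A by auto
    ultimately have eq: "?ab (\<phi> [(j, True)]) + ?ab (\<phi> [(j, False)])
        = ?ab (\<phi> [(j, True)]) + ?A *\<^sub>v ?ab [(j, False)]"
      using mult_add_distrib_mat_vec[OF A ab_carrier ab_carrier, of "[(j, True)]" "[(j, False)]"]
        pos[OF j] by simp
    show ?thesis
    proof (rule eq_vecI)
      fix i assume i: "i < dim_vec (?A *\<^sub>v ?ab [(j, False)])"
      then show "?ab (\<phi> [(j, False)]) $ i = (?A *\<^sub>v ?ab [(j, False)]) $ i"
        using arg_cong[OF eq, of "\<lambda>v. v $ i"] carrier_vecD[OF ab_carrier] A by simp
    qed (use ab_carrier A in simp)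
  qed
  show ?thesis
    using assms(2)
  proof (induction w)
    case Nil
    then show ?case using \<phi>_nil ab_nil A by auto
  next
    case (Cons x w)
    have x: "fst x < m" and red: "reduced (x # w)" using Cons.prems by (auto simp: free_group_def)
    have w: "w \<in> carrier ?F"
      using Cons.prems by (auto simp: free_group_def reduced_def successively_Cons)
    have x1: "[x] \<in> carrier ?F" using single[OF x, of "snd x"] by simp
    have "?ab (\<phi> [x]) = ?A *\<^sub>v ?ab [x]"
      using pos[OF x] neg[OF x] by (cases x; cases "snd x") auto
    then show ?case
      using \<phi>_push[OF x1 w] ab_push[OF x1 w] push_Cons_reduced[OF red] Cons.IH[OF w]
        mult_add_distrib_mat_vec[OF A ab_carrier ab_carrier, of "[x]" w] by simp
  qed
qed

end

theory Submission
  imports Defs "HOL-Algebra.Multiplicative_Group" "Jordan_Normal_Form.Gauss_Jordan_Elimination"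
    "Berlekamp_Zassenhaus.Berlekamp_Type_Based"
begin

text \<open>Let \<open>k\<close> be the field with \<open>p\<close> elements and let \<open>V = k\<^sup>n\<close> act by translations on the
  functions from \<open>V\<close> to \<open>k\<close>.  This regular representation permutes a basis, so it factors through \<open>Aut(F\<^sub>m) \<rightarrow> GL\<^sub>m(\<int>) \<rightarrow> GL\<^sub>m(k)\<close> with
  \<open>m = p\<^sup>n\<close>, and by naturality it suffices that it has the same class \<open>\<chi>\<^sub>\<alpha>\<close> as the basic
  representation, which is the subrepresentation of affine functions.  Pulled back to \<open>V\<close>, the
  transfer is a sum over the \<open>V\<close>-orbits of planes.  An orbit with more than one element contributes
  a transfer from a proper subgroup of \<open>V\<close>, which vanishes since that subgroup is a direct factor
  of index divisible by \<open>p\<close>.  So only the invariant planes matter, and an invariant plane of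
  functions consists of affine functions.\<close>

section \<open>Bar cochains\<close>

text \<open>The unipotent matrices of the basic representation come with no evident integral lifts
  of order p, whereas permutation matrices are integral; the size p^n is the number of points being
  permuted. The transfer depends on a transversal, and bases of planes can only be chosen, so
  neither is equivariant on the nose. One cochain-level pattern copes with this: a sum over an index
  set that the group permutes, with multipliers obeying a cocycle law. Pullbacks, transfers, their
  restriction to V and changes of basis are all of this form, and two such sums with equal
  permutations and multipliers are cohomologous. This takes the place of a double coset formula. An
  invariant plane is affine for the following reason. On a plane over the prime field, V acts by
  matrices \<open>\<phi> x\<close> with a common fixed vector and determinant 1, hence
  (\<open>\<phi> x\<close> - 1)(\<open>\<phi> y\<close> - 1) = 0. So second differences of the
  functions in the plane vanish, such a function minus its value at 0 is additive, and over the
  prime field additive functions are linear.\<close>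

definition face_sum :: "('g list \<Rightarrow> 'k::comm_ring_1) \<Rightarrow> 'g list \<Rightarrow> 'k" where
  "face_sum f xs = (\<Sum>i<length xs. (- 1) ^ i * f (take i xs @ drop (Suc i) xs))"

text \<open>Without the carrier test the alternating sum makes sense for every function on lists.
  This is what allows inductions that freeze the first entry, where
  \<open>\<lambda>ys. f (x # ys)\<close> is no longer a cochain.\<close>

lemma differential_face_sum:
  "differential G f xs = (if set xs \<subseteq> carrier G then face_sum f xs else 0)"
  by (simp add: differential_def face_sum_def)

lemma face_sum_Nil [simp]: "face_sum f [] = 0"
  by (simp add: face_sum_def)

lemma face_sum_Cons: "face_sum f (x # xs) = f xs - face_sum (\<lambda>ys. f (x # ys)) xs"
  by (simp add: face_sum_def sum.lessThan_Suc_shift sum_negf del: sum.lessThan_Suc)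

lemma face_sum_add: "face_sum (\<lambda>xs. f xs + g xs) xs = face_sum f xs + face_sum g xs"
  by (simp add: face_sum_def distrib_left sum.distrib)

lemma face_sum_diff: "face_sum (\<lambda>xs. f xs - g xs) xs = face_sum f xs - face_sum g xs"
  by (simp add: face_sum_def right_diff_distrib sum_subtractf)

lemma face_sum_scale: "face_sum (\<lambda>xs. c * f xs) xs = c * face_sum f xs"
  by (simp add: face_sum_def sum_distrib_left algebra_simps)

lemma face_sum_uminus: "face_sum (\<lambda>xs. - f xs) xs = - face_sum f xs"
  by (simp add: face_sum_def sum_negf)

lemma face_sum_zero [simp]: "face_sum (\<lambda>_. 0) xs = 0"
  by (simp add: face_sum_def)

lemma face_sum_sum: "face_sum (\<lambda>xs. \<Sum>C\<in>X. f C xs) xs = (\<Sum>C\<in>X. face_sum (f C) xs)"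
  unfolding face_sum_def sum_distrib_left by (rule sum.swap)

lemma face_sum_map: "face_sum (\<lambda>xs. f (map s xs)) xs = face_sum f (map s xs)"
  by (simp add: face_sum_def take_map drop_map)

lemma face_sum_cong:
  assumes "\<And>ys. set ys \<subseteq> set xs \<Longrightarrow> f ys = g ys"
  shows "face_sum f xs = face_sum g xs"
  unfolding face_sum_def
proof (intro sum.cong refl arg_cong2[where f = "(*)"] assms)
  fix i show "set (take i xs @ drop (Suc i) xs) \<subseteq> set xs"
    using set_take_subset[of i xs] set_drop_subset[of "Suc i" xs] by auto
qed

text \<open>In the recursion \<open>face_sum_Cons\<close> the two terms in which the first entry is
  among the deleted ones cancel. What is left is the claim for
  \<open>\<lambda>ys. f (x # ys)\<close>, so \<open>f\<close> must be arbitrary in the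
  induction.\<close>

lemma face_sum_face_sum: "face_sum (face_sum f) xs = 0"
  by (induction xs arbitrary: f) (simp_all add: face_sum_Cons face_sum_diff)

section \<open>Cup products and the Leibniz rule\<close>

lemma cup_Nil [simp]: "cup f h [] = 0"
  by (simp add: cup_def)

lemma cup_Cons: "cup f h (x # xs) = f [x] * h (x # xs) + cup (\<lambda>ys. f (x # ys)) h xs"
  by (simp add: cup_def sum.lessThan_Suc_shift del: sum.lessThan_Suc)

lemma cup_add_left: "cup (\<lambda>xs. f xs + g xs) h xs = cup f h xs + cup g h xs"
  by (simp add: cup_def distrib_right sum.distrib)

lemma cup_add_right: "cup f (\<lambda>xs. g xs + h xs) xs = cup f g xs + cup f h xs"
  by (simp add: cup_def distrib_left sum.distrib)

lemma cup_diff_left: "cup (\<lambda>xs. f xs - g xs) h xs = cup f h xs - cup g h xs"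
  by (simp add: cup_def left_diff_distrib sum_subtractf)

lemma cup_minus_left: "cup (\<lambda>xs. - f xs) h xs = - cup f h xs"
  by (simp add: cup_def sum_negf)

lemma cup_zero [simp]: "cup (\<lambda>_. 0) h xs = 0" "cup f (\<lambda>_. 0) xs = 0"
  by (simp_all add: cup_def)

lemma cup_cong:
  assumes "\<And>ys. set ys \<subseteq> set xs \<Longrightarrow> f ys = f' ys" "\<And>ys. set ys \<subseteq> set xs \<Longrightarrow> h ys = h' ys"
  shows "cup f h xs = cup f' h' xs"
  unfolding cup_def
  by (intro sum.cong refl arg_cong2[where f = "(*)"] assms)
    (meson set_take_subset set_drop_subset)+

lemma cup_map: "cup (\<lambda>xs. f (map s xs)) (\<lambda>xs. h (map s xs)) xs = cup f h (map s xs)"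
  by (simp add: cup_def take_map drop_map)

text \<open>A list of length l carries degree l - 1, so the exponent has the parity of the degree.
  Since all degrees live in one function, the sign of the Leibniz rule has to be an operator on
  functions.\<close>

definition degree_sign :: "('g list \<Rightarrow> 'k::comm_ring_1) \<Rightarrow> 'g list \<Rightarrow> 'k" where
  "degree_sign f xs = (- 1) ^ Suc (length xs) * f xs"

text \<open>The last term makes up for the value of \<open>f\<close> on the empty list, which is zero for a cochain
  but not for the functions \<open>\<lambda>ys. f (x # ys)\<close> of the induction.\<close>

lemma face_sum_cup:
  assumes "h [] = 0"
  shows "face_sum (cup f h) xs =
    cup (face_sum f) h xs + cup (degree_sign f) (face_sum h) xs - f [] * h xs"
proof (induction xs arbitrary: f)
  case Nil
  show ?case using assms by simp
next
  case (Cons x xs)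
  let ?f = "\<lambda>ys. f (x # ys)"
  have "(\<lambda>ys. cup f h (x # ys)) = (\<lambda>ys. f [x] * h (x # ys) + cup ?f h ys)"
    by (simp add: cup_Cons)
  moreover have "(\<lambda>ys. degree_sign f (x # ys)) = (\<lambda>ys. - degree_sign ?f ys)"
    by (simp add: degree_sign_def)
  moreover have "(\<lambda>ys. face_sum f (x # ys)) = (\<lambda>ys. f ys - face_sum ?f ys)"
    by (simp add: face_sum_Cons)
  ultimately show ?case
    using Cons[of ?f]
    by (simp add: face_sum_Cons[of "cup f h"] face_sum_Cons[of h] face_sum_Cons[of f "x" "[]"]
        cup_Cons[of "face_sum f"] cup_Cons[of "degree_sign f"] face_sum_add face_sum_scale
        cup_diff_left cup_minus_left degree_sign_def[of f "[x]"] algebra_simps)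
qed

section \<open>Prism operators as chain homotopies\<close>

definition prism :: "('g \<Rightarrow> 'h) \<Rightarrow> ('g \<Rightarrow> 'h) \<Rightarrow> ('h list \<Rightarrow> 'k::comm_ring_1) \<Rightarrow> 'g list \<Rightarrow> 'k" where
  "prism s s' f xs =
     (\<Sum>i<length xs. (- 1) ^ i * f (map s (take (Suc i) xs) @ map s' (drop i xs)))"

lemma prism_Nil [simp]: "prism s s' f [] = 0"
  by (simp add: prism_def)

lemma prism_Cons:
  "prism s s' f (x # xs) =
    f (s x # s' x # map s' xs) - prism s s' (\<lambda>ys. f (s x # ys)) xs"
  by (simp add: prism_def sum.lessThan_Suc_shift sum_negf del: sum.lessThan_Suc)

lemma prism_diff: "prism s s' (\<lambda>xs. f xs - g xs) xs = prism s s' f xs - prism s s' g xs"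
  by (simp add: prism_def right_diff_distrib sum_subtractf)

text \<open>The prism operator repeats one vertex, once under \<open>s\<close> and once under
  \<open>s'\<close>; in its boundary the inner faces cancel in pairs and the two ends remain. The
  identity concerns arbitrary functions, so it can be proved by freezing the first entry, and
  invariance of the homotopy becomes a separate question.\<close>

lemma face_sum_prism:
  "face_sum (prism s s' f) xs + prism s s' (face_sum f) xs = f (map s' xs) - f (map s xs)"
proof (induction xs arbitrary: f)
  case (Cons x xs)
  let ?f = "\<lambda>ys. f (s x # ys)" and ?f' = "\<lambda>ys. f (s x # s' x # ys)"
  have "(\<lambda>ys. prism s s' f (x # ys)) = (\<lambda>ys. ?f' (map s' ys) - prism s s' ?f ys)"
    by (simp add: prism_Cons)
  moreover have "(\<lambda>ys. face_sum f (s x # ys)) = (\<lambda>ys. f ys - face_sum ?f ys)"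
    by (simp add: face_sum_Cons)
  ultimately show ?case
    using Cons[of ?f]
    by (simp add: face_sum_Cons prism_Cons face_sum_diff prism_diff face_sum_map[of ?f']
        algebra_simps)
qed simp

section \<open>Cochains and cohomology classes\<close>

lemma cochainsI:
  assumes "\<And>xs. f xs \<noteq> 0 \<Longrightarrow> xs \<noteq> [] \<and> set xs \<subseteq> carrier G"
    and "\<And>xs. f xs \<noteq> 0 \<Longrightarrow> length xs \<le> b"
    and "\<And>g xs. g \<in> carrier G \<Longrightarrow> set xs \<subseteq> carrier G \<Longrightarrow> f (map (\<lambda>x. g \<otimes>\<^bsub>G\<^esub> x) xs) = f xs"
  shows "f \<in> cochains G"
  using assms unfolding cochains_def by blast

lemma cochains_outside: "f \<in> cochains G \<Longrightarrow> \<not> set xs \<subseteq> carrier G \<Longrightarrow> f xs = 0"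
  unfolding cochains_def by blast

lemma cochains_Nil: "f \<in> cochains G \<Longrightarrow> f [] = 0"
  unfolding cochains_def by blast

lemma cochains_bounded:
  assumes "f \<in> cochains G"
  obtains b where "\<And>xs. length xs > b \<Longrightarrow> f xs = 0"
proof -
  from assms obtain b where "\<forall>xs. f xs \<noteq> 0 \<longrightarrow> length xs \<le> b"
    unfolding cochains_def by blast
  then show ?thesis by (intro that[of b]) (auto simp: not_less[symmetric])
qed

lemma cochains_invariant:
  "f \<in> cochains G \<Longrightarrow> g \<in> carrier G \<Longrightarrow> set xs \<subseteq> carrier G \<Longrightarrow>
    f (map (\<lambda>x. g \<otimes>\<^bsub>G\<^esub> x) xs) = f xs"
  unfolding cochains_def by blast

lemma cochains_zero: "(\<lambda>_. 0) \<in> cochains G"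
  by (simp add: cochains_def)

lemma cochains_add:
  assumes f: "f \<in> cochains G" and g: "g \<in> cochains G"
  shows "(\<lambda>xs. f xs + g xs) \<in> cochains G"
proof -
  obtain b where b: "\<And>xs. length xs > b \<Longrightarrow> f xs = 0" using cochains_bounded[OF f] by blast
  obtain c where c: "\<And>xs. length xs > c \<Longrightarrow> g xs = 0" using cochains_bounded[OF g] by blast
  show ?thesis
  proof (rule cochainsI[where b = "max b c"])
    fix xs assume nz: "f xs + g xs \<noteq> 0"
    show "length xs \<le> max b c"
      using nz b[of xs] c[of xs] by (cases "length xs > b"; cases "length xs > c") auto
    show "xs \<noteq> [] \<and> set xs \<subseteq> carrier G"
      using nz cochains_outside[OF f, of xs] cochains_outside[OF g, of xs]
        cochains_Nil[OF f] cochains_Nil[OF g] by (metis add_0)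
  qed (simp add: cochains_invariant[OF f] cochains_invariant[OF g])
qed

lemma cochains_uminus: "f \<in> cochains G \<Longrightarrow> (\<lambda>xs. - f xs) \<in> cochains G"
  by (simp add: cochains_def)

lemma differential_add:
  "differential G (\<lambda>xs. f xs + g xs) = (\<lambda>xs. differential G f xs + differential G g xs)"
  by (auto simp: differential_face_sum face_sum_add)

lemma differential_uminus: "differential G (\<lambda>xs. - f xs) = (\<lambda>xs. - differential G f xs)"
  by (auto simp: differential_face_sum face_sum_uminus)

lemma differential_cong:
  assumes "\<And>xs. set xs \<subseteq> carrier G \<Longrightarrow> f xs = g xs"
  shows "differential G f = differential G g"
proof
  fix xs show "differential G f xs = differential G g xs"
    unfolding differential_face_sum by (auto intro!: face_sum_cong assms)
qed

lemma differential_differential: "differential G (differential G f) = (\<lambda>_. 0)"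
proof -
  have "differential G (differential G f) = differential G (face_sum f)"
    by (rule differential_cong) (simp add: differential_face_sum)
  then show ?thesis by (auto simp: differential_face_sum face_sum_face_sum)
qed

lemma (in monoid) differential_cochain:
  assumes f: "f \<in> cochains G"
  shows "differential G f \<in> cochains G"
proof -
  obtain b where b: "\<And>xs. length xs > b \<Longrightarrow> f xs = 0" using cochains_bounded[OF f] by blast
  show ?thesis
  proof (rule cochainsI[where b = "Suc b"])
    fix xs assume nz: "differential G f xs \<noteq> 0"
    then show "xs \<noteq> [] \<and> set xs \<subseteq> carrier G"
      by (auto simp: differential_face_sum split: if_splits)
    show "length xs \<le> Suc b"
    proof (rule ccontr)
      assume "\<not> length xs \<le> Suc b"
      then have "face_sum f xs = 0"
        unfolding face_sum_def by (intro sum.neutral ballI) (simp add: b)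
      then show False using nz by (simp add: differential_face_sum split: if_splits)
    qed
  next
    fix g xs assume g: "g \<in> carrier G" and xs: "set xs \<subseteq> carrier G"
    have "face_sum f (map (\<lambda>x. g \<otimes> x) xs) = face_sum f xs"
      unfolding face_sum_map[symmetric]
      by (rule face_sum_cong) (use g xs in \<open>auto intro: cochains_invariant[OF f]\<close>)
    moreover have "set (map (\<lambda>x. g \<otimes> x) xs) \<subseteq> carrier G" using g xs by auto
    ultimately show "differential G f (map (\<lambda>x. g \<otimes> x) xs) = differential G f xs"
      using xs by (simp only: differential_face_sum)
  qed
qed

lemma (in monoid) cup_cochain:
  assumes f: "f \<in> cochains G" and h: "h \<in> cochains G"
  shows "cup f h \<in> cochains G"
proof -
  obtain b where b: "\<And>xs. length xs > b \<Longrightarrow> f xs = 0" using cochains_bounded[OF f] by blast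
  obtain c where c: "\<And>xs. length xs > c \<Longrightarrow> h xs = 0" using cochains_bounded[OF h] by blast
  show ?thesis
  proof (rule cochainsI[where b = "b + c"])
    fix xs assume nz: "cup f h xs \<noteq> 0"
    then obtain i where i: "i < length xs" "f (take (Suc i) xs) \<noteq> 0" "h (drop i xs) \<noteq> 0"
      unfolding cup_def by (metis (no_types, lifting) lessThan_iff mult_zero_left mult_zero_right sum.neutral)
    have "set xs = set (take (Suc i) xs @ drop (Suc i) xs)" by simp
    also have "\<dots> \<subseteq> set (take (Suc i) xs) \<union> set (drop i xs)"
      using set_drop_subset_set_drop[of i "Suc i" xs] unfolding set_append by auto
    also have "\<dots> \<subseteq> carrier G"
      using i cochains_outside[OF f] cochains_outside[OF h] by blast
    finally show "xs \<noteq> [] \<and> set xs \<subseteq> carrier G" using i by auto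
    have "length (take (Suc i) xs) \<le> b" "length (drop i xs) \<le> c"
      using i b c by (meson not_le)+
    then show "length xs \<le> b + c" using i by simp
  next
    fix g xs assume g: "g \<in> carrier G" and xs: "set xs \<subseteq> carrier G"
    show "cup f h (map (\<lambda>x. g \<otimes> x) xs) = cup f h xs"
      unfolding cup_map[symmetric]
      by (rule cup_cong) (use g xs in \<open>auto intro: cochains_invariant[OF f] cochains_invariant[OF h]\<close>)
  qed
qed

lemma degree_sign_cochain:
  assumes f: "f \<in> cochains G"
  shows "degree_sign f \<in> cochains G"
proof -
  obtain b where b: "\<And>xs. length xs > b \<Longrightarrow> f xs = 0" using cochains_bounded[OF f] by blast
  have nz: "f xs \<noteq> 0" if "degree_sign f xs \<noteq> 0" for xs
    using that by (auto simp: degree_sign_def)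
  show ?thesis
  proof (rule cochainsI[where b = b])
    fix xs assume "degree_sign f xs \<noteq> 0"
    from nz[OF this] show "xs \<noteq> [] \<and> set xs \<subseteq> carrier G" "length xs \<le> b"
      using b cochains_Nil[OF f] cochains_outside[OF f] by (auto simp: not_less[symmetric])
  qed (simp add: degree_sign_def cochains_invariant[OF f])
qed

lemma face_sum_degree_sign:
  fixes f :: "'a list \<Rightarrow> 'b::comm_ring_1"
  shows "face_sum (degree_sign f) xs = - degree_sign (face_sum f) xs"
  unfolding face_sum_def degree_sign_def sum_distrib_left sum_negf[symmetric]
proof (rule sum.cong)
  have sign: "a * ((- 1) ^ Suc n * c) = - ((- 1) ^ Suc (Suc n) * (a * c))" for a c :: 'b and n
    by (simp add: mult.left_commute)
  fix i assume "i \<in> {..<length xs}"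
  then have l: "length xs = Suc (length (take i xs @ drop (Suc i) xs))" by auto
  show "(- 1) ^ i * ((- 1) ^ Suc (length (take i xs @ drop (Suc i) xs))
      * f (take i xs @ drop (Suc i) xs))
    = - ((- 1) ^ Suc (length xs) * ((- 1) ^ i * f (take i xs @ drop (Suc i) xs)))"
    unfolding l by (rule sign)
qed simp

lemma cup_outside:
  assumes xs: "\<not> set xs \<subseteq> A" and f: "\<And>ys. \<not> set ys \<subseteq> A \<Longrightarrow> f ys = 0"
    and h: "\<And>ys. \<not> set ys \<subseteq> A \<Longrightarrow> h ys = 0"
  shows "cup f h xs = 0"
  unfolding cup_def
proof (intro sum.neutral ballI)
  fix i
  have "set xs \<subseteq> set (take (Suc i) xs) \<union> set (drop i xs)"
    using set_drop_subset_set_drop[of i "Suc i" xs]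
    by (metis append_take_drop_id le_add2 plus_1_eq_Suc set_append sup.mono order_refl)
  then have "\<not> set (take (Suc i) xs) \<subseteq> A \<or> \<not> set (drop i xs) \<subseteq> A"
    using xs by blast
  then show "f (take (Suc i) xs) * h (drop i xs) = 0"
    using f h by (elim disjE) simp_all
qed

lemma differential_cup:
  fixes f h :: "'a list \<Rightarrow> 'b::comm_ring_1"
  assumes f: "f \<in> cochains G" and h: "h \<in> cochains G"
  shows "differential G (cup f h) =
    (\<lambda>xs. cup (differential G f) h xs + cup (degree_sign f) (differential G h) xs)"
proof
  fix xs
  show "differential G (cup f h) xs =
    cup (differential G f) h xs + cup (degree_sign f) (differential G h) xs"
  proof (cases "set xs \<subseteq> carrier G")
    case True
    have "cup (differential G f) h xs = cup (face_sum f) h xs"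
      "cup (degree_sign f) (differential G h) xs = cup (degree_sign f) (face_sum h) xs"
      by (rule cup_cong; use True in \<open>auto simp: differential_face_sum\<close>)+
    then show ?thesis
      using True face_sum_cup[of h f xs] cochains_Nil[OF f] cochains_Nil[OF h]
      by (simp add: differential_face_sum)
  next
    case False
    have "cup (differential G f) h xs = 0" "cup (degree_sign f) (differential G h) xs = 0"
      by (intro cup_outside[OF False] cochains_outside[OF h] cochains_outside[OF degree_sign_cochain[OF f]];
        simp add: differential_face_sum)+
    then show ?thesis using False by (simp add: differential_face_sum)
  qed
qed

section \<open>Cocycles, coboundaries and products of classes\<close>

abbreviation cocycles :: "('g, 'm) monoid_scheme \<Rightarrow> ('g list \<Rightarrow> 'k::comm_ring_1) set" where
  "cocycles G \<equiv> carrier (cocycle_ring G)"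

lemma cocycles_iff: "f \<in> cocycles G \<longleftrightarrow> f \<in> cochains G \<and> differential G f = (\<lambda>_. 0)"
  by (simp add: cocycle_ring_def)

lemma cocycles_add:
  assumes "f \<in> cocycles G" "g \<in> cocycles G"
  shows "(\<lambda>xs. f xs + g xs) \<in> cocycles G"
  using assms cochains_add by (auto simp: cocycles_iff differential_add)

lemma coboundaries_zero: "(\<lambda>_. 0) \<in> coboundaries G"
  unfolding coboundaries_def
  by (rule image_eqI[OF _ cochains_zero]) (auto simp: differential_face_sum)

lemma coboundaries_add:
  assumes "f \<in> coboundaries G" "g \<in> coboundaries G"
  shows "(\<lambda>xs. f xs + g xs) \<in> coboundaries G"
  using assms unfolding coboundaries_def
  by (auto simp flip: differential_add intro!: imageI cochains_add)

lemma coboundaries_uminus: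
  assumes "f \<in> coboundaries G"
  shows "(\<lambda>xs. - f xs) \<in> coboundaries G"
  using assms unfolding coboundaries_def
  by (auto simp flip: differential_uminus intro!: imageI cochains_uminus)

lemma coboundaries_diff:
  assumes "f \<in> coboundaries G" "g \<in> coboundaries G"
  shows "(\<lambda>xs. f xs - g xs) \<in> coboundaries G"
  using coboundaries_add[OF assms(1) coboundaries_uminus[OF assms(2)]] by simp

lemma (in monoid) coboundaries_cocycles: "coboundaries G \<subseteq> cocycles G"
  by (auto simp: coboundaries_def cocycles_iff differential_differential differential_cochain)

lemma (in monoid) cup_cocycle:
  assumes "f \<in> cocycles G" "h \<in> cocycles G"
  shows "cup f h \<in> cocycles G"
  using assms by (auto simp: cocycles_iff cup_cochain differential_cup)

lemma (in monoid) cup_coboundary_left: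
  assumes f: "f \<in> coboundaries G" and h: "h \<in> cocycles G"
  shows "cup f h \<in> coboundaries G"
proof -
  obtain u where u: "u \<in> cochains G" "f = differential G u" using f by (auto simp: coboundaries_def)
  have "cup f h = differential G (cup u h)"
    using u h by (subst differential_cup) (auto simp: cocycles_iff)
  then show ?thesis using u h cup_cochain by (auto simp: coboundaries_def cocycles_iff)
qed

text \<open>The sign in the Leibniz rule is moved to the other side: the twist of a cocycle by
  \<open>degree_sign\<close> is again a cocycle and twisting twice is the identity, so f cup du is
  the differential of the twisted f cup u.\<close>

lemma (in monoid) cup_coboundary_right:
  assumes f: "f \<in> cocycles G" and h: "h \<in> coboundaries G"
  shows "cup f h \<in> coboundaries G"
proof -
  obtain u where u: "u \<in> cochains G" "h = differential G u" using h by (auto simp: coboundaries_def)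
  have s: "degree_sign f \<in> cochains G" using f by (simp add: cocycles_iff degree_sign_cochain)
  have ss: "degree_sign (degree_sign f) = f"
    by (auto simp: degree_sign_def minus_one_power_iff)
  have z: "face_sum f xs = 0" if "set xs \<subseteq> carrier G" for xs
    using f that unfolding cocycles_iff by (metis differential_face_sum)
  then have "differential G (degree_sign f) = (\<lambda>_. 0)"
    by (auto simp: differential_face_sum face_sum_degree_sign z degree_sign_def[of "face_sum f"])
  then have "cup f h = differential G (cup (degree_sign f) u)"
    using u s by (subst differential_cup) (auto simp: ss)
  then show ?thesis using u s cup_cochain by (auto simp: coboundaries_def)
qed

lemma cohomology_class_eq:
  "cohomology_class G f = {(\<lambda>xs. b xs + f xs) | b. b \<in> coboundaries G}"
  by (auto simp: cohomology_class_def a_r_coset_def r_coset_def cocycle_ring_def)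

lemma cohomology_class_self: "f \<in> cohomology_class G f"
  unfolding cohomology_class_eq using coboundaries_zero by force

lemma cohomology_class_eq_iff:
  "cohomology_class G f = cohomology_class G g \<longleftrightarrow> (\<lambda>xs. f xs - g xs) \<in> coboundaries G"
proof
  assume "cohomology_class G f = cohomology_class G g"
  then obtain b where "b \<in> coboundaries G" "f = (\<lambda>xs. b xs + g xs)"
    using cohomology_class_self[of f G] unfolding cohomology_class_eq by auto
  then show "(\<lambda>xs. f xs - g xs) \<in> coboundaries G" by simp
next
  assume d: "(\<lambda>xs. f xs - g xs) \<in> coboundaries G"
  show "cohomology_class G f = cohomology_class G g"
  proof (rule subset_antisym; rule subsetI)
    fix u assume "u \<in> cohomology_class G f"
    then obtain b where "b \<in> coboundaries G" "u = (\<lambda>xs. b xs + f xs)"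
      unfolding cohomology_class_eq by auto
    then show "u \<in> cohomology_class G g"
      unfolding cohomology_class_eq using coboundaries_add[OF _ d]
      by (intro CollectI exI[of _ "\<lambda>xs. b xs + (f xs - g xs)"]) auto
  next
    fix u assume "u \<in> cohomology_class G g"
    then obtain b where "b \<in> coboundaries G" "u = (\<lambda>xs. b xs + g xs)"
      unfolding cohomology_class_eq by auto
    then show "u \<in> cohomology_class G f"
      unfolding cohomology_class_eq using coboundaries_diff[OF _ d]
      by (intro CollectI exI[of _ "\<lambda>xs. b xs - (f xs - g xs)"]) auto
  qed
qed

lemma cohomology_class_eqI:
  assumes "\<And>xs. f xs - g xs = b xs" "b \<in> coboundaries G"
  shows "cohomology_class G f = cohomology_class G g"
  using assms by (simp add: cohomology_class_eq_iff)

lemma zero_cohomology: "\<zero>\<^bsub>cohomology G\<^esub> = cohomology_class G (\<lambda>_. 0)"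
  by (auto simp: cohomology_def FactRing_def cohomology_class_eq)

lemma one_cohomology: "\<one>\<^bsub>cohomology G\<^esub> = cohomology_class G \<one>\<^bsub>cocycle_ring G\<^esub>"
  by (simp add: cohomology_def FactRing_def cohomology_class_def)

lemma carrier_cohomology: "carrier (cohomology G) = cohomology_class G ` cocycles G"
  by (auto simp: cohomology_def FactRing_def A_RCOSETS_def RCOSETS_def cohomology_class_def a_r_coset_def)

text \<open>Products in the quotient ring are unions over all pairs of representatives. They
  collapse to one coset because (b + f)(c + h) - f h = b (c + h) + f c, where b and c are
  coboundaries and both summands on the right are products of a coboundary and a cocycle.\<close>

lemma (in monoid) mult_cohomology:
  assumes f: "f \<in> cocycles G" and h: "h \<in> cocycles G"
  shows "cohomology_class G f \<otimes>\<^bsub>cohomology G\<^esub> cohomology_class G h = cohomology_class G (cup f h)"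
proof -
  have rep: "cohomology_class G (cup u v) = cohomology_class G (cup f h)"
    if u: "u \<in> cohomology_class G f" and v: "v \<in> cohomology_class G h" for u v
  proof -
    obtain b where b: "b \<in> coboundaries G" "u = (\<lambda>xs. b xs + f xs)"
      using u unfolding cohomology_class_eq by auto
    obtain c where c: "c \<in> coboundaries G" "v = (\<lambda>xs. c xs + h xs)"
      using v unfolding cohomology_class_eq by auto
    have v': "v \<in> cocycles G" using c h coboundaries_cocycles by (auto intro: cocycles_add)
    show ?thesis
    proof (rule cohomology_class_eqI)
      show "cup u v xs - cup f h xs = cup b v xs + cup f c xs" for xs
        unfolding b c(2) by (simp add: cup_add_left cup_add_right)
      show "(\<lambda>xs. cup b v xs + cup f c xs) \<in> coboundaries G"
        using b c f v' by (intro coboundaries_add cup_coboundary_left cup_coboundary_right)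
    qed
  qed
  have "cohomology_class G f \<otimes>\<^bsub>cohomology G\<^esub> cohomology_class G h =
      (\<Union>u\<in>cohomology_class G f. \<Union>v\<in>cohomology_class G h. cohomology_class G (cup u v))"
    by (simp add: cohomology_def FactRing_def rcoset_mult_def cohomology_class_def cocycle_ring_def)
  also have "\<dots> = (\<Union>u\<in>cohomology_class G f. \<Union>v\<in>cohomology_class G h. cohomology_class G (cup f h))"
    by (intro SUP_cong refl rep)
  also have "\<dots> = cohomology_class G (cup f h)"
  proof -
    have "cohomology_class G f \<noteq> {}" "cohomology_class G h \<noteq> {}"
      using cohomology_class_self by fast+
    then show ?thesis by simp
  qed
  finally show ?thesis .
qed

lemma on_classes_cohomology_class:
  assumes "\<And>b. b \<in> coboundaries H \<Longrightarrow>
    cohomology_class G (T (\<lambda>xs. b xs + f xs)) = cohomology_class G (T f)"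
  shows "on_classes G T (cohomology_class H f) = cohomology_class G (T f)"
  unfolding on_classes_def using assms cohomology_class_self[of f H]
  by (auto simp: cohomology_class_eq[of H])

section \<open>Operations given by equivariant families of maps\<close>

text \<open>A single summand need not be invariant: translation by \<open>g\<close> turns the
  summand of \<open>C\<close> into the one of \<open>\<tau> g C\<close>, and only the sum over
  \<open>X\<close> is unaffected. The summands are arbitrary because the lemma is applied both to
  family sums and to sums of prisms.\<close>

lemma twisted_sum_cochain:
  assumes "\<And>C. C \<in> X \<Longrightarrow> F C [] = 0" and "\<And>C xs. C \<in> X \<Longrightarrow> length xs > b \<Longrightarrow> F C xs = 0"
    and twist: "\<And>g C xs. g \<in> carrier G \<Longrightarrow> C \<in> X \<Longrightarrow> set xs \<subseteq> carrier G \<Longrightarrow>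
      F C (map (\<lambda>x. g \<otimes>\<^bsub>G\<^esub> x) xs) = F (\<tau> g C) xs"
    and bij: "\<And>g. g \<in> carrier G \<Longrightarrow> bij_betw (\<tau> g) X X"
    and G: "monoid G"
  shows "(\<lambda>xs. if set xs \<subseteq> carrier G then \<Sum>C\<in>X. F C xs else 0) \<in> cochains G"
proof (rule cochainsI[where b = b])
  fix xs assume nz: "(if set xs \<subseteq> carrier G then \<Sum>C\<in>X. F C xs else 0) \<noteq> 0"
  then show "xs \<noteq> [] \<and> set xs \<subseteq> carrier G"
    using assms(1) by (auto split: if_splits)
  show "length xs \<le> b"
    using nz assms(2)[of _ xs] by (meson not_le sum.neutral)
next
  fix g xs assume g: "g \<in> carrier G" and xs: "set xs \<subseteq> carrier G"
  have "(\<Sum>C\<in>X. F C (map (\<lambda>x. g \<otimes>\<^bsub>G\<^esub> x) xs)) = (\<Sum>C\<in>X. F (\<tau> g C) xs)"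
    by (intro sum.cong refl twist g xs)
  also have "\<dots> = (\<Sum>C\<in>X. F C xs)"
    by (rule sum.reindex_bij_betw[OF bij[OF g]])
  finally show "(if set (map (\<lambda>x. g \<otimes>\<^bsub>G\<^esub> x) xs) \<subseteq> carrier G
      then \<Sum>C\<in>X. F C (map (\<lambda>x. g \<otimes>\<^bsub>G\<^esub> x) xs) else 0) =
      (if set xs \<subseteq> carrier G then \<Sum>C\<in>X. F C xs else 0)"
    using g xs monoid.m_closed[OF G] by auto
qed

definition family_sum ::
  "('g, 'm) monoid_scheme \<Rightarrow> 'x set \<Rightarrow> ('x \<Rightarrow> 'g \<Rightarrow> 'h) \<Rightarrow> ('h list \<Rightarrow> 'k::comm_ring_1) \<Rightarrow> 'g list \<Rightarrow> 'k"
  where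
  "family_sum G X s f xs = (if set xs \<subseteq> carrier G then \<Sum>C\<in>X. f (map (s C) xs) else 0)"

text \<open>The common shape of a pullback (one index, \<open>a\<close> the homomorphism) and a
  transfer (indices the cosets, \<open>a\<close> the multiplier in the subgroup). A translation by
  \<open>g\<close> on the source permutes the indices and multiplies from the left by
  \<open>a g C\<close> on the target, where the invariance of cochains absorbs it.\<close>

definition equivariant_family ::
  "('g, 'm) monoid_scheme \<Rightarrow> ('h, 'n) monoid_scheme \<Rightarrow> 'x set \<Rightarrow> ('g \<Rightarrow> 'x \<Rightarrow> 'x) \<Rightarrow>
   ('g \<Rightarrow> 'x \<Rightarrow> 'h) \<Rightarrow> ('x \<Rightarrow> 'g \<Rightarrow> 'h) \<Rightarrow> bool" where
  "equivariant_family G H X \<tau> a s \<longleftrightarrow>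
     (\<forall>C\<in>X. \<forall>x\<in>carrier G. s C x \<in> carrier H) \<and>
     (\<forall>g\<in>carrier G. bij_betw (\<tau> g) X X \<and>
        (\<forall>C\<in>X. a g C \<in> carrier H \<and> (\<forall>x\<in>carrier G. s C (g \<otimes>\<^bsub>G\<^esub> x) = a g C \<otimes>\<^bsub>H\<^esub> s (\<tau> g C) x)))"

lemma equivariant_familyI:
  assumes "\<And>C x. C \<in> X \<Longrightarrow> x \<in> carrier G \<Longrightarrow> s C x \<in> carrier H"
    and "\<And>g. g \<in> carrier G \<Longrightarrow> bij_betw (\<tau> g) X X"
    and "\<And>g C. g \<in> carrier G \<Longrightarrow> C \<in> X \<Longrightarrow> a g C \<in> carrier H"
    and "\<And>g C x. g \<in> carrier G \<Longrightarrow> C \<in> X \<Longrightarrow> x \<in> carrier G \<Longrightarrow>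
      s C (g \<otimes>\<^bsub>G\<^esub> x) = a g C \<otimes>\<^bsub>H\<^esub> s (\<tau> g C) x"
  shows "equivariant_family G H X \<tau> a s"
  using assms by (simp add: equivariant_family_def)

lemma equivariant_familyD:
  assumes "equivariant_family G H X \<tau> a s"
  shows "C \<in> X \<Longrightarrow> x \<in> carrier G \<Longrightarrow> s C x \<in> carrier H"
    and "g \<in> carrier G \<Longrightarrow> bij_betw (\<tau> g) X X"
    and "g \<in> carrier G \<Longrightarrow> C \<in> X \<Longrightarrow> \<tau> g C \<in> X"
    and "g \<in> carrier G \<Longrightarrow> C \<in> X \<Longrightarrow> a g C \<in> carrier H"
    and "g \<in> carrier G \<Longrightarrow> C \<in> X \<Longrightarrow> x \<in> carrier G \<Longrightarrow>
      s C (g \<otimes>\<^bsub>G\<^esub> x) = a g C \<otimes>\<^bsub>H\<^esub> s (\<tau> g C) x"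
  using assms by (auto simp: equivariant_family_def dest: bij_betw_apply)

lemma equivariant_family_set:
  assumes "equivariant_family G H X \<tau> a s" "C \<in> X" "set xs \<subseteq> carrier G"
  shows "set (map (s C) xs) \<subseteq> carrier H"
  using equivariant_familyD(1)[OF assms(1,2)] assms(3) by auto

lemma equivariant_family_map:
  assumes "equivariant_family G H X \<tau> a s" "g \<in> carrier G" "C \<in> X" "set xs \<subseteq> carrier G"
  shows "map (s C) (map (\<lambda>x. g \<otimes>\<^bsub>G\<^esub> x) xs) = map (\<lambda>y. a g C \<otimes>\<^bsub>H\<^esub> y) (map (s (\<tau> g C)) xs)"
  using equivariant_familyD(5)[OF assms(1-3)] assms(4) by auto

lemma family_sum_cochain:
  assumes s: "equivariant_family G H X \<tau> a s" and f: "f \<in> cochains H" and G: "monoid G"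
  shows "family_sum G X s f \<in> cochains G"
proof -
  obtain b where b: "\<And>xs. length xs > b \<Longrightarrow> f xs = 0" using cochains_bounded[OF f] by blast
  show ?thesis
    unfolding family_sum_def
  proof (rule twisted_sum_cochain[where b = b and \<tau> = \<tau>])
    fix g C xs assume "g \<in> carrier G" "C \<in> X" "set xs \<subseteq> carrier G"
    then show "f (map (s C) (map (\<lambda>x. g \<otimes>\<^bsub>G\<^esub> x) xs)) = f (map (s (\<tau> g C)) xs)"
      unfolding equivariant_family_map[OF s \<open>g \<in> carrier G\<close> \<open>C \<in> X\<close> \<open>set xs \<subseteq> carrier G\<close>]
      using equivariant_familyD(3,4)[OF s]
      by (intro cochains_invariant[OF f] equivariant_family_set[OF s])
  qed (use b cochains_Nil[OF f] G equivariant_familyD(2)[OF s] in auto)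
qed

lemma family_sum_differential:
  assumes s: "equivariant_family G H X \<tau> a s"
  shows "family_sum G X s (differential H f) = differential G (family_sum G X s f)"
proof
  fix xs
  show "family_sum G X s (differential H f) xs = differential G (family_sum G X s f) xs"
  proof (cases "set xs \<subseteq> carrier G")
    case True
    have "face_sum (family_sum G X s f) xs = face_sum (\<lambda>ys. \<Sum>C\<in>X. f (map (s C) ys)) xs"
      by (rule face_sum_cong) (use True in \<open>auto simp: family_sum_def\<close>)
    also have "\<dots> = (\<Sum>C\<in>X. differential H f (map (s C) xs))"
      unfolding face_sum_sum face_sum_map differential_face_sum
      using equivariant_family_set[OF s _ True] by (intro sum.cong refl) simp
    finally show ?thesis
      using True by (simp add: family_sum_def differential_face_sum)
  qed (simp add: family_sum_def differential_face_sum)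
qed

lemma family_sum_add:
  "family_sum G X s (\<lambda>xs. f xs + h xs) xs = family_sum G X s f xs + family_sum G X s h xs"
  by (simp add: family_sum_def sum.distrib)

lemma family_sum_zero [simp]: "family_sum G X s (\<lambda>_. 0) = (\<lambda>_. 0)"
  by (simp add: family_sum_def fun_eq_iff)

lemma family_sum_cocycle:
  assumes "equivariant_family G H X \<tau> a s" "f \<in> cocycles H" "monoid G"
  shows "family_sum G X s f \<in> cocycles G"
  using assms family_sum_cochain[OF assms(1), of f] family_sum_differential[OF assms(1), of f]
  by (simp add: cocycles_iff)

lemma family_sum_coboundary:
  assumes s: "equivariant_family G H X \<tau> a s" and b: "b \<in> coboundaries H" and G: "monoid G"
  shows "family_sum G X s b \<in> coboundaries G"
  using b family_sum_differential[OF s] family_sum_cochain[OF s _ G]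
  unfolding coboundaries_def by auto

lemma on_classes_family_sum:
  assumes s: "equivariant_family G H X \<tau> a s" and G: "monoid G"
  shows "on_classes G (family_sum G X s) (cohomology_class H f) = cohomology_class G (family_sum G X s f)"
proof (rule on_classes_cohomology_class, rule cohomology_class_eqI)
  fix b assume "b \<in> coboundaries H"
  then show "family_sum G X s b \<in> coboundaries G" by (rule family_sum_coboundary[OF s _ G])
qed (simp add: family_sum_add)

text \<open>Two families that are equivariant for the same permutations \<open>\<tau>\<close> and multipliers \<open>a\<close> give
  chain homotopic maps, since the prism operators of the members add up to a \<open>G\<close>-invariant one.\<close>

lemma family_sum_homotopy:
  assumes s: "equivariant_family G H X \<tau> a s" and s': "equivariant_family G H X \<tau> a s'"
    and f: "f \<in> cocycles H" and G: "monoid G"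
  shows "cohomology_class G (family_sum G X s f) = cohomology_class G (family_sum G X s' f)"
proof -
  have fc: "f \<in> cochains H" using f by (simp add: cocycles_iff)
  have df: "face_sum f ys = 0" if "set ys \<subseteq> carrier H" for ys
    using f that unfolding cocycles_iff by (metis differential_face_sum)
  obtain b where b: "\<And>xs. length xs > b \<Longrightarrow> f xs = 0" using cochains_bounded[OF fc] by blast
  have mem: "set (map (s C) (take (Suc i) xs) @ map (s' C) (drop i xs)) \<subseteq> carrier H"
    if "C \<in> X" "set xs \<subseteq> carrier G" for C i xs
  proof -
    have "set (take (Suc i) xs) \<subseteq> carrier G" "set (drop i xs) \<subseteq> carrier G"
      using that(2) set_take_subset[of "Suc i" xs] set_drop_subset[of i xs] by blast+
    then show ?thesis
      using equivariant_family_set[OF s that(1)] equivariant_family_set[OF s' that(1)] by simp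
  qed
  define D where "D xs = (if set xs \<subseteq> carrier G then \<Sum>C\<in>X. prism (s C) (s' C) f xs else 0)" for xs
  have D: "D \<in> cochains G"
    unfolding D_def[abs_def]
  proof (rule twisted_sum_cochain[where b = b and \<tau> = \<tau>])
    fix C xs assume "length (xs :: 'a list) > b"
    then show "prism (s C) (s' C) f xs = 0"
      unfolding prism_def by (intro sum.neutral ballI) (simp add: b)
  next
    fix g C xs assume g: "g \<in> carrier G" and C: "C \<in> X" and xs: "set xs \<subseteq> carrier G"
    \<comment> \<open>A prism tuple mixes values of \<open>s\<close> and \<open>s'\<close>. Both
      pick up the same left factor \<open>a g C\<close>, so the tuple for \<open>\<tau> g C\<close>
      is translated as a whole, which \<open>f\<close> does not notice.\<close>
    have "f (map (s C) (take (Suc i) (map (\<lambda>x. g \<otimes>\<^bsub>G\<^esub> x) xs)) @ map (s' C) (drop i (map (\<lambda>x. g \<otimes>\<^bsub>G\<^esub> x) xs))) =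
        f (map (s (\<tau> g C)) (take (Suc i) xs) @ map (s' (\<tau> g C)) (drop i xs))" for i
    proof -
      have sub: "set (take (Suc i) xs) \<subseteq> carrier G" "set (drop i xs) \<subseteq> carrier G"
        using xs set_take_subset[of "Suc i" xs] set_drop_subset[of i xs] by blast+
      show ?thesis
        unfolding take_map drop_map equivariant_family_map[OF s g C sub(1)]
          equivariant_family_map[OF s' g C sub(2)] map_append[symmetric]
        by (intro cochains_invariant[OF fc] mem equivariant_familyD(3,4)[OF s] g C xs)
    qed
    then show "prism (s C) (s' C) f (map (\<lambda>x. g \<otimes>\<^bsub>G\<^esub> x) xs) = prism (s (\<tau> g C)) (s' (\<tau> g C)) f xs"
      by (simp add: prism_def)
  qed (use G equivariant_familyD(2)[OF s] in auto)
  show ?thesis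
  proof (rule cohomology_class_eqI[symmetric])
    show "differential G D \<in> coboundaries G" using D by (simp add: coboundaries_def)
    show "family_sum G X s' f xs - family_sum G X s f xs = differential G D xs" for xs
    proof (cases "set xs \<subseteq> carrier G")
      case True
      have prism0: "prism (s C) (s' C) (face_sum f) xs = 0" if "C \<in> X" for C
        unfolding prism_def by (intro sum.neutral ballI) (simp add: df[OF mem[OF that True]])
      have "face_sum D xs = face_sum (\<lambda>ys. \<Sum>C\<in>X. prism (s C) (s' C) f ys) xs"
        by (rule face_sum_cong) (use True in \<open>auto simp: D_def\<close>)
      also have "\<dots> = (\<Sum>C\<in>X. f (map (s' C) xs) - f (map (s C) xs))"
        unfolding face_sum_sum
        by (intro sum.cong refl) (simp add: face_sum_prism[symmetric] prism0)
      finally show ?thesis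
        using True by (simp add: family_sum_def differential_face_sum sum_subtractf)
    qed (simp add: family_sum_def differential_face_sum)
  qed
qed

section \<open>Pullbacks and the truncation to positive degrees\<close>

definition pullback_cochain ::
  "('g, 'm) monoid_scheme \<Rightarrow> ('g \<Rightarrow> 'h) \<Rightarrow> ('h list \<Rightarrow> 'k::comm_ring_1) \<Rightarrow> 'g list \<Rightarrow> 'k" where
  "pullback_cochain G \<phi> f xs = (if set xs \<subseteq> carrier G then f (map \<phi> xs) else 0)"

lemma pullback_cochain_family_sum: "pullback_cochain G \<phi> = family_sum G {()} (\<lambda>_. \<phi>)"
  by (simp add: pullback_cochain_def family_sum_def fun_eq_iff)

lemma equivariant_family_hom:
  assumes "\<phi> \<in> hom G H"
  shows "equivariant_family G H {()} (\<lambda>_ C. C) (\<lambda>g _. \<phi> g) (\<lambda>_. \<phi>)"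
  using assms by (auto simp: equivariant_family_def hom_def Pi_iff bij_betw_def)

lemma pullback_cohomology_class:
  assumes "\<phi> \<in> hom G H" "monoid G"
  shows "pullback G \<phi> (cohomology_class H f) = cohomology_class G (pullback_cochain G \<phi> f)"
  using on_classes_family_sum[OF equivariant_family_hom[OF assms(1)] assms(2)]
  by (simp add: pullback_def pullback_cochain_family_sum[symmetric] pullback_cochain_def[abs_def])

lemma pullback_cochain_cocycle:
  assumes "\<phi> \<in> hom G H" "monoid G" "f \<in> cocycles H"
  shows "pullback_cochain G \<phi> f \<in> cocycles G"
  unfolding pullback_cochain_family_sum
  by (rule family_sum_cocycle[OF equivariant_family_hom[OF assms(1)] assms(3,2)])

text \<open>Dropping degree 0 commutes with the differential because the differential from degree 0
  to degree 1 is zero: an invariant function of one group element is constant. Degree at least 1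
  means length at least 2.\<close>

lemma positive_part_cohomology_class:
  fixes G :: "('a, 'm) monoid_scheme" and f :: "'a list \<Rightarrow> 'c::comm_ring_1"
  assumes G: "group G" and f: "f \<in> cocycles G"
  obtains f' where "f' \<in> cocycles G" "positive_part G (cohomology_class G f) = cohomology_class G f'"
proof -
  interpret group G by fact
  define T where "T f xs = (if length xs \<ge> 2 then f xs else 0)" for f :: "'a list \<Rightarrow> 'c" and xs
  have T_cochain: "T h \<in> cochains G" if "h \<in> cochains G" for h
    using that unfolding cochains_def T_def by auto
  have T_differential: "differential G (T h) = T (differential G h)" if h: "h \<in> cochains G" for h
  proof
    fix xs :: "'a list"
    consider "length xs \<le> 1" | "length xs = 2" | "length xs \<ge> 3" by linarith
    then show "differential G (T h) xs = T (differential G h) xs"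
    proof cases
      case 1
      then show ?thesis
        by (auto simp: differential_face_sum T_def face_sum_def intro!: sum.neutral)
    next
      case 2
      then obtain x y where xs: "xs = [x, y]"
        by (auto simp: numeral_2_eq_2 length_Suc_conv)
      have "h [x] = h [y]" if "x \<in> carrier G" "y \<in> carrier G"
        using cochains_invariant[OF h, of "x \<otimes>\<^bsub>G\<^esub> inv\<^bsub>G\<^esub> y" "[y]"] that by (simp add: m_assoc)
      then show ?thesis
        by (simp add: xs differential_face_sum face_sum_Cons T_def)
    next
      case 3
      then have "face_sum (T h) xs = face_sum h xs"
        unfolding face_sum_def by (intro sum.cong refl) (auto simp: T_def)
      then show ?thesis using 3 by (simp add: differential_face_sum T_def)
    qed
  qed
  show ?thesis
  proof (rule that)
    show "T f \<in> cocycles G"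
      using f T_cochain[of f] T_differential[of f] by (auto simp: cocycles_iff T_def[of "\<lambda>_. 0"])
    have "positive_part G (cohomology_class G f) = on_classes G T (cohomology_class G f)"
      by (simp add: positive_part_def T_def[abs_def])
    also have "\<dots> = cohomology_class G (T f)"
    proof (rule on_classes_cohomology_class, rule cohomology_class_eqI)
      fix b :: "'a list \<Rightarrow> 'c" assume "b \<in> coboundaries G"
      then show "T b \<in> coboundaries G"
        using T_cochain T_differential unfolding coboundaries_def by (auto simp flip: T_differential)
      show "T (\<lambda>xs. b xs + f xs) xs - T f xs = T b xs" for xs by (simp add: T_def)
    qed
    finally show "positive_part G (cohomology_class G f) = cohomology_class G (T f)" .
  qed
qed

lemma (in monoid) one_cocycle: "(\<one>\<^bsub>cocycle_ring G\<^esub> :: 'a list \<Rightarrow> 'k::comm_ring_1) \<in> cocycles G"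
proof -
  let ?u = "\<one>\<^bsub>cocycle_ring G\<^esub> :: 'a list \<Rightarrow> 'k"
  have u: "?u xs = (if length xs = 1 \<and> set xs \<subseteq> carrier G then 1 else 0)" for xs
    by (simp add: cocycle_ring_def)
  have "?u \<in> cochains G"
    by (rule cochainsI[where b = 1]) (auto simp: u split: if_splits)
  moreover have "differential G ?u xs = 0" for xs
  proof (cases "\<exists>x y zs. xs = x # y # zs")
    case True
    then obtain x y zs where xs: "xs = x # y # zs" by blast
    show ?thesis by (simp add: xs differential_face_sum face_sum_Cons u)
  next
    case False
    then have "xs = [] \<or> (\<exists>x. xs = [x])" by (metis list.exhaust)
    then show ?thesis by (auto simp: differential_face_sum face_sum_Cons u)
  qed
  ultimately show ?thesis by (auto simp: cocycles_iff)
qed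

section \<open>Powers of classes and nilpotence\<close>

primrec cup_power ::
  "('g, 'm) monoid_scheme \<Rightarrow> ('g list \<Rightarrow> 'k::comm_ring_1) \<Rightarrow> nat \<Rightarrow> 'g list \<Rightarrow> 'k" where
  "cup_power G f 0 = \<one>\<^bsub>cocycle_ring G\<^esub>"
| "cup_power G f (Suc k) = cup (cup_power G f k) f"

lemma (in monoid) cup_power_cocycle: "f \<in> cocycles G \<Longrightarrow> cup_power G f k \<in> cocycles G"
  by (induction k) (simp_all add: one_cocycle cup_cocycle)

lemma (in monoid) cohomology_class_power:
  assumes "f \<in> cocycles G"
  shows "cohomology_class G f [^]\<^bsub>cohomology G\<^esub> k = cohomology_class G (cup_power G f k)"
proof (induction k)
  case 0
  show ?case by (simp add: nat_pow_def one_cohomology)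
next
  case (Suc k)
  then show ?case
    using mult_cohomology[OF cup_power_cocycle[OF assms] assms] by (simp add: nat_pow_def)
qed

lemma pullback_cochain_cup:
  "pullback_cochain G \<phi> (cup f h) = cup (pullback_cochain G \<phi> f) (pullback_cochain G \<phi> h)"
proof
  fix xs
  show "pullback_cochain G \<phi> (cup f h) xs = cup (pullback_cochain G \<phi> f) (pullback_cochain G \<phi> h) xs"
  proof (cases "set xs \<subseteq> carrier G")
    case True
    have "cup (pullback_cochain G \<phi> f) (pullback_cochain G \<phi> h) xs =
        cup (\<lambda>ys. f (map \<phi> ys)) (\<lambda>ys. h (map \<phi> ys)) xs"
      by (rule cup_cong) (use True in \<open>auto simp: pullback_cochain_def\<close>)
    then show ?thesis using True by (simp add: cup_map pullback_cochain_def)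
  next
    case False
    then show ?thesis
      by (simp add: pullback_cochain_def cup_outside[OF False])
  qed
qed

lemma pullback_cochain_power:
  assumes "\<phi> \<in> hom G H"
  shows "pullback_cochain G \<phi> (cup_power H f k) = cup_power G (pullback_cochain G \<phi> f) k"
proof (induction k)
  case 0
  have "\<phi> x \<in> carrier H" if "x \<in> carrier G" for x using assms that by (auto simp: hom_def)
  then show ?case by (auto simp: pullback_cochain_def cocycle_ring_def fun_eq_iff)
qed (simp add: pullback_cochain_cup)

lemma pullback_zero:
  assumes "\<phi> \<in> hom G H" "monoid G"
  shows "pullback G \<phi> \<zero>\<^bsub>cohomology H\<^esub> = \<zero>\<^bsub>cohomology G\<^esub>"
  unfolding zero_cohomology pullback_cohomology_class[OF assms]
  by (simp add: pullback_cochain_def[abs_def])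

text \<open>Pullback is multiplicative already on cochains, so a vanishing power pulls back to a
  vanishing power. The contrapositive is what counts: a pullback that is not nilpotent witnesses
  that the original class is not.\<close>

lemma nilpotent_pullback:
  assumes \<phi>: "\<phi> \<in> hom G H" and G: "monoid G" and H: "monoid H" and f: "f \<in> cocycles H"
    and "nilpotent (cohomology H) (cohomology_class H f)"
  shows "nilpotent (cohomology G) (pullback G \<phi> (cohomology_class H f))"
proof -
  obtain k where k: "cohomology_class H f [^]\<^bsub>cohomology H\<^esub> (k :: nat) = \<zero>\<^bsub>cohomology H\<^esub>"
    using assms(5) by (auto simp: nilpotent_def)
  have "pullback G \<phi> (cohomology_class H f) [^]\<^bsub>cohomology G\<^esub> k =
      pullback G \<phi> (cohomology_class H f [^]\<^bsub>cohomology H\<^esub> k)"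
    by (simp add: pullback_cohomology_class[OF \<phi> G] monoid.cohomology_class_power[OF H f]
        monoid.cohomology_class_power[OF G pullback_cochain_cocycle[OF \<phi> G f]]
        pullback_cochain_power[OF \<phi>])
  also have "\<dots> = \<zero>\<^bsub>cohomology G\<^esub>"
    unfolding k by (rule pullback_zero[OF \<phi> G])
  finally show ?thesis unfolding nilpotent_def by blast
qed

section \<open>Actions of elementary abelian groups\<close>

text \<open>The action is on the right because the main example is the set of right cosets of a
  subgroup, on which the group acts by translation from the right.\<close>

locale right_action = group G for G (structure) +
  fixes X :: "'x set" and act :: "'x \<Rightarrow> 'a \<Rightarrow> 'x"
  assumes act_closed [simp]: "C \<in> X \<Longrightarrow> g \<in> carrier G \<Longrightarrow> act C g \<in> X"
    and act_one [simp]: "C \<in> X \<Longrightarrow> act C \<one> = C"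
    and act_act: "C \<in> X \<Longrightarrow> g \<in> carrier G \<Longrightarrow> h \<in> carrier G \<Longrightarrow> act (act C g) h = act C (g \<otimes> h)"
begin

definition fixed_points :: "'x set" where
  "fixed_points = {C \<in> X. \<forall>g\<in>carrier G. act C g = C}"

definition orbit_of :: "'x \<Rightarrow> 'x set" where
  "orbit_of b = act b ` carrier G"

lemma act_inv [simp]:
  assumes "C \<in> X" "g \<in> carrier G"
  shows "act (act C g) (inv g) = C" "act (act C (inv g)) g = C"
  using assms by (simp_all add: act_act)

lemma subgroup_stabilizer:
  assumes "b \<in> X"
  shows "subgroup {g \<in> carrier G. act b g = b} G"
proof
  fix x y assume "x \<in> {g \<in> carrier G. act b g = b}" "y \<in> {g \<in> carrier G. act b g = b}"
  then show "x \<otimes> y \<in> {g \<in> carrier G. act b g = b}"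
    using act_act[OF assms, of x y] by simp
next
  fix x assume "x \<in> {g \<in> carrier G. act b g = b}"
  then show "inv x \<in> {g \<in> carrier G. act b g = b}"
    using act_inv(1)[OF assms, of x] by simp
qed (use assms in auto)

text \<open>Removing an orbit from an invariant set leaves an invariant set, so a finite
  \<open>X\<close> is exhausted orbit by orbit.\<close>

lemma fixed_point_free_induct [consumes 2, case_names empty orbit]:
  assumes "finite X" "fixed_points = {}"
    and empty: "P {}"
    and orbit: "\<And>b Y. b \<in> X \<Longrightarrow> Y \<subseteq> X \<Longrightarrow> orbit_of b \<inter> Y = {} \<Longrightarrow> P Y \<Longrightarrow> P (orbit_of b \<union> Y)"
  shows "P X"
proof -
  have "P Y" if "finite Y" "Y \<subseteq> X" "\<And>C g. C \<in> Y \<Longrightarrow> g \<in> carrier G \<Longrightarrow> act C g \<in> Y" for Y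
    using that
  proof (induction Y rule: finite_psubset_induct)
    case (psubset Y)
    show ?case
    proof (cases "Y = {}")
      case False
      then obtain b where b: "b \<in> Y" by blast
      then have bX: "b \<in> X" using psubset.prems by blast
      have "b \<in> orbit_of b"
        unfolding orbit_of_def using act_one[OF bX] by (metis image_eqI one_closed)
      then have "Y - orbit_of b \<subset> Y" using b by blast
      moreover have "act C g \<in> Y - orbit_of b" if C: "C \<in> Y - orbit_of b" and g: "g \<in> carrier G" for C g
      proof -
        have "act C g \<notin> orbit_of b"
        proof
          assume "act C g \<in> orbit_of b"
          then obtain h where h: "h \<in> carrier G" "act C g = act b h" unfolding orbit_of_def by blast
          have CX: "C \<in> X" using C psubset.prems by blast
          have "C = act (act b h) (inv g)" using CX g by (simp flip: h(2))
          also have "\<dots> = act b (h \<otimes> inv g)" using bX g h by (simp add: act_act)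
          finally have "C \<in> orbit_of b" unfolding orbit_of_def using g h by simp
          then show False using C by blast
        qed
        then show ?thesis using C g psubset.prems by blast
      qed
      ultimately have "P (Y - orbit_of b)"
        using psubset.IH[of "Y - orbit_of b"] psubset.prems by blast
      then have "P (orbit_of b \<union> (Y - orbit_of b))"
        using bX psubset.prems by (intro orbit) auto
      moreover have "orbit_of b \<subseteq> Y" using b psubset.prems by (auto simp: orbit_of_def)
      ultimately show ?thesis by (simp add: Un_absorb1)
    qed (simp add: empty)
  qed
  then show ?thesis using assms(1) by simp
qed

end

section \<open>Elementary abelian groups and complements of their subgroups\<close>

locale elementary_abelian = comm_group +
  fixes p :: nat
  assumes prime_exponent: "Factorial_Ring.prime p"
    and exponent: "x \<in> carrier G \<Longrightarrow> x [^] p = \<one>"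
    and finite_carrier: "finite (carrier G)"
begin

lemma prime_dvd_card_subgroup:
  assumes K: "subgroup K G" and "K \<noteq> {\<one>}"
  shows "p dvd card K"
proof -
  interpret K: subgroup K G by fact
  obtain k where k: "k \<in> K" "k \<noteq> \<one>"
    using assms(2) K.one_closed by blast
  have "ord k dvd p" using k exponent by (simp add: pow_eq_id[symmetric])
  moreover have "ord k \<noteq> 1" using k ord_eq_1 by simp
  ultimately have "ord k = p" using prime_exponent by (metis prime_nat_iff)
  moreover have "generate G {k} \<subseteq> K" using k K by (simp add: generate_subgroup_incl)
  moreover have "ord k = card (generate G {k})"
    using k by (simp add: generate_pow_card)
  moreover have "subgroup (generate G {k}) (G\<lparr>carrier := K\<rparr>)"
    using k K calculation(2) by (intro subgroup_incl generate_is_subgroup) auto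
  then have "card (generate G {k}) dvd Coset.order (G\<lparr>carrier := K\<rparr>)"
    using group.lagrange[OF K.subgroup_is_group[OF is_group]] by (metis dvd_triv_right)
  ultimately show ?thesis by (simp add: Coset.order_def)
qed

text \<open>The complement of a subspace, found without bases: take \<open>K\<close> maximal among
  the subgroups that meet \<open>S\<close> trivially. If some x were outside S K, then
  \<open>K\<close> with the powers of x adjoined would still meet \<open>S\<close> trivially,
  against maximality.\<close>

lemma complement:
  assumes S: "subgroup S G"
  obtains K where "subgroup K G" "S \<inter> K = {\<one>}" "\<And>x. x \<in> carrier G \<Longrightarrow> \<exists>s\<in>S. \<exists>k\<in>K. x = s \<otimes> k"
proof -
  interpret S: subgroup S G by fact
  let ?\<K> = "{K. subgroup K G \<and> S \<inter> K = {\<one>}}"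
  have "?\<K> \<subseteq> Pow (carrier G)" using subgroup.subset by blast
  then have "finite ?\<K>" using finite_carrier by (meson finite_Pow_iff finite_subset)
  moreover have "{\<one>} \<in> ?\<K>" using triv_subgroup S.one_closed by simp
  ultimately have "\<exists>K\<in>?\<K>. \<forall>L\<in>?\<K>. K \<subseteq> L \<longrightarrow> K = L"
    by (intro finite_has_maximal) auto
  then obtain K where K: "subgroup K G" "S \<inter> K = {\<one>}"
    and max: "\<And>L. subgroup L G \<Longrightarrow> S \<inter> L = {\<one>} \<Longrightarrow> K \<subseteq> L \<Longrightarrow> K = L"
    by auto
  interpret K: subgroup K G by fact
  have "\<exists>s\<in>S. \<exists>k\<in>K. x = s \<otimes> k" if x: "x \<in> carrier G" for x
  proof (rule ccontr)
    assume no: "\<not> (\<exists>s\<in>S. \<exists>k\<in>K. x = s \<otimes> k)"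
    let ?L = "{k \<otimes> x [^] i | k i. k \<in> K \<and> i \<in> (UNIV :: int set)}"
    have L: "subgroup ?L G"
    proof
      fix y z assume "y \<in> ?L" "z \<in> ?L"
      then obtain k i l j where y: "k \<in> K" "y = k \<otimes> x [^] (i::int)" and z: "l \<in> K" "z = l \<otimes> x [^] (j::int)"
        by blast
      then have "y \<otimes> z = (k \<otimes> l) \<otimes> x [^] (i + j)"
        using x by (simp add: int_pow_mult m_ac)
      then show "y \<otimes> z \<in> ?L" using y z K.m_closed by blast
    next
      fix y assume "y \<in> ?L"
      then obtain k i where y: "k \<in> K" "y = k \<otimes> x [^] (i::int)" by blast
      then have "inv y = inv k \<otimes> x [^] (- i)"
        using x by (simp add: inv_mult int_pow_neg)
      then show "inv y \<in> ?L" using y K.m_inv_closed by blast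
    next
      show "\<one> \<in> ?L" using K.one_closed by (auto intro!: exI[of _ "0::int"] exI[of _ \<one>])
    qed (use x in auto)
    moreover have "y = \<one>" if y: "y \<in> S" "y \<in> ?L" for y
    proof -
      obtain k i where k: "k \<in> K" "y = k \<otimes> x [^] (i::int)" using y by blast
      have pow: "x [^] (int p * m) = \<one>" for m :: int
        using x exponent by (simp add: int_pow_pow[symmetric] int_pow_int int_pow_one)
      show ?thesis
      proof (cases "int p dvd i")
        case True
        then obtain m where "i = int p * m" by blast
        then have "y = k" using k pow by simp
        then show ?thesis using k y K by blast
      next
        case False
        \<comment> \<open>An exponent prime to p can be undone: by Bezout x is a power of
          \<open>x [^] i\<close>, which lies in S K, so x would lie there too.\<close>
        then have "coprime (int p) i" using prime_exponent by (simp add: prime_imp_coprime)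
        then obtain u v where uv: "u * int p + v * i = 1"
          using bezout_int[of "int p" i] by auto
        have xi: "x [^] i = y \<otimes> inv k" using k x by (simp add: m_comm[of k] m_assoc)
        have "x = x [^] (int p * u + i * v)" using x uv by (simp add: mult.commute int_pow_1)
        also have "\<dots> = (x [^] i) [^] v"
          using x pow by (simp add: int_pow_mult int_pow_pow)
        also have "\<dots> = y [^] v \<otimes> (inv k) [^] v"
          using k y by (simp add: xi int_pow_distrib)
        finally have "x = y [^] v \<otimes> (inv k) [^] v" .
        moreover have "y [^] v \<in> S" "(inv k) [^] v \<in> K"
          using y k S K by (simp_all add: subgroup_int_pow_closed)
        ultimately show ?thesis using no by blast
      qed
    qed
    moreover have "\<one> \<in> ?L" using L by (rule subgroup.one_closed)
    ultimately have "S \<inter> ?L = {\<one>}" using S.one_closed by blast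
    moreover have "K \<subseteq> ?L"
    proof
      fix y assume "y \<in> K"
      moreover have "y = y \<otimes> x [^] (0 :: int)" using \<open>y \<in> K\<close> by simp
      ultimately show "y \<in> ?L" by blast
    qed
    ultimately have "K = ?L" by (rule max[OF L])
    moreover have "x \<in> ?L"
      using x K.one_closed by (auto intro!: exI[of _ "1::int"] exI[of _ \<one>])
    ultimately have "x \<in> K" by simp
    then show False using no S.one_closed x by (metis l_one)
  qed
  then show ?thesis using that K by blast
qed

text \<open>\<open>r\<close> is the projection onto \<open>S\<close> along a complement
  \<open>K\<close>. It is multiplicative because the defect of multiplicativity lies in
  \<open>S\<close> by construction and in \<open>K\<close> by comparing the
  \<open>K\<close>-components, and the two meet trivially.\<close>

lemma retraction:
  assumes S: "subgroup S G"
  obtains K r where "subgroup K G" "S \<inter> K = {\<one>}"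
    "\<And>x. x \<in> carrier G \<Longrightarrow> r x \<in> S" "\<And>x. x \<in> carrier G \<Longrightarrow> x \<otimes> inv (r x) \<in> K"
    "\<And>x y. x \<in> carrier G \<Longrightarrow> y \<in> carrier G \<Longrightarrow> r (x \<otimes> y) = r x \<otimes> r y"
proof -
  interpret S: subgroup S G by fact
  obtain K where K: "subgroup K G" "S \<inter> K = {\<one>}"
    and ex: "\<And>x. x \<in> carrier G \<Longrightarrow> \<exists>s\<in>S. \<exists>k\<in>K. x = s \<otimes> k"
    using complement[OF S] by blast
  interpret K: subgroup K G by fact
  have "\<exists>s\<in>S. x \<otimes> inv s \<in> K" if x: "x \<in> carrier G" for x
  proof -
    obtain s k where "s \<in> S" "k \<in> K" "x = s \<otimes> k" using ex[OF x] by blast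
    then show ?thesis by (intro bexI[of _ s]) (simp_all add: m_ac)
  qed
  then obtain r where r: "\<And>x. x \<in> carrier G \<Longrightarrow> r x \<in> S" "\<And>x. x \<in> carrier G \<Longrightarrow> x \<otimes> inv (r x) \<in> K"
    by metis
  have "r (x \<otimes> y) = r x \<otimes> r y" if x: "x \<in> carrier G" and y: "y \<in> carrier G" for x y
  proof -
    let ?d = "r x \<otimes> r y \<otimes> inv (r (x \<otimes> y))"
    have m: "r x \<in> carrier G" "r y \<in> carrier G" "r (x \<otimes> y) \<in> carrier G"
      using r(1) x y by simp_all
    have "(x \<otimes> y \<otimes> inv (r (x \<otimes> y))) \<otimes> inv ((x \<otimes> inv (r x)) \<otimes> (y \<otimes> inv (r y))) \<in> K"
      using r(2) x y K.m_closed K.m_inv_closed by simp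
    also have "(x \<otimes> y \<otimes> inv (r (x \<otimes> y))) \<otimes> inv ((x \<otimes> inv (r x)) \<otimes> (y \<otimes> inv (r y))) = ?d"
    proof -
      have regroup: "(a \<otimes> b \<otimes> c) \<otimes> ((x \<otimes> a') \<otimes> (y \<otimes> b')) = (x \<otimes> y \<otimes> c) \<otimes> (a \<otimes> a') \<otimes> (b \<otimes> b')"
        if "a \<in> carrier G" "b \<in> carrier G" "c \<in> carrier G" "a' \<in> carrier G" "b' \<in> carrier G"
        for a b c a' b'
        using that x y by (simp add: m_ac)
      have "?d \<otimes> ((x \<otimes> inv (r x)) \<otimes> (y \<otimes> inv (r y))) =
          (x \<otimes> y \<otimes> inv (r (x \<otimes> y))) \<otimes> (r x \<otimes> inv (r x)) \<otimes> (r y \<otimes> inv (r y))"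
        using m x y by (intro regroup) auto
      also have "\<dots> = x \<otimes> y \<otimes> inv (r (x \<otimes> y))"
        using m x y by simp
      finally have "?d \<otimes> ((x \<otimes> inv (r x)) \<otimes> (y \<otimes> inv (r y))) = x \<otimes> y \<otimes> inv (r (x \<otimes> y))" .
      moreover have "u \<otimes> v \<otimes> inv v = u" if "u \<in> carrier G" "v \<in> carrier G" for u v
        using that by (simp add: m_assoc)
      ultimately show ?thesis using m x y by (metis inv_closed m_closed)
    qed
    finally have "?d \<in> S \<inter> K" using r(1) x y by simp
    then have "?d = \<one>" using K by blast
    then show ?thesis
      using m x y by (metis inv_closed inv_equality inv_inv m_closed)
  qed
  then show ?thesis using that K r by blast
qed

end

locale elementary_abelian_action = elementary_abelian G p + right_action G X act
  for G :: "('a, 'm) monoid_scheme" (structure) and p and X :: "'x set" and act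
begin

text \<open>A complement \<open>K\<close> of the stabilizer of \<open>b\<close> acts simply
  transitively on the orbit, and \<open>r\<close> is the projection onto the stabilizer along
  \<open>K\<close>. As \<open>b\<close> is not fixed, \<open>K\<close> is nontrivial, and this is
  where the factor p comes from.\<close>

lemma orbit_parametrization:
  assumes b: "b \<in> X" "b \<notin> fixed_points"
  obtains K r where "subgroup K G" "p dvd card K" "bij_betw (act b) K (orbit_of b)"
    "\<And>x. x \<in> carrier G \<Longrightarrow> r x \<in> carrier G" "\<And>x. x \<in> carrier G \<Longrightarrow> act b (r x) = b"
    "\<And>x. x \<in> carrier G \<Longrightarrow> x \<otimes> inv (r x) \<in> K"
    "\<And>x y. x \<in> carrier G \<Longrightarrow> y \<in> carrier G \<Longrightarrow> r (x \<otimes> y) = r x \<otimes> r y"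
proof -
  let ?S = "{g \<in> carrier G. act b g = b}"
  obtain K r where K: "subgroup K G" "?S \<inter> K = {\<one>}"
    and r: "\<And>x. x \<in> carrier G \<Longrightarrow> r x \<in> ?S" "\<And>x. x \<in> carrier G \<Longrightarrow> x \<otimes> inv (r x) \<in> K"
      "\<And>x y. x \<in> carrier G \<Longrightarrow> y \<in> carrier G \<Longrightarrow> r (x \<otimes> y) = r x \<otimes> r y"
    using retraction[OF subgroup_stabilizer[OF b(1)]] by blast
  interpret K: subgroup K G by fact
  have act_eq: "act b (x \<otimes> inv (r x)) = act b x" if x: "x \<in> carrier G" for x
  proof -
    have "act b (x \<otimes> inv (r x)) = act b (inv (r x) \<otimes> x)"
      using x r(1) by (simp add: m_comm)
    also have "\<dots> = act (act (act b (r x)) (inv (r x))) x"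
      using x b r(1)[OF x] by (simp add: act_act)
    also have "\<dots> = act b x" using x b r(1)[OF x] by (subst act_inv) auto
    finally show ?thesis .
  qed
  have "inj_on (act b) K"
  proof (rule inj_onI)
    fix k l assume kl: "k \<in> K" "l \<in> K" "act b k = act b l"
    then have "act b (k \<otimes> inv l) = act (act b l) (inv l)"
      using b by (simp flip: act_act)
    then have "k \<otimes> inv l \<in> ?S \<inter> K" using b kl by simp
    then have "k \<otimes> inv l = \<one>" using K by blast
    then show "k = l" using kl by (metis K.mem_carrier inv_closed inv_equality inv_inv)
  qed
  moreover have "act b ` K = orbit_of b"
    unfolding orbit_of_def using act_eq r(2) K.subset by (auto; metis image_eqI)
  moreover have "K \<noteq> {\<one>}"
  proof
    assume "K = {\<one>}"
    then have "act b ` K = {b}" using b by simp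
    then have "act b g = b" if "g \<in> carrier G" for g
      using that \<open>act b ` K = orbit_of b\<close> by (auto simp: orbit_of_def)
    then show False using b by (simp add: fixed_points_def)
  qed
  ultimately show ?thesis
    using that[of K r] K r prime_dvd_card_subgroup by (auto simp: bij_betw_def)
qed

text \<open>Every orbit is in bijection with a nontrivial subgroup. The contrapositive yields fixed
  points: a finite set of size prime to p has one.\<close>

lemma prime_dvd_card:
  assumes "finite X" "fixed_points = {}"
  shows "p dvd card X"
  using assms
proof (induction rule: fixed_point_free_induct)
  case (orbit b Y)
  obtain K where K: "p dvd card K" "bij_betw (act b) K (orbit_of b)"
    using orbit_parametrization[of b] orbit(1) assms by (metis empty_iff)
  have "finite (orbit_of b)" "finite Y"
    using finite_carrier orbit assms(1) finite_subset by (auto simp: orbit_of_def)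
  then show ?case
    using K orbit bij_betw_same_card[OF K(2)] by (simp add: card_Un_disjoint)
qed simp

end

text \<open>The two laws make \<open>c\<close> a functor from the action groupoid of
  \<open>X\<close> to \<open>H\<close>. On the stabilizer of a point \<open>C\<close>,
  \<open>c C\<close> is therefore a homomorphism.\<close>

locale twisted_action = elementary_abelian_action G p X act + H: group H
  for G :: "('a, 'm) monoid_scheme" (structure) and p and X :: "'x set" and act
    and H :: "('h, 'n) monoid_scheme" (structure) +
  fixes c :: "'x \<Rightarrow> 'a \<Rightarrow> 'h"
  assumes twist_closed: "C \<in> X \<Longrightarrow> g \<in> carrier G \<Longrightarrow> c C g \<in> carrier H"
    and twist_mult: "C \<in> X \<Longrightarrow> g \<in> carrier G \<Longrightarrow> h \<in> carrier G \<Longrightarrow>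
      c C (g \<otimes>\<^bsub>G\<^esub> h) = c C g \<otimes>\<^bsub>H\<^esub> c (act C g) h"
begin

text \<open>On an orbit the sum is the transfer from the stabilizer.  Since the stabilizer has a
  complement \<open>K\<close>, its restriction map is surjective, so the transfer is multiplication by the
  index \<open>card K\<close>.\<close>

lemma family_sum_orbit:
  fixes f :: "'h list \<Rightarrow> 'k::comm_ring_1"
  assumes b: "b \<in> X" "b \<notin> fixed_points" and f: "f \<in> cocycles H" and char: "of_nat p = (0 :: 'k)"
  shows "family_sum G (orbit_of b) c f \<in> coboundaries G"
proof -
  obtain K r where K: "subgroup K G" "p dvd card K" "bij_betw (act b) K (orbit_of b)"
    and r: "\<And>x. x \<in> carrier G \<Longrightarrow> r x \<in> carrier G" "\<And>x. x \<in> carrier G \<Longrightarrow> act b (r x) = b"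
      "\<And>x. x \<in> carrier G \<Longrightarrow> x \<otimes>\<^bsub>G\<^esub> inv\<^bsub>G\<^esub> (r x) \<in> K"
      "\<And>x y. x \<in> carrier G \<Longrightarrow> y \<in> carrier G \<Longrightarrow> r (x \<otimes>\<^bsub>G\<^esub> y) = r x \<otimes>\<^bsub>G\<^esub> r y"
    using orbit_parametrization[OF b] by blast
  interpret K: subgroup K G by fact
  have fc: "f \<in> cochains H" using f by (simp add: cocycles_iff)
  \<comment> \<open>Write g as \<open>r g\<close> times its component in \<open>K\<close>. The
    component permutes the index set \<open>K\<close> by translation and \<open>r g\<close> becomes
    the multiplier. Both families obey this rule, but the members of \<open>?s'\<close> do not
    depend on k, so its sum is \<open>card K\<close> times one term.\<close>
  let ?\<tau> = "\<lambda>g k. (g \<otimes>\<^bsub>G\<^esub> inv\<^bsub>G\<^esub> (r g)) \<otimes>\<^bsub>G\<^esub> k" and ?a = "\<lambda>g (_ :: 'a). c b (r g)"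
  let ?s = "\<lambda>k x. c b (k \<otimes>\<^bsub>G\<^esub> x)" and ?s' = "\<lambda>(_ :: 'a) x. c b (r x)"
  have \<tau>: "bij_betw (?\<tau> g) K K" if g: "g \<in> carrier G" for g
    by (rule bij_betw_byWitness[where f' = "\<lambda>k. inv\<^bsub>G\<^esub> (g \<otimes>\<^bsub>G\<^esub> inv\<^bsub>G\<^esub> (r g)) \<otimes>\<^bsub>G\<^esub> k"])
      (use r(3)[OF g] in \<open>auto simp flip: m_assoc\<close>)
  have s: "equivariant_family G H K ?\<tau> ?a ?s"
  proof (rule equivariant_familyI)
    fix g k x assume g: "g \<in> carrier G" and k: "k \<in> K" and x: "x \<in> carrier G"
    have "k \<otimes>\<^bsub>G\<^esub> (g \<otimes>\<^bsub>G\<^esub> x) = r g \<otimes>\<^bsub>G\<^esub> (?\<tau> g k \<otimes>\<^bsub>G\<^esub> x)"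
    proof -
      have "r g \<otimes>\<^bsub>G\<^esub> (?\<tau> g k \<otimes>\<^bsub>G\<^esub> x) = (r g \<otimes>\<^bsub>G\<^esub> inv\<^bsub>G\<^esub> (r g)) \<otimes>\<^bsub>G\<^esub> (k \<otimes>\<^bsub>G\<^esub> (g \<otimes>\<^bsub>G\<^esub> x))"
        using g k x r(1)[OF g] by (simp add: m_ac del: r_inv l_inv)
      then show ?thesis using g k x r(1)[OF g] by simp
    qed
    then show "c b (k \<otimes>\<^bsub>G\<^esub> (g \<otimes>\<^bsub>G\<^esub> x)) = c b (r g) \<otimes>\<^bsub>H\<^esub> c b (?\<tau> g k \<otimes>\<^bsub>G\<^esub> x)"
      using g k x b r by (simp add: twist_mult)
  qed (use \<tau> b r twist_closed in auto)
  have s': "equivariant_family G H K ?\<tau> ?a ?s'"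
    by (rule equivariant_familyI) (use \<tau> b r twist_closed twist_mult in auto)
  \<comment> \<open>By the cocycle law \<open>?s k\<close> is \<open>c (act b k)\<close> multiplied
    from the left by \<open>c b k\<close>, which \<open>f\<close> does not see.\<close>
  have "family_sum G (orbit_of b) c f = family_sum G K ?s f"
  proof
    fix xs
    have "(\<Sum>C\<in>orbit_of b. f (map (c C) xs)) = (\<Sum>k\<in>K. f (map (?s k) xs))" if xs: "set xs \<subseteq> carrier G"
    proof -
      have "f (map (?s k) xs) = f (map (c (act b k)) xs)" if k: "k \<in> K" for k
      proof -
        have "map (?s k) xs = map (\<lambda>y. c b k \<otimes>\<^bsub>H\<^esub> y) (map (c (act b k)) xs)"
          using xs k b by (auto simp: twist_mult)
        also have "f \<dots> = f (map (c (act b k)) xs)"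
          using xs k b twist_closed by (intro cochains_invariant[OF fc]) auto
        finally show ?thesis .
      qed
      then show ?thesis by (simp flip: sum.reindex_bij_betw[OF K(3)])
    qed
    then show "family_sum G (orbit_of b) c f xs = family_sum G K ?s f xs"
      by (simp add: family_sum_def)
  qed
  moreover have "cohomology_class G (family_sum G K ?s f) = cohomology_class G (family_sum G K ?s' f)"
    by (rule family_sum_homotopy[OF s s' f]) (rule monoid_axioms)
  moreover have "of_nat (card K) = (0 :: 'k)" using K(2) char by (auto elim!: dvdE)
  then have "family_sum G K ?s' f = (\<lambda>_. 0)" by (auto simp: family_sum_def)
  ultimately show ?thesis by (simp add: cohomology_class_eq_iff)
qed

lemma family_sum_coboundary_if_no_fixed_points:
  fixes f :: "'h list \<Rightarrow> 'k::comm_ring_1"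
  assumes "finite X" "fixed_points = {}" and f: "f \<in> cocycles H" and char: "of_nat p = (0 :: 'k)"
  shows "family_sum G X c f \<in> coboundaries G"
  using assms(1,2)
proof (induction rule: fixed_point_free_induct)
  case empty
  have "family_sum G {} c f = (\<lambda>_. 0)" by (simp add: family_sum_def fun_eq_iff)
  then show ?case by (simp add: coboundaries_zero)
next
  case (orbit b Y)
  have "finite (orbit_of b)" "finite Y"
    using finite_carrier orbit assms(1) finite_subset by (auto simp: orbit_of_def)
  then have "family_sum G (orbit_of b \<union> Y) c f =
      (\<lambda>xs. family_sum G (orbit_of b) c f xs + family_sum G Y c f xs)"
    using orbit by (auto simp: family_sum_def sum.union_disjoint fun_eq_iff)
  then show ?case
    using orbit assms(2) family_sum_orbit[of b, OF _ _ f char] by (simp add: coboundaries_add)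
qed

text \<open>The points that are not fixed form an invariant subset, and the twisted action
  restricted to it has no fixed points.\<close>

lemma family_sum_fixed_points:
  fixes f :: "'h list \<Rightarrow> 'k::comm_ring_1"
  assumes "finite X" and f: "f \<in> cocycles H" and char: "of_nat p = (0 :: 'k)"
  shows "cohomology_class G (family_sum G X c f) = cohomology_class G (family_sum G fixed_points c f)"
proof -
  let ?Y = "X - fixed_points"
  have closed: "act C g \<in> ?Y" if C: "C \<in> ?Y" and g: "g \<in> carrier G" for C g
  proof -
    have "act C g \<notin> fixed_points"
    proof
      assume fixed: "act C g \<in> fixed_points"
      then have "act (act C g) (inv\<^bsub>G\<^esub> g) = act C g" using g by (simp add: fixed_points_def)
      then show False using fixed C g by simp
    qed
    then show ?thesis using C g by simp
  qed
  interpret Y: twisted_action G p ?Y act H c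
    by unfold_locales (use closed in \<open>auto simp: act_act twist_closed twist_mult\<close>)
  have "Y.fixed_points = {}"
    unfolding Y.fixed_points_def by (auto simp: fixed_points_def)
  then have "family_sum G ?Y c f \<in> coboundaries G"
    using assms by (intro Y.family_sum_coboundary_if_no_fixed_points) auto
  moreover have "family_sum G X c f xs - family_sum G fixed_points c f xs = family_sum G ?Y c f xs" for xs
    using assms(1) by (simp add: family_sum_def sum_diff fixed_points_def)
  ultimately show ?thesis by (intro cohomology_class_eqI)
qed

end

section \<open>The transfer as a sum over cosets\<close>

text \<open>The cocycle of the chosen transversal: for the representative t of \<open>C\<close> and
  the representative t' of the coset of t x, it is the element m of \<open>P\<close> with t x = m
  t'.\<close>

definition coset_multiplier :: "('g, 'm) monoid_scheme \<Rightarrow> 'g set \<Rightarrow> 'g set \<Rightarrow> 'g \<Rightarrow> 'g" where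
  "coset_multiplier G P C x = coset_retraction G P (coset_rep C \<otimes>\<^bsub>G\<^esub> x)"

context group
begin

context
  fixes P assumes P: "subgroup P G"
begin

lemma rcosets_subset: "C \<in> rcosets P \<Longrightarrow> C \<subseteq> carrier G"
  using r_coset_subset_G[OF subgroup.subset[OF P]] by (auto simp: RCOSETS_def)

lemma coset_rep_mem:
  assumes C: "C \<in> rcosets P"
  shows "coset_rep C \<in> C" "coset_rep C \<in> carrier G" "P #> coset_rep C = C"
proof -
  obtain x where x: "x \<in> carrier G" "C = P #> x" using C by (auto simp: RCOSETS_def)
  have "x \<in> C" using rcos_self[OF x(1) P] x(2) by simp
  then show m: "coset_rep C \<in> C" unfolding coset_rep_def by (rule someI)
  then show "coset_rep C \<in> carrier G" using C rcosets_subset by blast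
  show "P #> coset_rep C = C"
    using repr_independence[OF _ x(1) P] m x(2) by simp
qed

lemma rcosets_r_coset:
  assumes C: "C \<in> rcosets P" and x: "x \<in> carrier G"
  shows "C #> x \<in> rcosets P" "P #> (coset_rep C \<otimes> x) = C #> x"
proof -
  show eq: "P #> (coset_rep C \<otimes> x) = C #> x"
    using coset_mult_assoc[OF subgroup.subset[OF P] coset_rep_mem(2)[OF C] x]
    by (simp add: coset_rep_mem(3)[OF C])
  show "C #> x \<in> rcosets P"
    unfolding eq[symmetric] using coset_rep_mem(2)[OF C] x subgroup.subset[OF P]
    by (intro rcosetsI) auto
qed

lemma coset_multiplier_eq:
  assumes C: "C \<in> rcosets P" and x: "x \<in> carrier G"
  shows "coset_multiplier G P C x = coset_rep C \<otimes> x \<otimes> inv (coset_rep (C #> x))"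
  by (simp add: coset_multiplier_def coset_retraction_def rcosets_r_coset(2)[OF C x])

lemma coset_multiplier_closed:
  assumes C: "C \<in> rcosets P" and x: "x \<in> carrier G"
  shows "coset_multiplier G P C x \<in> P"
proof -
  have "coset_rep (C #> x) \<in> P #> (coset_rep C \<otimes> x)"
    using coset_rep_mem(1)[OF rcosets_r_coset(1)[OF C x]] rcosets_r_coset(2)[OF C x] by simp
  then obtain h where h: "h \<in> P" "coset_rep (C #> x) = h \<otimes> (coset_rep C \<otimes> x)"
    by (auto simp: r_coset_def)
  have hc: "h \<in> carrier G" using h subgroup.mem_carrier[OF P] by blast
  have "coset_multiplier G P C x = inv h"
    using hc x coset_rep_mem(2)[OF C]
    by (simp add: coset_multiplier_eq[OF C x] h(2) inv_mult_group m_assoc)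
      (simp flip: m_assoc add: inv_solve_left)
  then show ?thesis using h subgroup.m_inv_closed[OF P] by simp
qed

lemma r_coset_r_coset:
  assumes "C \<in> rcosets P" "x \<in> carrier G" "y \<in> carrier G"
  shows "(C #> x) #> y = C #> (x \<otimes> y)"
  using assms rcosets_subset by (intro coset_mult_assoc) auto

lemma r_coset_one:
  assumes "C \<in> rcosets P"
  shows "C #> \<one> = C"
  using assms rcosets_subset by (intro coset_mult_one) auto

text \<open>The representative of the intermediate coset \<open>C #> x\<close> and its inverse are
  inserted between x and y.\<close>

lemma coset_multiplier_mult:
  assumes C: "C \<in> rcosets P" and x: "x \<in> carrier G" and y: "y \<in> carrier G"
  shows "coset_multiplier G P C (x \<otimes> y) =
    coset_multiplier G P C x \<otimes> coset_multiplier G P (C #> x) y"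
proof -
  have Cx: "C #> x \<in> rcosets P" and Cxy: "C #> (x \<otimes> y) \<in> rcosets P"
    using C x y rcosets_r_coset(1) by simp_all
  have cancel: "inv t \<otimes> (t \<otimes> u) = u" if "t \<in> carrier G" "u \<in> carrier G" for t u
    using that by (simp flip: m_assoc)
  show ?thesis
    using coset_rep_mem(2)[OF C] coset_rep_mem(2)[OF Cx] coset_rep_mem(2)[OF Cxy] x y
    by (simp add: coset_multiplier_eq[OF C] coset_multiplier_eq[OF Cx] r_coset_r_coset[OF C x y]
        m_assoc cancel)
qed

lemma bij_betw_r_coset:
  assumes "g \<in> carrier G"
  shows "bij_betw (\<lambda>C. C #> g) (rcosets P) (rcosets P)"
  by (rule bij_betw_byWitness[where f' = "\<lambda>C. C #> inv g"])
    (use assms rcosets_r_coset(1) in \<open>auto simp: r_coset_r_coset r_coset_one\<close>)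

lemma equivariant_coset_multiplier:
  "equivariant_family G (G\<lparr>carrier := P\<rparr>) (rcosets P) (\<lambda>g C. C #> g)
    (\<lambda>g C. coset_multiplier G P C g) (coset_multiplier G P)"
  by (rule equivariant_familyI)
    (auto simp: coset_multiplier_closed coset_multiplier_mult bij_betw_r_coset)

lemma transfer_cohomology_class:
  "transfer G P (cohomology_class (G\<lparr>carrier := P\<rparr>) f) =
     cohomology_class G (family_sum G (rcosets P) (coset_multiplier G P) f)"
  using on_classes_family_sum[OF equivariant_coset_multiplier monoid_axioms]
  by (simp add: transfer_def family_sum_def[abs_def] coset_multiplier_def[abs_def])

end

end

text \<open>Restricting a transfer to another group keeps the full sum over the cosets; only the
  group that permutes them changes. This is the double coset formula before the cosets are sorted
  into orbits.\<close>

lemma pullback_family_sum_pullback: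
  assumes "\<And>x. x \<in> carrier K \<Longrightarrow> \<rho> x \<in> carrier G"
    and "\<And>C x. C \<in> X \<Longrightarrow> x \<in> carrier G \<Longrightarrow> s C x \<in> carrier P"
  shows "pullback_cochain K \<rho> (family_sum G X s (pullback_cochain P \<pi> f)) =
    family_sum K X (\<lambda>C x. \<pi> (s C (\<rho> x))) f"
proof
  fix xs
  show "pullback_cochain K \<rho> (family_sum G X s (pullback_cochain P \<pi> f)) xs =
      family_sum K X (\<lambda>C x. \<pi> (s C (\<rho> x))) f xs"
    using assms by (auto simp: pullback_cochain_def family_sum_def comp_def subset_iff intro!: sum.cong)
qed

section \<open>The general linear group and its parabolic subgroup\<close>

lemma mat_mult_assoc:
  fixes A B C :: "'a::semiring_0 mat"
  assumes "dim_col A = dim_row B" "dim_col B = dim_row C"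
  shows "A * B * C = A * (B * C)"
  by (rule assoc_mult_mat[of A "dim_row A" "dim_row B" B "dim_row C" C "dim_col C"])
    (use assms in auto)

lemma carrier_GL:
  "A \<in> carrier (GL N) \<longleftrightarrow>
    A \<in> carrier_mat N N \<and> (\<exists>B\<in>carrier_mat N N. B * A = 1\<^sub>m N \<and> A * B = 1\<^sub>m N)"
  by (auto simp: GL_def units_of_def Units_def ring_mat_def)

lemma mult_GL [simp]: "A \<otimes>\<^bsub>GL N\<^esub> B = A * B"
  by (simp add: GL_def units_of_def ring_mat_def)

lemma one_GL [simp]: "\<one>\<^bsub>GL N\<^esub> = 1\<^sub>m N"
  by (simp add: GL_def units_of_def ring_mat_def)

lemma group_GL: "group (GL N :: 'a::comm_ring_1 mat monoid)"
proof -
  interpret ring "ring_mat TYPE('a) N ()" by (rule ring_mat)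
  show ?thesis unfolding GL_def by (rule units_group)
qed

lemma GL_carrier_mat: "A \<in> carrier (GL N) \<Longrightarrow> A \<in> carrier_mat N N"
  by (simp add: carrier_GL)

lemma GL_dim: "A \<in> carrier (GL N) \<Longrightarrow> dim_row A = N" "A \<in> carrier (GL N) \<Longrightarrow> dim_col A = N"
  by (auto dest: GL_carrier_mat)

lemma GL_inv_closed: "A \<in> carrier (GL N) \<Longrightarrow> inv\<^bsub>GL N\<^esub> A \<in> carrier (GL N)"
  by (rule group.inv_closed[OF group_GL])

lemma GL_mult_closed: "A \<in> carrier (GL N) \<Longrightarrow> B \<in> carrier (GL N) \<Longrightarrow> A * B \<in> carrier (GL N)"
  using monoid.m_closed[OF group.is_monoid[OF group_GL], of A N B] by simp

lemma GL_inv: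
  assumes "A \<in> carrier (GL N)"
  shows "inv\<^bsub>GL N\<^esub> A * A = 1\<^sub>m N" "A * inv\<^bsub>GL N\<^esub> A = 1\<^sub>m N"
  using group.l_inv[OF group_GL assms] group.r_inv[OF group_GL assms] by simp_all

lemma GL_inv_cancel:
  assumes "A \<in> carrier (GL N)" "dim_row B = N"
  shows "inv\<^bsub>GL N\<^esub> A * (A * B) = B" "A * (inv\<^bsub>GL N\<^esub> A * B) = B"
  using assms GL_inv[OF assms(1)] GL_dim[OF assms(1)] GL_dim[OF GL_inv_closed[OF assms(1)]]
  by (simp_all add: left_mult_one_mat' flip: mat_mult_assoc)

lemma GL_inv_cancel_right:
  assumes "A \<in> carrier (GL N)" "dim_col B = N"
  shows "B * A * inv\<^bsub>GL N\<^esub> A = B" "B * inv\<^bsub>GL N\<^esub> A * A = B"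
  using assms GL_inv[OF assms(1)] GL_dim[OF assms(1)] GL_dim[OF GL_inv_closed[OF assms(1)]]
  by (simp_all add: right_mult_one_mat' mat_mult_assoc)

lemma finite_GL: "finite (carrier (GL N :: 'a::{comm_ring_1,finite} mat monoid))"
proof -
  have "carrier_mat N N \<subseteq> mat N N ` (({..<N} \<times> {..<N}) \<rightarrow>\<^sub>E (UNIV :: 'a set))"
  proof
    fix A :: "'a mat" assume A: "A \<in> carrier_mat N N"
    show "A \<in> mat N N ` (({..<N} \<times> {..<N}) \<rightarrow>\<^sub>E (UNIV :: 'a set))"
    proof (rule image_eqI)
      show "A = mat N N (restrict (\<lambda>ij. A $$ ij) ({..<N} \<times> {..<N}))"
        by (rule eq_matI) (use A in auto)
    qed auto
  qed
  moreover have "finite (({..<N} \<times> {..<N}) \<rightarrow>\<^sub>E (UNIV :: 'a set))"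
    by (intro finite_PiE) auto
  ultimately have "finite (carrier_mat N N :: 'a mat set)" by (meson finite_imageI finite_subset)
  then show ?thesis by (rule finite_subset[rotated]) (auto simp: carrier_GL)
qed

text \<open>The standard embedding of the plane as a matrix E. Block triangularity of g with upper
  left block A becomes the equation g E = E A, which can be multiplied and inverted without looking
  at entries.\<close>

definition first_columns :: "nat \<Rightarrow> 'a::comm_ring_1 mat" where
  "first_columns N = mat N 2 (\<lambda>(i, j). if i = j then 1 else 0)"

lemma first_columns_carrier [simp]: "first_columns N \<in> carrier_mat N 2"
  "dim_row (first_columns N) = N" "dim_col (first_columns N) = 2"
  by (simp_all add: first_columns_def)

lemma mult_first_columns:
  fixes A :: "'a::comm_ring_1 mat"
  assumes "A \<in> carrier_mat M N" "N \<ge> 2" "i < M" "j < 2"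
  shows "(A * first_columns N) $$ (i, j) = A $$ (i, j)"
proof -
  have "col (first_columns N) j = (unit_vec N j :: 'a vec)"
    using assms by (intro eq_vecI) (auto simp: first_columns_def)
  then show ?thesis using assms by simp
qed

lemma first_columns_mult:
  fixes A :: "'a::comm_ring_1 mat"
  assumes "A \<in> carrier_mat 2 K" "N \<ge> 2" "i < N" "j < K"
  shows "(first_columns N * A) $$ (i, j) = (if i < 2 then A $$ (i, j) else 0)"
proof -
  have "row (first_columns N) i = (if i < 2 then unit_vec 2 i else 0\<^sub>v 2 :: 'a vec)"
    using assms by (intro eq_vecI) (auto simp: first_columns_def)
  then show ?thesis using assms by auto
qed

lemma mult_first_columns_eqD:
  assumes "g \<in> carrier_mat N N" "A \<in> carrier_mat 2 2" "N \<ge> 2"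
    and eq: "g * first_columns N = first_columns N * A"
  shows "upper_left_block g = A"
proof (rule eq_matI)
  fix i j assume ij: "i < dim_row A" "j < dim_col A"
  have "(g * first_columns N) $$ (i, j) = (first_columns N * A) $$ (i, j)" by (simp add: eq)
  then show "upper_left_block g $$ (i, j) = A $$ (i, j)"
    using ij assms mult_first_columns[OF assms(1,3), of i j] first_columns_mult[OF assms(2,3), of i j]
    by (auto simp: upper_left_block_def)
qed (use assms in \<open>auto simp: upper_left_block_def\<close>)

lemma mult_first_columns_block:
  assumes g: "g \<in> carrier_mat N N" and A: "A \<in> carrier_mat 2 2" and N: "N \<ge> 2"
    and eq: "g * first_columns N = first_columns N * A"
  obtains X B where "X \<in> carrier_mat 2 (N - 2)" "B \<in> carrier_mat (N - 2) (N - 2)"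
    "g = four_block_mat A X (0\<^sub>m (N - 2) 2) B"
proof -
  let ?X = "mat 2 (N - 2) (\<lambda>(i, j). g $$ (i, j + 2))"
  let ?B = "mat (N - 2) (N - 2) (\<lambda>(i, j). g $$ (i + 2, j + 2))"
  have left: "g $$ (i, j) = (if i < 2 then A $$ (i, j) else 0)" if "i < N" "j < 2" for i j
    using that eq mult_first_columns[OF g N that] first_columns_mult[OF A N that] by simp
  have [simp]: "Suc (Suc (j - 2)) = j" if "\<not> j < 2" for j :: nat using that by simp
  have "g = four_block_mat A ?X (0\<^sub>m (N - 2) 2) ?B"
    by (rule eq_matI) (use g A N left in auto)
  then show ?thesis by (intro that[of ?X ?B]) auto
qed

lemma four_block_mult_first_columns:
  assumes "A \<in> carrier_mat 2 2" "X \<in> carrier_mat 2 (N - 2)" "B \<in> carrier_mat (N - 2) (N - 2)" "N \<ge> 2"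
  shows "four_block_mat A X (0\<^sub>m (N - 2) 2) B * first_columns N = first_columns N * A"
proof -
  let ?g = "four_block_mat A X (0\<^sub>m (N - 2) 2) B"
  have N2: "2 + (N - 2) = N" using assms(4) by simp
  have g: "?g \<in> carrier_mat N N"
    using four_block_carrier_mat[OF assms(1,3), of X "0\<^sub>m (N - 2) 2"] unfolding N2 .
  show ?thesis
    by (rule eq_matI)
      (use g assms in \<open>auto simp: mult_first_columns[OF g] first_columns_mult[OF assms(1)] simp del: index_mult_mat(1)\<close>)
qed

lemma four_block_upper_mult:
  assumes "A \<in> carrier_mat 2 2" "X \<in> carrier_mat 2 m" "B \<in> carrier_mat m m"
    "A' \<in> carrier_mat 2 2" "X' \<in> carrier_mat 2 m" "B' \<in> carrier_mat m m"
  shows "four_block_mat A X (0\<^sub>m m 2) B * four_block_mat A' X' (0\<^sub>m m 2) B' =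
    four_block_mat (A * A') (A * X' + X * B') (0\<^sub>m m 2) (B * (B' :: 'a::comm_ring_1 mat))"
proof -
  have "four_block_mat A X (0\<^sub>m m 2) B * four_block_mat A' X' (0\<^sub>m m 2) B' =
    four_block_mat (A * A' + X * 0\<^sub>m m 2) (A * X' + X * B') (0\<^sub>m m 2 * A' + B * 0\<^sub>m m 2)
      (0\<^sub>m m 2 * X' + B * B')"
    by (intro mult_four_block_mat) (use assms in auto)
  moreover have "A * A' + X * 0\<^sub>m m 2 = A * A'" "0\<^sub>m m 2 * A' + B * 0\<^sub>m m 2 = 0\<^sub>m m 2"
    "0\<^sub>m m 2 * X' + B * B' = B * B'"
    using assms by (auto intro!: right_add_zero_mat left_add_zero_mat
        simp: right_mult_zero_mat[OF assms(2)] left_mult_zero_mat[OF assms(4)] right_mult_zero_mat[OF assms(3)]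
          left_mult_zero_mat[OF assms(5)])
  ultimately show ?thesis by simp
qed

text \<open>The parabolic subgroup is the stabilizer of the plane spanned by the first two basis vectors.\<close>

lemma parabolic_iff:
  assumes N: "N \<ge> 2"
  shows "g \<in> parabolic N \<longleftrightarrow>
    g \<in> carrier (GL N) \<and> (\<exists>A\<in>carrier (GL 2). g * first_columns N = first_columns N * A)"
    (is "?L \<longleftrightarrow> ?R")
proof
  assume ?L
  then obtain A X B where g: "g = four_block_mat A X (0\<^sub>m (N - 2) 2) B"
    and A: "A \<in> carrier (GL 2)" and X: "X \<in> carrier_mat 2 (N - 2)" and B: "B \<in> carrier (GL (N - 2))"
    by (auto simp: parabolic_def)
  obtain A' where A': "A' \<in> carrier_mat 2 2" "A' * A = 1\<^sub>m 2" "A * A' = 1\<^sub>m 2"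
    using A by (auto simp: carrier_GL)
  obtain B' where B': "B' \<in> carrier_mat (N - 2) (N - 2)" "B' * B = 1\<^sub>m (N - 2)" "B * B' = 1\<^sub>m (N - 2)"
    using B by (auto simp: carrier_GL)
  note Ac = GL_carrier_mat[OF A] and Bc = GL_carrier_mat[OF B]
  \<comment> \<open>The upper right block of the inverse of a block triangular matrix, forced by A
    X' + X B' = 0.\<close>
  let ?X' = "- (A' * X * B')"
  let ?h = "four_block_mat A' ?X' (0\<^sub>m (N - 2) 2) B'"
  have X': "?X' \<in> carrier_mat 2 (N - 2)" using A' X B' by simp
  have N2: "2 + (N - 2) = N" using N by simp
  have "g \<in> carrier_mat N N" "?h \<in> carrier_mat N N"
    using four_block_carrier_mat[OF Ac Bc, of X "0\<^sub>m (N - 2) 2"]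
      four_block_carrier_mat[OF A'(1) B'(1), of ?X' "0\<^sub>m (N - 2) 2"] unfolding g N2 by blast+
  moreover have one: "four_block_mat (1\<^sub>m 2) (0\<^sub>m 2 (N - 2)) (0\<^sub>m (N - 2) 2) (1\<^sub>m (N - 2)) = (1\<^sub>m N :: 'a mat)"
    using four_block_one_mat[of 2 "N - 2"] unfolding N2 .
  moreover have "g * ?h = 1\<^sub>m N"
  proof -
    have "A * ?X' = - (X * B')"
    proof -
      have "A * (A' * X * B') = A * A' * (X * B')"
        using Ac A'(1) X B'(1) by (simp add: mat_mult_assoc)
      also have "\<dots> = X * B'" using X A' B' by simp
      finally show ?thesis using Ac A' X B' by simp
    qed
    moreover have "- (X * B') + X * B' = 0\<^sub>m 2 (N - 2)"
      using X B' by (intro uminus_l_inv_mat) auto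
    ultimately show ?thesis
      unfolding g four_block_upper_mult[OF Ac X Bc A'(1) X' B'(1)] using A' B' one by simp
  qed
  moreover have "?h * g = 1\<^sub>m N"
  proof -
    have "?X' * B = - (A' * X)"
    proof -
      have "A' * X * B' * B = A' * X"
        using Bc A' X B' by (simp add: mat_mult_assoc)
      then show ?thesis using Bc A' X B' by simp
    qed
    moreover have "A' * X + - (A' * X) = 0\<^sub>m 2 (N - 2)"
      using X A' by (intro eq_matI) auto
    ultimately show ?thesis
      unfolding g four_block_upper_mult[OF A'(1) X' B'(1) Ac X Bc] using A' B' one by simp
  qed
  ultimately have "g \<in> carrier (GL N)" unfolding carrier_GL by blast
  moreover have "g * first_columns N = first_columns N * A"
    unfolding g using Ac X Bc N by (rule four_block_mult_first_columns)
  ultimately show ?R using A by blast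
next
  assume ?R
  then obtain A where g: "g \<in> carrier (GL N)" and A: "A \<in> carrier (GL 2)"
    and eq: "g * first_columns N = first_columns N * A" by blast
  let ?h = "inv\<^bsub>GL N\<^esub> g" and ?A' = "inv\<^bsub>GL 2\<^esub> A"
  have h: "?h \<in> carrier (GL N)" and A': "?A' \<in> carrier (GL 2)" using g A GL_inv_closed by auto
  \<comment> \<open>The inverse of g preserves the standard plane too, hence is block triangular;
    comparing lower right blocks in the products of g with its inverse then shows that B is
    invertible.\<close>
  have "?h * first_columns N = ?h * (first_columns N * A * ?A')"
    using A by (simp add: GL_inv_cancel_right)
  also have "\<dots> = ?h * (g * (first_columns N * ?A'))"
    using GL_dim[OF g] GL_dim[OF A'] by (simp add: eq[symmetric] mat_mult_assoc)
  also have "\<dots> = first_columns N * ?A'" using g by (simp add: GL_inv_cancel)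
  finally have eq': "?h * first_columns N = first_columns N * ?A'" .
  note Ac = GL_carrier_mat[OF A] and A'c = GL_carrier_mat[OF A']
  obtain X B where X: "X \<in> carrier_mat 2 (N - 2)" and B: "B \<in> carrier_mat (N - 2) (N - 2)"
    and gb: "g = four_block_mat A X (0\<^sub>m (N - 2) 2) B"
    using mult_first_columns_block[OF GL_carrier_mat[OF g] Ac N eq] by blast
  obtain X' B' where X': "X' \<in> carrier_mat 2 (N - 2)" and B': "B' \<in> carrier_mat (N - 2) (N - 2)"
    and hb: "?h = four_block_mat ?A' X' (0\<^sub>m (N - 2) 2) B'"
    using mult_first_columns_block[OF GL_carrier_mat[OF h] A'c N eq'] by blast
  have lower_right: "U = 1\<^sub>m (N - 2)"
    if "four_block_mat S T (0\<^sub>m (N - 2) 2) U = 1\<^sub>m N" "S \<in> carrier_mat 2 2" "U \<in> carrier_mat (N - 2) (N - 2)"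
    for S T U :: "'a mat"
  proof (rule eq_matI)
    fix i j assume ij: "i < dim_row (1\<^sub>m (N - 2))" "j < dim_col (1\<^sub>m (N - 2))"
    have "four_block_mat S T (0\<^sub>m (N - 2) 2) U $$ (i + 2, j + 2) = 1\<^sub>m N $$ (i + 2, j + 2)"
      by (simp add: that(1))
    then show "U $$ (i, j) = 1\<^sub>m (N - 2) $$ (i, j)" using ij that(2,3) by auto
  qed (use that in auto)
  have "B * B' = 1\<^sub>m (N - 2)"
    using GL_inv(2)[OF g] Ac A'c B B'
    unfolding hb by (intro lower_right[of "A * ?A'" "A * X' + X * B'"])
      (simp_all add: gb four_block_upper_mult[OF Ac X B A'c X' B'])
  moreover have "B' * B = 1\<^sub>m (N - 2)"
    using GL_inv(1)[OF g] Ac A'c B B'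
    unfolding hb by (intro lower_right[of "?A' * A" "?A' * X + X' * B"])
      (simp_all add: gb four_block_upper_mult[OF A'c X' B' Ac X B])
  ultimately have "B \<in> carrier (GL (N - 2))" using B B' by (auto simp: carrier_GL)
  then show ?L using A X gb by (auto simp: parabolic_def)
qed

lemma parabolicD:
  assumes "N \<ge> 2" "g \<in> parabolic N"
  shows "g \<in> carrier (GL N)" "upper_left_block g \<in> carrier (GL 2)"
    "g * first_columns N = first_columns N * upper_left_block g"
proof -
  obtain A where g: "g \<in> carrier (GL N)" and A: "A \<in> carrier (GL 2)"
    and eq: "g * first_columns N = first_columns N * A"
    using assms parabolic_iff by blast
  have "upper_left_block g = A"
    using mult_first_columns_eqD[OF GL_carrier_mat[OF g] GL_carrier_mat[OF A] assms(1) eq] .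
  then show "g \<in> carrier (GL N)" "upper_left_block g \<in> carrier (GL 2)"
    "g * first_columns N = first_columns N * upper_left_block g" using g A eq by auto
qed

lemma parabolic_mult:
  assumes N: "N \<ge> 2" and g: "g \<in> parabolic N" and h: "h \<in> parabolic N"
  shows "g * h \<in> parabolic N" "upper_left_block (g * h) = upper_left_block g * upper_left_block h"
proof -
  note g' = parabolicD[OF N g] and h' = parabolicD[OF N h]
  have gh: "g * h \<in> carrier (GL N)" "upper_left_block g * upper_left_block h \<in> carrier (GL 2)"
    using g' h' GL_mult_closed by auto
  have "g * h * first_columns N = g * first_columns N * upper_left_block h"
    using GL_dim[OF g'(1)] GL_dim[OF h'(1)] GL_dim[OF h'(2)] h'(3) by (simp add: mat_mult_assoc)
  also have "\<dots> = first_columns N * (upper_left_block g * upper_left_block h)"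
    using GL_dim[OF g'(2)] GL_dim[OF h'(2)] g'(3) by (simp add: mat_mult_assoc)
  finally have eq: "g * h * first_columns N = first_columns N * (upper_left_block g * upper_left_block h)" .
  then show "g * h \<in> parabolic N" using gh parabolic_iff[OF N] by blast
  show "upper_left_block (g * h) = upper_left_block g * upper_left_block h"
    using mult_first_columns_eqD[OF _ _ N eq] gh GL_carrier_mat by blast
qed

lemma subgroup_parabolic:
  assumes N: "N \<ge> 2"
  shows "subgroup (parabolic N) (GL N)"
proof (rule group.subgroupI[OF group_GL])
  show "parabolic N \<subseteq> carrier (GL N)" using parabolicD(1)[OF N] by blast
  have "1\<^sub>m N * first_columns N = first_columns N * (1\<^sub>m 2 :: 'a mat)"
    by (simp add: left_mult_one_mat[of _ N 2] right_mult_one_mat[of _ N 2])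
  moreover have "1\<^sub>m k \<in> carrier (GL k :: 'a mat monoid)" for k
    using group.is_monoid[OF group_GL, of k] monoid.one_closed by fastforce
  ultimately show "parabolic N \<noteq> ({} :: 'a mat set)" using parabolic_iff[OF N] by blast
next
  fix g :: "'a mat" assume "g \<in> parabolic N"
  note g = parabolicD[OF N this]
  let ?A = "upper_left_block g"
  have "inv\<^bsub>GL N\<^esub> g * first_columns N = inv\<^bsub>GL N\<^esub> g * (first_columns N * ?A * inv\<^bsub>GL 2\<^esub> ?A)"
    using g by (simp add: GL_inv_cancel_right)
  also have "\<dots> = inv\<^bsub>GL N\<^esub> g * (g * (first_columns N * inv\<^bsub>GL 2\<^esub> ?A))"
    using GL_dim[OF g(1)] GL_dim[OF GL_inv_closed[OF g(2)]] by (simp add: g(3)[symmetric] mat_mult_assoc)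
  also have "\<dots> = first_columns N * inv\<^bsub>GL 2\<^esub> ?A" using g by (simp add: GL_inv_cancel)
  finally show "inv\<^bsub>GL N\<^esub> g \<in> parabolic N"
    using g GL_inv_closed parabolic_iff[OF N] by blast
qed (simp add: parabolic_mult[OF N])

lemma upper_left_block_hom:
  assumes N: "N \<ge> 2"
  shows "upper_left_block \<in> hom ((GL N)\<lparr>carrier := parabolic N\<rparr>) (GL 2)"
  using parabolicD(2)[OF N] parabolic_mult(2)[OF N] by (auto simp: hom_def)

section \<open>Invariant planes\<close>

text \<open>Two independent columns extend to a basis. The left inverse \<open>L\<close> records
  independence, and row reduction preserves it; a reduced echelon matrix with two columns and a left
  inverse has pivots in both columns and so is \<open>first_columns N\<close>. The matrix that
  undoes the row reduction is g.\<close>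

lemma left_invertible_columns:
  fixes B :: "'a::field mat"
  assumes B: "B \<in> carrier_mat N 2" and L: "L \<in> carrier_mat 2 N" and LB: "L * B = 1\<^sub>m 2" and N: "N \<ge> 2"
  obtains g where "g \<in> carrier (GL N)" "B = g * first_columns N"
proof -
  obtain C D where CD: "gauss_jordan B B = (C, D)" by fastforce
  obtain P where P: "P \<in> carrier (GL N)" and C: "C = P * B"
    using gauss_jordan_transform[OF B B CD, of "()"] by (auto simp: GL_def units_of_def)
  have Cc: "C \<in> carrier_mat N 2" using gauss_jordan_carrier[OF B B CD] by simp
  obtain f where f: "pivot_fun C f 2"
    using gauss_jordan_row_echelon[OF B CD] Cc by (auto simp: row_echelon_form_def)
  note pivot = pivot_funD[OF carrier_matD(1)[OF Cc] f]
  obtain M where M: "M \<in> carrier_mat 2 N" "M * C = 1\<^sub>m 2"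
  proof
    show "L * inv\<^bsub>GL N\<^esub> P \<in> carrier_mat 2 N"
      using L GL_carrier_mat[OF GL_inv_closed[OF P]] by simp
    show "L * inv\<^bsub>GL N\<^esub> P * C = 1\<^sub>m 2"
      using L B GL_dim[OF P] GL_dim[OF GL_inv_closed[OF P]] LB GL_inv_cancel(1)[OF P, of B]
      by (simp add: C mat_mult_assoc)
  qed
  have MC: "(\<Sum>k<N. M $$ (i, k) * C $$ (k, j)) = 1\<^sub>m 2 $$ (i, j)" if "i < 2" "j < 2" for i j
  proof -
    have "(M * C) $$ (i, j) = (\<Sum>k<N. M $$ (i, k) * C $$ (k, j))"
      using that M(1) Cc by (simp add: scalar_prod_def lessThan_atLeast0)
    then show ?thesis by (simp add: M(2))
  qed
  \<comment> \<open>If the first pivot were further right, column 0 would vanish, contrary to left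
    invertibility.\<close>
  have f0: "f 0 = 0"
  proof (rule ccontr)
    assume "f 0 \<noteq> 0"
    then have "i < N \<Longrightarrow> 0 < f i" for i
    proof (induction i)
      case (Suc i)
      then show ?case using pivot(3)[of i] by auto
    qed simp
    then have "C $$ (k, 0) = 0" if "k < N" for k using pivot(2) that by blast
    then show False using MC[of 0 0] by simp
  qed
  have C0: "C $$ (k, 0) = (if k = 0 then 1 else 0)" if "k < N" for k
    using pivot(4,5)[of 0] f0 that N by auto
  \<comment> \<open>Otherwise \<open>f 1\<close> is the number of columns 2, the value for a row
    without pivot, and all rows but the first are zero. Column 0 of C being a unit vector gives
    M(1,0) = 0, so entry (1,1) of M C would be 0 instead of 1.\<close>
  have f1: "f 1 = 1"
  proof (rule ccontr)
    assume "f 1 \<noteq> 1"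
    then have "f 1 = 2" using pivot(1)[of 1] pivot(3)[of 0] f0 N by auto
    have "i < N \<Longrightarrow> i \<ge> 1 \<Longrightarrow> f i = 2" for i
    proof (induction i)
      case (Suc i)
      show ?case
      proof (cases "i = 0")
        case False
        then show ?thesis
          using Suc pivot(3)[of i] pivot(1)[of "Suc i"] by auto
      qed (simp add: \<open>f 1 = 2\<close>[simplified])
    qed simp
    then have C1: "C $$ (k, 1) = 0" if "k < N" "k \<ge> 1" for k using pivot(2)[of k 1] that by simp
    have "M $$ (1, 0) = 0"
      using MC[of 1 0] N by (simp add: C0 if_distrib[of "\<lambda>x. _ * x"] cong: sum.cong_simp if_cong)
    moreover have "M $$ (1, 0) * C $$ (0, 1) = 1"
    proof -
      have "(\<Sum>k<N. M $$ (1, k) * C $$ (k, 1)) = (\<Sum>k<N. if k = 0 then M $$ (1, 0) * C $$ (0, 1) else 0)"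
      proof (intro sum.cong refl)
        fix k assume "k \<in> {..<N}"
        then show "M $$ (1, k) * C $$ (k, 1) = (if k = 0 then M $$ (1, 0) * C $$ (0, 1) else 0)"
          using C1[of k] by (cases "k = 0") auto
      qed
      then show ?thesis using MC[of 1 1] N by simp
    qed
    ultimately show False by simp
  qed
  have C1: "C $$ (k, 1) = (if k = 1 then 1 else 0)" if "k < N" for k
    using pivot(4,5)[of 1] f1 that N by auto
  have "C = first_columns N"
  proof (rule eq_matI)
    fix i j :: nat assume "i < dim_row (first_columns N)" "j < dim_col (first_columns N)"
    then have ij: "i < N" "j = 0 \<or> j = 1" by auto
    then show "C $$ (i, j) = first_columns N $$ (i, j)"
      using C0[of i] C1[of i] by (auto simp: first_columns_def)
  qed (use Cc in auto)
  then have "B = inv\<^bsub>GL N\<^esub> P * first_columns N"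
    using GL_inv_cancel(1)[OF P, of B] B C by simp
  then show ?thesis using that GL_inv_closed[OF P] by blast
qed

text \<open>In terms of planes this is the matrix of x, in the bases \<open>plane\<close>, as a map
  from the plane of the translated coset to the plane of \<open>C\<close>; see
  \<open>mult_plane\<close>.\<close>

definition block_multiplier :: "nat \<Rightarrow> 'a::comm_ring_1 mat set \<Rightarrow> 'a mat \<Rightarrow> 'a mat" where
  "block_multiplier N C x = upper_left_block (coset_multiplier (GL N) (parabolic N) C x)"

abbreviation plane_cosets :: "nat \<Rightarrow> 'a::comm_ring_1 mat set set" where
  "plane_cosets N \<equiv> rcosets\<^bsub>GL N\<^esub> (parabolic N)"

text \<open>The columns are a basis of the plane that corresponds to the coset \<open>C\<close> under the action on
  planes from the right, \<open>W \<mapsto> g\<inverse> W\<close>.\<close>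

definition plane :: "nat \<Rightarrow> 'a::comm_ring_1 mat set \<Rightarrow> 'a mat" where
  "plane N C = inv\<^bsub>GL N\<^esub> (coset_rep C) * first_columns N"

definition chi_cochain ::
  "nat \<Rightarrow> ('a::comm_ring_1 mat list \<Rightarrow> 'a) \<Rightarrow> 'a mat list \<Rightarrow> 'a" where
  "chi_cochain N f =
     family_sum (GL N) (plane_cosets N) (coset_multiplier (GL N) (parabolic N))
       (pullback_cochain ((GL N)\<lparr>carrier := parabolic N\<rparr>) upper_left_block f)"

lemma monoid_parabolic:
  assumes "N \<ge> 2"
  shows "monoid ((GL N :: 'a::comm_ring_1 mat monoid)\<lparr>carrier := parabolic N\<rparr>)"
  using group.subgroup_imp_group[OF group_GL subgroup_parabolic[OF assms]] by (rule group.is_monoid)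

lemma chi_cochain_cocycle:
  assumes N: "N \<ge> 2" and f: "f \<in> cocycles (GL 2)"
  shows "chi_cochain N f \<in> cocycles (GL N)"
  unfolding chi_cochain_def
  by (rule family_sum_cocycle[OF group.equivariant_coset_multiplier[OF group_GL subgroup_parabolic[OF N]]
        pullback_cochain_cocycle[OF upper_left_block_hom[OF N] monoid_parabolic[OF N] f]
        group.is_monoid[OF group_GL]])

lemma chi_univ_cohomology_class:
  assumes N: "N \<ge> 2"
    and "positive_part (GL 2) \<alpha> = cohomology_class (GL 2) f"
  shows "chi_univ N \<alpha> = cohomology_class (GL N) (chi_cochain N f)"
  by (simp add: chi_univ_def chi_cochain_def assms(2)
      pullback_cohomology_class[OF upper_left_block_hom[OF N] monoid_parabolic[OF N]]
      group.transfer_cohomology_class[OF group_GL subgroup_parabolic[OF N]])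

lemma chi_cohomology_class:
  assumes N: "N \<ge> 2" and "positive_part (GL 2) \<alpha> = cohomology_class (GL 2) f"
    and \<rho>: "\<rho> \<in> hom G (GL N)" and G: "monoid G"
  shows "chi G N \<rho> \<alpha> = cohomology_class G (pullback_cochain G \<rho> (chi_cochain N f))"
  by (simp add: chi_def chi_univ_cohomology_class[OF assms(1,2)] pullback_cohomology_class[OF \<rho> G])

lemma pullback_chi_cochain:
  assumes N: "N \<ge> 2" and \<rho>: "\<rho> \<in> hom G (GL N)"
  shows "pullback_cochain G \<rho> (chi_cochain N f) =
    family_sum G (plane_cosets N) (\<lambda>C x. block_multiplier N C (\<rho> x)) f"
  unfolding chi_cochain_def block_multiplier_def
  using \<rho> group.coset_multiplier_closed[OF group_GL subgroup_parabolic[OF N]]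
  by (intro pullback_family_sum_pullback) (auto simp: hom_def)

lemma chi_pullback:
  fixes \<alpha> :: "('c::comm_ring_1 mat list \<Rightarrow> 'c) set"
  assumes N: "N \<ge> 2" and \<alpha>: "positive_part (GL 2) \<alpha> = cohomology_class (GL 2) f"
    and \<rho>: "\<rho> \<in> hom H (GL N)" and H: "monoid H" and \<theta>: "\<theta> \<in> hom G H" and G: "monoid G"
  shows "chi G N (\<rho> \<circ> \<theta>) \<alpha> = pullback G \<theta> (chi H N \<rho> \<alpha>)"
proof -
  have comp: "\<rho> \<circ> \<theta> \<in> hom G (GL N)"
    using \<theta> \<rho> by (auto simp: hom_def Pi_iff)
  have "pullback_cochain G (\<rho> \<circ> \<theta>) h = pullback_cochain G \<theta> (pullback_cochain H \<rho> h)" for h :: "'c mat list \<Rightarrow> 'c"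
    using \<theta> by (auto simp: pullback_cochain_def hom_def Pi_iff subset_iff fun_eq_iff)
  then show ?thesis
    by (simp add: chi_cohomology_class[OF N \<alpha> comp G] chi_cohomology_class[OF N \<alpha> \<rho> H]
        pullback_cohomology_class[OF \<theta> G])
qed

section \<open>Cosets of the parabolic subgroup as planes\<close>

context
  fixes N :: nat assumes N: "N \<ge> 2"
begin

lemma coset_rep_GL:
  assumes "C \<in> plane_cosets N"
  shows "coset_rep C \<in> carrier (GL N)"
  by (rule group.coset_rep_mem(2)[OF group_GL subgroup_parabolic[OF N] assms])

lemma plane_carrier:
  assumes "C \<in> plane_cosets N"
  shows "plane N C \<in> carrier_mat N 2"
  using GL_carrier_mat[OF GL_inv_closed[OF coset_rep_GL[OF assms]]] by (simp add: plane_def)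

lemma plane_dim:
  assumes "C \<in> plane_cosets N"
  shows "dim_row (plane N C) = N" "dim_col (plane N C) = 2"
  using plane_carrier[OF assms] by auto

lemma coset_rep_plane:
  assumes "C \<in> plane_cosets N"
  shows "coset_rep C * plane N C = first_columns N"
  using coset_rep_GL[OF assms] by (simp add: plane_def GL_inv_cancel)

lemma plane_left_inverse:
  assumes C: "C \<in> plane_cosets N"
  obtains L where "L \<in> carrier_mat 2 N" "L * plane N C = 1\<^sub>m 2"
proof -
  let ?T = "transpose_mat (first_columns N) :: 'a mat"
  have T: "?T \<in> carrier_mat 2 N" by simp
  have TE: "?T * first_columns N = 1\<^sub>m 2"
  proof (rule eq_matI)
    fix i j assume ij: "i < dim_row (1\<^sub>m 2 :: 'a mat)" "j < dim_col (1\<^sub>m 2 :: 'a mat)"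
    then show "(?T * first_columns N) $$ (i, j) = 1\<^sub>m 2 $$ (i, j)"
      using N mult_first_columns[OF T N, of i j] by (auto simp: first_columns_def)
  qed auto
  show ?thesis
  proof (rule that)
    show "?T * coset_rep C \<in> carrier_mat 2 N"
      using T GL_carrier_mat[OF coset_rep_GL[OF C]] by auto
    show "?T * coset_rep C * plane N C = 1\<^sub>m 2"
      using T GL_dim[OF coset_rep_GL[OF C]] plane_dim[OF C] coset_rep_plane[OF C] TE
      by (simp add: mat_mult_assoc)
  qed
qed

lemma r_coset_plane_cosets:
  assumes "C \<in> plane_cosets N" "g \<in> carrier (GL N)"
  shows "C #>\<^bsub>GL N\<^esub> g \<in> plane_cosets N"
  by (rule group.rcosets_r_coset(1)[OF group_GL subgroup_parabolic[OF N] assms])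

lemma block_multiplier_closed:
  assumes "C \<in> plane_cosets N" "g \<in> carrier (GL N)"
  shows "block_multiplier N C g \<in> carrier (GL 2)"
  unfolding block_multiplier_def
  by (intro parabolicD(2)[OF N] group.coset_multiplier_closed[OF group_GL subgroup_parabolic[OF N]] assms)

lemma block_multiplier_mult:
  assumes "C \<in> plane_cosets N" "g \<in> carrier (GL N)" "h \<in> carrier (GL N)"
  shows "block_multiplier N C (g * h) =
    block_multiplier N C g * block_multiplier N (C #>\<^bsub>GL N\<^esub> g) h"
proof -
  note closed = group.coset_multiplier_closed[OF group_GL subgroup_parabolic[OF N]]
  have "coset_multiplier (GL N) (parabolic N) C (g * h) = coset_multiplier (GL N) (parabolic N) C g *
      coset_multiplier (GL N) (parabolic N) (C #>\<^bsub>GL N\<^esub> g) h"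
    using group.coset_multiplier_mult[OF group_GL subgroup_parabolic[OF N] assms] by simp
  then show ?thesis
    unfolding block_multiplier_def
    using parabolic_mult(2)[OF N closed[OF assms(1,2)] closed[OF r_coset_plane_cosets[OF assms(1,2)] assms(3)]]
    by simp
qed

text \<open>For representatives t of \<open>C\<close> and t' of its translate, the multiplier t g
  t'^-1 satisfies t g t'^-1 E = E A, where E is the standard plane and A the block; multiplying by
  t^-1 gives the claim.\<close>

lemma mult_plane:
  assumes C: "C \<in> plane_cosets N" and g: "g \<in> carrier (GL N)"
  shows "g * plane N (C #>\<^bsub>GL N\<^esub> g) = plane N C * block_multiplier N C g"
proof -
  let ?D = "C #>\<^bsub>GL N\<^esub> g" and ?m = "coset_multiplier (GL N) (parabolic N) C g"
  let ?t = "coset_rep C"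
  have D: "?D \<in> plane_cosets N" by (rule r_coset_plane_cosets[OF C g])
  note dims = GL_dim[OF g] GL_dim[OF coset_rep_GL[OF C]] GL_dim[OF coset_rep_GL[OF D]]
    GL_dim[OF GL_inv_closed[OF coset_rep_GL[OF C]]] GL_dim[OF GL_inv_closed[OF coset_rep_GL[OF D]]]
  have "?m \<in> parabolic N"
    by (rule group.coset_multiplier_closed[OF group_GL subgroup_parabolic[OF N] C g])
  from parabolicD(3)[OF N this]
  have m: "?m * first_columns N = first_columns N * block_multiplier N C g"
    by (simp add: block_multiplier_def)
  have "?m = ?t * g * inv\<^bsub>GL N\<^esub> (coset_rep ?D)"
    using group.coset_multiplier_eq[OF group_GL subgroup_parabolic[OF N] C g] by simp
  then have "?t * (g * plane N ?D) = first_columns N * block_multiplier N C g"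
    using m dims by (simp add: plane_def mat_mult_assoc)
  then have "inv\<^bsub>GL N\<^esub> ?t * (?t * (g * plane N ?D)) = plane N C * block_multiplier N C g"
    using dims GL_dim[OF block_multiplier_closed[OF C g]] by (simp add: plane_def mat_mult_assoc)
  then show ?thesis
    using GL_inv_cancel(1)[OF coset_rep_GL[OF C], of "g * plane N ?D"] dims by simp
qed

text \<open>A coset is determined by the span of its plane: with representatives t of
  \<open>C\<close> and u of \<open>D\<close>, the matrix u t^-1 maps the standard plane to itself
  and thus is parabolic.\<close>

lemma plane_cosets_eqI:
  assumes C: "C \<in> plane_cosets N" and D: "D \<in> plane_cosets N" and q: "q \<in> carrier (GL 2)"
    and eq: "plane N C = plane N D * q"
  shows "C = D"
proof -
  let ?h = "coset_rep D * inv\<^bsub>GL N\<^esub> (coset_rep C)"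
  note tC = coset_rep_GL[OF C] and tD = coset_rep_GL[OF D]
  have h: "?h \<in> carrier (GL N)" using tC tD GL_inv_closed GL_mult_closed by blast
  have "?h * first_columns N = coset_rep D * plane N C"
    using GL_dim[OF tD] GL_dim[OF GL_inv_closed[OF tC]] by (simp add: plane_def mat_mult_assoc)
  also have "\<dots> = first_columns N * q"
    using GL_dim[OF tD] GL_dim[OF q] plane_dim[OF D] coset_rep_plane[OF D]
    by (simp add: eq flip: mat_mult_assoc)
  finally have "?h \<in> parabolic N" using h q parabolic_iff[OF N] by blast
  moreover have "coset_rep D = ?h * coset_rep C"
    using GL_inv_cancel_right(2)[OF tC] GL_dim[OF tD] by simp
  ultimately have "coset_rep D \<in> parabolic N #>\<^bsub>GL N\<^esub> coset_rep C"
    by (auto simp: r_coset_def)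
  then have "parabolic N #>\<^bsub>GL N\<^esub> coset_rep C = parabolic N #>\<^bsub>GL N\<^esub> coset_rep D"
    by (rule group.repr_independence[OF group_GL _ tC subgroup_parabolic[OF N]])
  then show ?thesis
    using group.coset_rep_mem(3)[OF group_GL subgroup_parabolic[OF N] C]
      group.coset_rep_mem(3)[OF group_GL subgroup_parabolic[OF N] D] by simp
qed

text \<open>Every plane comes from a coset. The given basis may differ from the one that the chosen
  representative dictates, hence the change of basis \<open>q\<close>.\<close>

lemma plane_of_left_invertible:
  fixes B :: "'a::field mat"
  assumes B: "B \<in> carrier_mat N 2" and L: "L \<in> carrier_mat 2 N" "L * B = 1\<^sub>m 2"
  obtains C q where "C \<in> plane_cosets N" "q \<in> carrier (GL 2)" "plane N C = B * q"
proof -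
  obtain g where g: "g \<in> carrier (GL N)" and B_eq: "B = g * first_columns N"
    using left_invertible_columns[OF B L N] by blast
  let ?t = "inv\<^bsub>GL N\<^esub> g"
  let ?C = "parabolic N #>\<^bsub>GL N\<^esub> ?t"
  have t: "?t \<in> carrier (GL N)" using g by (rule GL_inv_closed)
  have C: "?C \<in> plane_cosets N" using t by (auto simp: RCOSETS_def)
  let ?h = "coset_rep ?C"
  note tC = coset_rep_GL[OF C]
  have "?h \<in> ?C" by (rule group.coset_rep_mem(1)[OF group_GL subgroup_parabolic[OF N] C])
  then obtain r where r: "r \<in> parabolic N" "?h = r * ?t" by (auto simp: r_coset_def)
  let ?r' = "inv\<^bsub>GL N\<^esub> r"
  have r': "?r' \<in> parabolic N" using r subgroup.m_inv_closed[OF subgroup_parabolic[OF N]] by blast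
  note rG = parabolicD(1)[OF N r(1)] and r'G = parabolicD(1)[OF N r']
  have "inv\<^bsub>GL N\<^esub> ?h = g * ?r'"
    using group.inv_mult_group[OF group_GL rG t] group.inv_inv[OF group_GL g] by (simp add: r(2))
  then have "plane N ?C = B * upper_left_block ?r'"
    using GL_dim[OF g] GL_dim[OF r'G] GL_dim[OF parabolicD(2)[OF N r']] parabolicD(3)[OF N r']
    by (simp add: plane_def B_eq mat_mult_assoc)
  then show ?thesis using that C parabolicD(2)[OF N r'] by blast
qed

lemma r_coset_eq_of_invariant_plane:
  assumes C: "C \<in> plane_cosets N" and g: "g \<in> carrier (GL N)" and \<psi>: "\<psi> \<in> carrier (GL 2)"
    and inv: "g * plane N C = plane N C * \<psi>"
  shows "C #>\<^bsub>GL N\<^esub> g = C"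
proof -
  let ?D = "C #>\<^bsub>GL N\<^esub> g" and ?m = "block_multiplier N C g" and ?\<psi>' = "inv\<^bsub>GL 2\<^esub> \<psi>"
  have D: "?D \<in> plane_cosets N" by (rule r_coset_plane_cosets[OF C g])
  note m = block_multiplier_closed[OF C g] and \<psi>' = GL_inv_closed[OF \<psi>]
  note dims = plane_dim[OF C] plane_dim[OF D] GL_dim[OF g] GL_dim[OF m] GL_dim[OF \<psi>] GL_dim[OF \<psi>']
  have "g * plane N ?D = plane N C * ?m" by (rule mult_plane[OF C g])
  also have "\<dots> = (plane N C * \<psi> * ?\<psi>') * ?m"
    using dims \<psi> by (simp add: GL_inv_cancel_right)
  also have "\<dots> = g * (plane N C * (?\<psi>' * ?m))"
    using dims by (simp add: mat_mult_assoc flip: inv)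
  finally have "inv\<^bsub>GL N\<^esub> g * (g * plane N ?D) = inv\<^bsub>GL N\<^esub> g * (g * (plane N C * (?\<psi>' * ?m)))"
    by simp
  then have "plane N ?D = plane N C * (?\<psi>' * ?m)"
    using dims g by (simp add: GL_inv_cancel)
  then show ?thesis
    using plane_cosets_eqI[OF D C] GL_mult_closed[OF \<psi>' m] by simp
qed

end

section \<open>Sums over invariant planes\<close>

definition fixed_cosets :: "('g, 'm) monoid_scheme \<Rightarrow> nat \<Rightarrow> ('g \<Rightarrow> 'a::comm_ring_1 mat) \<Rightarrow> 'a mat set set" where
  "fixed_cosets G N \<rho> = {C \<in> plane_cosets N. \<forall>x\<in>carrier G. C #>\<^bsub>GL N\<^esub> \<rho> x = C}"

lemma (in elementary_abelian) family_sum_fixed_cosets: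
  fixes f :: "'c::{comm_ring_1,finite} mat list \<Rightarrow> 'c"
  assumes N: "N \<ge> 2" and \<rho>: "\<rho> \<in> hom G (GL N)" and f: "f \<in> cocycles (GL 2)"
    and char: "of_nat p = (0 :: 'c)"
  shows "cohomology_class G (family_sum G (plane_cosets N) (\<lambda>C x. block_multiplier N C (\<rho> x)) f) =
    cohomology_class G (family_sum G (fixed_cosets G N \<rho>) (\<lambda>C x. block_multiplier N C (\<rho> x)) f)"
proof -
  have \<rho>_closed: "\<rho> x \<in> carrier (GL N)" if "x \<in> carrier G" for x using \<rho> that by (auto simp: hom_def)
  have \<rho>_mult: "\<rho> (x \<otimes> y) = \<rho> x * \<rho> y" if "x \<in> carrier G" "y \<in> carrier G" for x y
    using \<rho> that by (auto simp: hom_def)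
  have \<rho>_one: "\<rho> \<one> = \<one>\<^bsub>GL N\<^esub>" using hom_one[OF \<rho> is_group group_GL] .
  note r_coset_mult = group.r_coset_r_coset[OF group_GL subgroup_parabolic[OF N]]
  interpret twisted_action G p "plane_cosets N" "\<lambda>C x. C #>\<^bsub>GL N\<^esub> \<rho> x" "GL 2"
    "\<lambda>C x. block_multiplier N C (\<rho> x)"
  proof (intro twisted_action.intro elementary_abelian_action.intro right_action.intro
      right_action_axioms.intro twisted_action_axioms.intro)
    show "C #>\<^bsub>GL N\<^esub> \<rho> \<one> = C" if "C \<in> plane_cosets N" for C
      using group.r_coset_one[OF group_GL subgroup_parabolic[OF N] that] by (simp add: \<rho>_one)
  qed (use elementary_abelian_axioms is_group group_GL in
      \<open>auto simp: \<rho>_closed \<rho>_mult r_coset_plane_cosets[OF N] r_coset_mult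
        block_multiplier_closed[OF N] block_multiplier_mult[OF N]\<close>)
  have "finite (plane_cosets N :: 'c mat set set)"
    using finite_GL[where 'a = 'c] by (simp add: RCOSETS_def)
  from family_sum_fixed_points[OF this f char] show ?thesis
    by (simp add: fixed_points_def fixed_cosets_def)
qed

text \<open>\<open>J\<close> embeds \<rho> as a subrepresentation of \<sigma>, with a linear
  retraction \<open>L\<close> that need not be equivariant; the premise \<open>factor\<close> says
  that invariant planes of \<sigma> lie in the image of \<open>J\<close>. So the invariant planes
  correspond, and the two representations on corresponding planes differ by a change of basis, which
  does not affect the class.\<close>

lemma (in group) family_sum_fixed_cosets_comparison:
  fixes f :: "'c::field mat list \<Rightarrow> 'c"
  assumes N: "N \<ge> 2" and M: "M \<ge> 2"
    and \<sigma>: "\<sigma> \<in> hom G (GL N)" and \<rho>: "\<rho> \<in> hom G (GL M)"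
    and J: "J \<in> carrier_mat N M" and L: "L \<in> carrier_mat M N" and LJ: "L * J = 1\<^sub>m M"
    and inter: "\<And>x. x \<in> carrier G \<Longrightarrow> \<sigma> x * J = J * \<rho> x"
    and factor: "\<And>B \<phi>. B \<in> carrier_mat N 2 \<Longrightarrow> (\<And>x. x \<in> carrier G \<Longrightarrow> \<phi> x \<in> carrier (GL 2)) \<Longrightarrow>
      (\<And>x y. x \<in> carrier G \<Longrightarrow> y \<in> carrier G \<Longrightarrow> \<phi> (x \<otimes> y) = \<phi> x * \<phi> y) \<Longrightarrow>
      (\<And>x. x \<in> carrier G \<Longrightarrow> \<sigma> x * B = B * \<phi> x) \<Longrightarrow> B = J * (L * B)"
    and f: "f \<in> cocycles (GL 2)"
  shows "cohomology_class G (family_sum G (fixed_cosets G N \<sigma>) (\<lambda>C x. block_multiplier N C (\<sigma> x)) f) =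
    cohomology_class G (family_sum G (fixed_cosets G M \<rho>) (\<lambda>C x. block_multiplier M C (\<rho> x)) f)"
proof -
  let ?\<phi> = "\<lambda>C x. block_multiplier N C (\<sigma> x)" and ?\<psi> = "\<lambda>C x. block_multiplier M C (\<rho> x)"
  have \<sigma>_closed: "\<sigma> x \<in> carrier (GL N)" and \<rho>_closed: "\<rho> x \<in> carrier (GL M)" if "x \<in> carrier G" for x
    using \<sigma> \<rho> that by (auto simp: hom_def)
  have \<sigma>_mult: "\<sigma> (x \<otimes> y) = \<sigma> x * \<sigma> y" if "x \<in> carrier G" "y \<in> carrier G" for x y
    using \<sigma> that by (auto simp: hom_def)
  have fixN: "C \<in> plane_cosets N" "x \<in> carrier G \<Longrightarrow> C #>\<^bsub>GL N\<^esub> \<sigma> x = C"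
    if "C \<in> fixed_cosets G N \<sigma>" for C x using that by (auto simp: fixed_cosets_def)
  have fixM: "D \<in> plane_cosets M" "x \<in> carrier G \<Longrightarrow> D #>\<^bsub>GL M\<^esub> \<rho> x = D"
    if "D \<in> fixed_cosets G M \<rho>" for D x using that by (auto simp: fixed_cosets_def)
  have \<phi>_closed: "?\<phi> C x \<in> carrier (GL 2)" if "C \<in> fixed_cosets G N \<sigma>" "x \<in> carrier G" for C x
    using block_multiplier_closed[OF N fixN(1)[OF that(1)] \<sigma>_closed[OF that(2)]] .
  have \<psi>_closed: "?\<psi> D x \<in> carrier (GL 2)" if "D \<in> fixed_cosets G M \<rho>" "x \<in> carrier G" for D x
    using block_multiplier_closed[OF M fixM(1)[OF that(1)] \<rho>_closed[OF that(2)]] .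
  have \<phi>_mult: "?\<phi> C (x \<otimes> y) = ?\<phi> C x * ?\<phi> C y"
    if "C \<in> fixed_cosets G N \<sigma>" "x \<in> carrier G" "y \<in> carrier G" for C x y
    using block_multiplier_mult[OF N fixN(1)[OF that(1)] \<sigma>_closed[OF that(2)] \<sigma>_closed[OF that(3)]]
      fixN(2)[OF that(1,2)] that by (simp add: \<sigma>_mult)
  have \<phi>_plane: "\<sigma> x * plane N C = plane N C * ?\<phi> C x"
    if "C \<in> fixed_cosets G N \<sigma>" "x \<in> carrier G" for C x
    using mult_plane[OF N fixN(1)[OF that(1)] \<sigma>_closed[OF that(2)]] fixN(2)[OF that] by simp
  have \<psi>_plane: "\<rho> x * plane M D = plane M D * ?\<psi> D x"
    if "D \<in> fixed_cosets G M \<rho>" "x \<in> carrier G" for D x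
    using mult_plane[OF M fixM(1)[OF that(1)] \<rho>_closed[OF that(2)]] fixM(2)[OF that] by simp
  have LJ_cancel: "L * (J * A) = A" if "dim_row A = M" for A
    using L J LJ that by (simp add: left_mult_one_mat' flip: mat_mult_assoc)
  have down: "\<exists>D q. D \<in> fixed_cosets G M \<rho> \<and> q \<in> carrier (GL 2) \<and> plane N C = J * plane M D * q"
    if C: "C \<in> fixed_cosets G N \<sigma>" for C
  proof -
    let ?B = "plane N C"
    define A where "A = L * ?B"
    note Cc = fixN(1)[OF C]
    have B: "?B \<in> carrier_mat N 2" by (rule plane_carrier[OF N Cc])
    have A: "A \<in> carrier_mat M 2" using L B by (simp add: A_def)
    have BJA: "?B = J * A"
      unfolding A_def by (rule factor[where \<phi> = "?\<phi> C"]) (use B C \<phi>_closed \<phi>_mult \<phi>_plane in auto)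
    \<comment> \<open>\<open>J\<close> intertwines the representations and is injective, so the
      equation is checked after applying \<open>J\<close>, which \<open>L\<close> then
      cancels.\<close>
    have A_inv: "\<rho> x * A = A * ?\<phi> C x" if x: "x \<in> carrier G" for x
    proof -
      have "J * (\<rho> x * A) = J * \<rho> x * A"
        using J A GL_dim[OF \<rho>_closed[OF x]] by (simp add: mat_mult_assoc)
      also have "\<dots> = \<sigma> x * (J * A)"
        using J A GL_dim[OF \<sigma>_closed[OF x]] by (simp add: mat_mult_assoc flip: inter[OF x])
      also have "\<dots> = J * (A * ?\<phi> C x)"
        unfolding BJA[symmetric] \<phi>_plane[OF C x]
        using J A GL_dim[OF \<phi>_closed[OF C x]] by (simp add: BJA mat_mult_assoc)
      finally have "L * (J * (\<rho> x * A)) = L * (J * (A * ?\<phi> C x))" by simp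
      then show ?thesis
        using LJ_cancel[of "\<rho> x * A"] LJ_cancel[of "A * ?\<phi> C x"] A GL_dim[OF \<rho>_closed[OF x]] by simp
    qed
    obtain Z where Z: "Z \<in> carrier_mat 2 N" "Z * ?B = 1\<^sub>m 2" using plane_left_inverse[OF N Cc] by blast
    have "Z * J * A = 1\<^sub>m 2" using Z J A BJA by (simp add: mat_mult_assoc)
    then obtain D q where D: "D \<in> plane_cosets M" and q: "q \<in> carrier (GL 2)" and DA: "plane M D = A * q"
      using plane_of_left_invertible[OF M A, of "Z * J"] Z J by auto
    have "D \<in> fixed_cosets G M \<rho>"
      unfolding fixed_cosets_def
    proof (intro CollectI conjI D ballI)
      fix x assume x: "x \<in> carrier G"
      let ?\<theta> = "inv\<^bsub>GL 2\<^esub> q * ?\<phi> C x * q"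
      note q' = GL_inv_closed[OF q]
      note dims = GL_dim[OF q] GL_dim[OF q'] GL_dim[OF \<phi>_closed[OF C x]] GL_dim[OF \<rho>_closed[OF x]]
      have "\<rho> x * plane M D = A * ?\<phi> C x * q"
        using dims A by (simp add: DA A_inv[OF x] flip: mat_mult_assoc)
      also have "\<dots> = A * q * inv\<^bsub>GL 2\<^esub> q * ?\<phi> C x * q"
        using A q by (simp add: GL_inv_cancel_right)
      also have "\<dots> = plane M D * ?\<theta>"
        using dims A by (simp add: DA mat_mult_assoc)
      finally show "D #>\<^bsub>GL M\<^esub> \<rho> x = D"
        using r_coset_eq_of_invariant_plane[OF M D \<rho>_closed[OF x]] GL_mult_closed q q' \<phi>_closed[OF C x]
        by blast
    qed
    moreover have "plane N C = J * plane M D * inv\<^bsub>GL 2\<^esub> q"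
    proof -
      have "J * plane M D * inv\<^bsub>GL 2\<^esub> q = J * (A * q * inv\<^bsub>GL 2\<^esub> q)"
        using J A GL_dim[OF q] GL_dim[OF GL_inv_closed[OF q]] by (simp add: DA mat_mult_assoc)
      also have "\<dots> = ?B" using A q BJA by (simp add: GL_inv_cancel_right)
      finally show ?thesis by simp
    qed
    ultimately show ?thesis using GL_inv_closed[OF q] by blast
  qed
  have up: "\<exists>C q. C \<in> fixed_cosets G N \<sigma> \<and> q \<in> carrier (GL 2) \<and> plane N C = J * plane M D * q"
    if D: "D \<in> fixed_cosets G M \<rho>" for D
  proof -
    let ?A = "plane M D"
    note Dc = fixM(1)[OF D]
    have A: "?A \<in> carrier_mat M 2" by (rule plane_carrier[OF M Dc])
    obtain Z where Z: "Z \<in> carrier_mat 2 M" "Z * ?A = 1\<^sub>m 2" using plane_left_inverse[OF M Dc] by blast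
    have "Z * L * (J * ?A) = 1\<^sub>m 2" using Z L J A LJ_cancel by (simp add: mat_mult_assoc)
    then obtain C q where C: "C \<in> plane_cosets N" and q: "q \<in> carrier (GL 2)" and CA: "plane N C = J * ?A * q"
      using plane_of_left_invertible[OF N, of "J * ?A" "Z * L"] Z L J A by auto
    have "C \<in> fixed_cosets G N \<sigma>"
      unfolding fixed_cosets_def
    proof (intro CollectI conjI C ballI)
      fix x assume x: "x \<in> carrier G"
      let ?\<theta> = "inv\<^bsub>GL 2\<^esub> q * ?\<psi> D x * q"
      note q' = GL_inv_closed[OF q]
      note dims = GL_dim[OF q] GL_dim[OF q'] GL_dim[OF \<psi>_closed[OF D x]] GL_dim[OF \<rho>_closed[OF x]]
        GL_dim[OF \<sigma>_closed[OF x]]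
      have "\<sigma> x * plane N C = \<sigma> x * J * ?A * q"
        using dims J A by (simp add: CA mat_mult_assoc)
      also have "\<dots> = J * (\<rho> x * ?A) * q"
        using dims J A by (simp add: inter[OF x] mat_mult_assoc)
      also have "\<dots> = J * ?A * ?\<psi> D x * q"
        using dims J A by (simp add: \<psi>_plane[OF D x] mat_mult_assoc)
      also have "\<dots> = J * ?A * q * inv\<^bsub>GL 2\<^esub> q * ?\<psi> D x * q"
        using J A q by (simp add: GL_inv_cancel_right)
      also have "\<dots> = plane N C * ?\<theta>"
        using dims J A by (simp add: CA mat_mult_assoc)
      finally show "C #>\<^bsub>GL N\<^esub> \<sigma> x = C"
        using r_coset_eq_of_invariant_plane[OF N C \<sigma>_closed[OF x]] GL_mult_closed q q' \<psi>_closed[OF D x]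
        by blast
    qed
    then show ?thesis using q CA by blast
  qed
  from down obtain \<beta> q where \<beta>: "\<And>C. C \<in> fixed_cosets G N \<sigma> \<Longrightarrow> \<beta> C \<in> fixed_cosets G M \<rho>"
    and q: "\<And>C. C \<in> fixed_cosets G N \<sigma> \<Longrightarrow> q C \<in> carrier (GL 2)"
    and \<beta>q: "\<And>C. C \<in> fixed_cosets G N \<sigma> \<Longrightarrow> plane N C = J * plane M (\<beta> C) * q C"
    by metis
  have proportional: "A = B * (s * inv\<^bsub>GL 2\<^esub> r)"
    if "A * r = B * s" "r \<in> carrier (GL 2)" "s \<in> carrier (GL 2)" "dim_col A = 2" "dim_col B = 2" for A B r s :: "'c mat"
  proof -
    have "A = B * s * inv\<^bsub>GL 2\<^esub> r" using that by (simp add: GL_inv_cancel_right flip: that(1))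
    then show ?thesis
      using that(5) GL_dim[OF that(2)] GL_dim[OF that(3)] GL_dim[OF GL_inv_closed[OF that(2)]]
      by (simp add: mat_mult_assoc)
  qed
  have bij: "bij_betw \<beta> (fixed_cosets G N \<sigma>) (fixed_cosets G M \<rho>)"
    unfolding bij_betw_def
  proof (intro conjI inj_onI)
    fix C C' assume C: "C \<in> fixed_cosets G N \<sigma>" and C': "C' \<in> fixed_cosets G N \<sigma>" and eq: "\<beta> C = \<beta> C'"
    let ?B = "J * plane M (\<beta> C)"
    note D = fixM(1)[OF \<beta>[OF C]]
    have q'C: "inv\<^bsub>GL 2\<^esub> (q C) \<in> carrier (GL 2)" using GL_inv_closed[OF q[OF C]] .
    have "?B = plane N C * inv\<^bsub>GL 2\<^esub> (q C)"
      using q[OF C] plane_dim[OF M D] by (simp add: \<beta>q[OF C] GL_inv_cancel_right)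
    then have "plane N C' = plane N C * (inv\<^bsub>GL 2\<^esub> (q C) * q C')"
      using GL_dim[OF q'C] GL_dim[OF q[OF C']] plane_dim[OF N fixN(1)[OF C]]
      by (simp add: \<beta>q[OF C'] flip: eq) (simp add: mat_mult_assoc)
    then show "C = C'"
      using plane_cosets_eqI[OF N fixN(1)[OF C'] fixN(1)[OF C]] GL_mult_closed[OF q'C q[OF C']] by auto
  next
    have "D \<in> \<beta> ` fixed_cosets G N \<sigma>" if D: "D \<in> fixed_cosets G M \<rho>" for D
    proof -
      obtain C r where C: "C \<in> fixed_cosets G N \<sigma>" and r: "r \<in> carrier (GL 2)"
        and CD: "plane N C = J * plane M D * r" using up[OF D] by blast
      note dims = plane_dim[OF M fixM(1)[OF D]] plane_dim[OF M fixM(1)[OF \<beta>[OF C]]]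
        GL_dim[OF r] GL_dim[OF q[OF C]]
      have "J * (plane M D * r) = J * (plane M (\<beta> C) * q C)"
        using dims J CD \<beta>q[OF C] by (simp add: mat_mult_assoc)
      then have "L * (J * (plane M D * r)) = L * (J * (plane M (\<beta> C) * q C))" by simp
      then have "plane M D * r = plane M (\<beta> C) * q C" using dims LJ_cancel by simp
      then have "plane M D = plane M (\<beta> C) * (q C * inv\<^bsub>GL 2\<^esub> r)"
        using proportional[OF _ r q[OF C]] dims by blast
      then have "D = \<beta> C"
        using plane_cosets_eqI[OF M fixM(1)[OF D] fixM(1)[OF \<beta>[OF C]]]
          GL_mult_closed[OF q[OF C] GL_inv_closed[OF r]] by blast
      then show ?thesis using C by blast
    qed
    then show "\<beta> ` fixed_cosets G N \<sigma> = fixed_cosets G M \<rho>" using \<beta> by blast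
  qed
  \<comment> \<open>Both planes carry the same action of x, read in two bases related by
    \<open>q C\<close>; a left inverse \<open>Z\<close> of the basis cancels it.\<close>
  have conj: "?\<psi> (\<beta> C) x = q C * (?\<phi> C x * inv\<^bsub>GL 2\<^esub> (q C))"
    if C: "C \<in> fixed_cosets G N \<sigma>" and x: "x \<in> carrier G" for C x
  proof -
    let ?A = "plane M (\<beta> C)"
    note D = \<beta>[OF C] and qC = q[OF C]
    note q' = GL_inv_closed[OF qC]
    note dims = plane_dim[OF M fixM(1)[OF D]] GL_dim[OF qC] GL_dim[OF q'] GL_dim[OF \<phi>_closed[OF C x]]
      GL_dim[OF \<psi>_closed[OF D x]] GL_dim[OF \<sigma>_closed[OF x]] GL_dim[OF \<rho>_closed[OF x]]
    have "J * (?A * (q C * ?\<phi> C x)) = plane N C * ?\<phi> C x"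
      using dims J by (simp add: \<beta>q[OF C] mat_mult_assoc)
    also have "\<dots> = \<sigma> x * (J * ?A * q C)"
      by (simp flip: \<phi>_plane[OF C x] \<beta>q[OF C])
    also have "\<dots> = (\<sigma> x * J) * ?A * q C"
      using dims J by (simp add: mat_mult_assoc)
    also have "\<dots> = J * (\<rho> x * ?A * q C)"
      using dims J by (simp add: inter[OF x] mat_mult_assoc)
    also have "\<dots> = J * (?A * (?\<psi> (\<beta> C) x * q C))"
      using dims by (simp add: \<psi>_plane[OF D x] mat_mult_assoc)
    finally have "L * (J * (?A * (q C * ?\<phi> C x))) = L * (J * (?A * (?\<psi> (\<beta> C) x * q C)))" by simp
    then have eqA: "?A * (q C * ?\<phi> C x) = ?A * (?\<psi> (\<beta> C) x * q C)" using dims LJ_cancel by simp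
    obtain Z where Z: "Z \<in> carrier_mat 2 M" "Z * ?A = 1\<^sub>m 2"
      using plane_left_inverse[OF M fixM(1)[OF D]] by blast
    have "Z * ?A * (q C * ?\<phi> C x) = Z * ?A * (?\<psi> (\<beta> C) x * q C)"
      using dims Z(1) eqA by (simp add: mat_mult_assoc)
    then have "?\<psi> (\<beta> C) x * q C = q C * ?\<phi> C x"
      using dims by (simp add: Z(2) left_mult_one_mat')
    then have "?\<psi> (\<beta> C) x = q C * ?\<phi> C x * inv\<^bsub>GL 2\<^esub> (q C)"
      using GL_inv_cancel_right(1)[OF qC, of "?\<psi> (\<beta> C) x"] dims by simp
    then show ?thesis using dims by (simp add: mat_mult_assoc)
  qed
  have fc: "f \<in> cochains (GL 2)" using f by (simp add: cocycles_iff)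
  \<comment> \<open>A conjugation is split in two: the left factor \<open>q C\<close> is absorbed by
    the invariance of cochains, and the right factor by a homotopy, since \<open>?\<phi>'\<close>
    has the same left multipliers as \<open>?\<phi>\<close>.\<close>
  let ?\<phi>' = "\<lambda>C x. ?\<phi> C x * inv\<^bsub>GL 2\<^esub> (q C)"
  have \<phi>'_closed: "?\<phi>' C x \<in> carrier (GL 2)" if "C \<in> fixed_cosets G N \<sigma>" "x \<in> carrier G" for C x
    using GL_mult_closed[OF \<phi>_closed[OF that] GL_inv_closed[OF q[OF that(1)]]] .
  have "family_sum G (fixed_cosets G M \<rho>) ?\<psi> f = family_sum G (fixed_cosets G N \<sigma>) ?\<phi>' f"
  proof
    fix xs
    have "(\<Sum>D\<in>fixed_cosets G M \<rho>. f (map (?\<psi> D) xs)) = (\<Sum>C\<in>fixed_cosets G N \<sigma>. f (map (?\<phi>' C) xs))"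
      if xs: "set xs \<subseteq> carrier G"
    proof -
      have "f (map (?\<psi> (\<beta> C)) xs) = f (map (?\<phi>' C) xs)" if C: "C \<in> fixed_cosets G N \<sigma>" for C
      proof -
        have "map (?\<psi> (\<beta> C)) xs = map (\<lambda>y. q C \<otimes>\<^bsub>GL 2\<^esub> y) (map (?\<phi>' C) xs)"
          using xs conj[OF C] by auto
        also have "f \<dots> = f (map (?\<phi>' C) xs)"
          by (intro cochains_invariant[OF fc q[OF C]]) (use xs \<phi>'_closed[OF C] in auto)
        finally show ?thesis .
      qed
      then show ?thesis by (simp flip: sum.reindex_bij_betw[OF bij])
    qed
    then show "family_sum G (fixed_cosets G M \<rho>) ?\<psi> f xs = family_sum G (fixed_cosets G N \<sigma>) ?\<phi>' f xs"
      by (simp add: family_sum_def)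
  qed
  moreover have "cohomology_class G (family_sum G (fixed_cosets G N \<sigma>) ?\<phi> f) =
      cohomology_class G (family_sum G (fixed_cosets G N \<sigma>) ?\<phi>' f)"
  proof (rule family_sum_homotopy[OF _ _ f monoid_axioms])
    show "equivariant_family G (GL 2) (fixed_cosets G N \<sigma>) (\<lambda>_ C. C) (\<lambda>g C. ?\<phi> C g) ?\<phi>"
      by (rule equivariant_familyI) (auto simp: \<phi>_closed \<phi>_mult bij_betw_def)
    show "equivariant_family G (GL 2) (fixed_cosets G N \<sigma>) (\<lambda>_ C. C) (\<lambda>g C. ?\<phi> C g) ?\<phi>'"
    proof (rule equivariant_familyI)
      fix g C x assume g: "g \<in> carrier G" and C: "C \<in> fixed_cosets G N \<sigma>" and x: "x \<in> carrier G"
      then show "?\<phi>' C (g \<otimes> x) = ?\<phi> C g \<otimes>\<^bsub>GL 2\<^esub> ?\<phi>' C x"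
        using GL_dim[OF \<phi>_closed[OF C g]] GL_dim[OF \<phi>_closed[OF C x]] GL_dim[OF GL_inv_closed[OF q[OF C]]]
        by (simp add: \<phi>_mult mat_mult_assoc)
    qed (auto simp: \<phi>_closed \<phi>'_closed bij_betw_def)
  qed
  ultimately show ?thesis by simp
qed

section \<open>Two-dimensional representations of elementary abelian groups\<close>

lemma mat2_mult:
  fixes A B :: "'a::comm_ring_1 mat"
  assumes "A \<in> carrier_mat N 2" "B \<in> carrier_mat 2 2" "i < N" "j < 2"
  shows "(A * B) $$ (i, j) = A $$ (i, 0) * B $$ (0, j) + A $$ (i, 1) * B $$ (1, j)"
  using assms by (simp add: scalar_prod_def numeral_2_eq_2)

text \<open>Two trace-zero matrices X = (a, b; c, -a) and Y = (d, e; g, -d) that kill the same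
  nonzero vector (u, v) are multiples of one nilpotent matrix, so X Y = 0. The conclusions are the
  entries of (1 + X)(1 + Y) = (1 + X) + (1 + Y) - 1.\<close>

lemma common_kernel_trace_zero_mult:
  fixes a b c d e g u v :: "'a::field"
  assumes A: "a * u + b * v = 0" "c * u - a * v = 0"
    and B: "d * u + e * v = 0" "g * u - d * v = 0" and nz: "u \<noteq> 0 \<or> v \<noteq> 0"
  shows "(1 + a) * (1 + d) + b * g = (1 + a) + (1 + d) - 1" "(1 + a) * e + b * (1 - d) = b + e"
    "c * (1 + d) + (1 - a) * g = c + g" "c * e + (1 - a) * (1 - d) = (1 - a) + (1 - d) - 1"
proof -
  have "a * d + b * g = 0 \<and> a * e - b * d = 0 \<and> c * d - a * g = 0 \<and> c * e + a * d = 0"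
  proof (cases "u = 0")
    case True
    then have "b = 0" "a = 0" "e = 0" "d = 0" using A B nz by auto
    then show ?thesis by simp
  next
    case False
    define r where "r = v / u"
    have "a = - b * r" "c = a * r" "d = - e * r" "g = d * r"
      using A B False by (simp_all add: r_def field_simps eq_neg_iff_add_eq_0)
    then show ?thesis by (simp add: algebra_simps)
  qed
  then show "(1 + a) * (1 + d) + b * g = (1 + a) + (1 + d) - 1" "(1 + a) * e + b * (1 - d) = b + e"
    "c * (1 + d) + (1 - a) * g = c + g" "c * e + (1 - a) * (1 - d) = (1 - a) + (1 - d) - 1"
    by (simp_all add: algebra_simps eq_neg_iff_add_eq_0)
qed

text \<open>An elementary abelian \<open>p\<close>-group acts on the nonzero vectors and, through the determinant, on
  the nonzero scalars.  Neither set has a cardinality divisible by \<open>p\<close>, so there are a fixed vector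
  and determinant \<open>1\<close>; hence the maps \<open>\<phi> x - 1\<close> have product zero.\<close>

lemma (in elementary_abelian) two_dimensional_rep_unipotent:
  fixes \<phi> :: "'a \<Rightarrow> 'q::prime_card mod_ring mat"
  assumes p: "p = CARD('q)"
    and closed: "\<And>x. x \<in> carrier G \<Longrightarrow> \<phi> x \<in> carrier (GL 2)"
    and mult: "\<And>x y. x \<in> carrier G \<Longrightarrow> y \<in> carrier G \<Longrightarrow> \<phi> (x \<otimes> y) = \<phi> x * \<phi> y"
    and xy: "x \<in> carrier G" "y \<in> carrier G" and ij: "i < 2" "j < 2"
  shows "\<phi> (x \<otimes> y) $$ (i, j) = \<phi> x $$ (i, j) + \<phi> y $$ (i, j) - (if i = j then 1 else 0)"
proof -
  have hom: "\<phi> \<in> hom G (GL 2)" using closed mult by (auto simp: hom_def)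
  have one: "\<phi> \<one> = 1\<^sub>m 2" using hom_one[OF hom is_group group_GL] by simp
  have carr: "\<phi> x \<in> carrier_mat 2 2" if "x \<in> carrier G" for x using closed[OF that] by (rule GL_carrier_mat)
  have prod: "\<phi> (x \<otimes> y) $$ (i, j) = \<phi> x $$ (i, 0) * \<phi> y $$ (0, j) + \<phi> x $$ (i, 1) * \<phi> y $$ (1, j)"
    if "x \<in> carrier G" "y \<in> carrier G" "i < 2" "j < 2" for x y i j
    using that mat2_mult[OF carr carr] by (simp add: mult)
  define d where "d x = \<phi> x $$ (0, 0) * \<phi> x $$ (1, 1) - \<phi> x $$ (0, 1) * \<phi> x $$ (1, 0)" for x
  have d_mult: "d (x \<otimes> y) = d x * d y" if "x \<in> carrier G" "y \<in> carrier G" for x y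
    using that by (simp add: d_def prod algebra_simps)
  have d_one: "d \<one> = 1" by (simp add: d_def one)
  have d_nz: "d x \<noteq> 0" if "x \<in> carrier G" for x
    using d_mult[of x "inv x"] that d_one by auto
  have two: "p \<ge> 2" using prime_exponent by (rule prime_ge_2_nat)
  have "d x = 1" if x: "x \<in> carrier G" for x
  proof -
    interpret D: elementary_abelian_action G p "UNIV - {0} :: 'q mod_ring set" "\<lambda>a x. d x * a"
      by (intro elementary_abelian_action.intro right_action.intro right_action_axioms.intro)
        (use elementary_abelian_axioms is_group in \<open>auto simp: d_nz d_one d_mult\<close>)
    have "card (UNIV - {0} :: 'q mod_ring set) = p - 1"
      by (simp add: p card_Diff_singleton)
    then have "\<not> p dvd card (UNIV - {0} :: 'q mod_ring set)" using two by (auto dest: dvd_imp_le)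
    then have "D.fixed_points \<noteq> {}" using D.prime_dvd_card by auto
    then obtain a where "a \<noteq> 0" "\<forall>x\<in>carrier G. d x * a = a"
      unfolding D.fixed_points_def by auto
    then show ?thesis using x by auto
  qed
  then have det: "\<phi> x $$ (0, 0) * \<phi> x $$ (1, 1) - \<phi> x $$ (0, 1) * \<phi> x $$ (1, 0) = 1"
    if "x \<in> carrier G" for x using that by (simp add: d_def)
  define act where "act w x = (\<phi> x $$ (0, 0) * fst w + \<phi> x $$ (0, 1) * snd w,
    \<phi> x $$ (1, 0) * fst w + \<phi> x $$ (1, 1) * snd w)" for w x
  have act_act: "act (act w x) y = act w (x \<otimes> y)" if "x \<in> carrier G" "y \<in> carrier G" for w x y
  proof -
    \<comment> \<open>Matrices act from the left, so the order is reversed; commutativity of the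
      group makes this a right action.\<close>
    have "act (act w x) y = act w (y \<otimes> x)"
      using that by (simp add: act_def prod algebra_simps)
    then show ?thesis using that by (simp add: m_comm)
  qed
  have act_one: "act w \<one> = w" for w by (simp add: act_def one)
  have act_zero: "act (0, 0) x = (0, 0)" for x by (simp add: act_def)
  have act_nz: "act w x \<noteq> (0, 0)" if "w \<noteq> (0, 0)" "x \<in> carrier G" for w x
  proof
    assume "act w x = (0, 0)"
    then have "act (act w x) (inv x) = (0, 0)" by (simp add: act_zero)
    then show False using that by (simp add: act_act act_one)
  qed
  interpret W: elementary_abelian_action G p "UNIV - {(0, 0)} :: ('q mod_ring \<times> 'q mod_ring) set" act
    by (intro elementary_abelian_action.intro right_action.intro right_action_axioms.intro)
      (use elementary_abelian_axioms is_group in \<open>auto simp: act_act act_one act_nz simp del: prod.inject\<close>)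
  have "card (UNIV - {(0, 0)} :: ('q mod_ring \<times> 'q mod_ring) set) = p * p - 1"
    by (simp add: p card_Diff_singleton card_prod)
  moreover have "\<not> p dvd p * p - 1"
  proof
    assume "p dvd p * p - 1"
    moreover have "p * p - (p * p - 1) = 1" using two by simp
    ultimately have "p dvd 1" by (metis dvd_diff_nat dvd_triv_left)
    then show False using two by simp
  qed
  ultimately have "W.fixed_points \<noteq> {}" using W.prime_dvd_card by auto
  then obtain w where w: "w \<noteq> (0, 0)" "\<And>x. x \<in> carrier G \<Longrightarrow> act w x = w"
    unfolding W.fixed_points_def by auto
  obtain u v where uv: "w = (u, v)" by (cases w)
  have nz: "u \<noteq> 0 \<or> v \<noteq> 0" using w(1) by (simp add: uv)
  have fix0: "(\<phi> x $$ (0, 0) - 1) * u + \<phi> x $$ (0, 1) * v = 0" and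
    fix1: "\<phi> x $$ (1, 0) * u + (\<phi> x $$ (1, 1) - 1) * v = 0" if "x \<in> carrier G" for x
    using w(2)[OF that] by (simp_all add: uv act_def algebra_simps)
  \<comment> \<open>The fixed vector makes \<open>\<phi> x\<close> - 1 singular, which Cramer's
    identities show without division; expanding the determinant 1 of \<open>\<phi> x\<close> around
    the identity then leaves a vanishing trace.\<close>
  have trace: "\<phi> x $$ (1, 1) - 1 = - (\<phi> x $$ (0, 0) - 1)" if x: "x \<in> carrier G" for x
  proof -
    let ?a = "\<phi> x $$ (0, 0) - 1" and ?b = "\<phi> x $$ (0, 1)" and ?c = "\<phi> x $$ (1, 0)" and ?e = "\<phi> x $$ (1, 1) - 1"
    have "(?a * ?e - ?b * ?c) * u = ?e * (?a * u + ?b * v) - ?b * (?c * u + ?e * v)"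
      "(?a * ?e - ?b * ?c) * v = ?a * (?c * u + ?e * v) - ?c * (?a * u + ?b * v)"
      by (simp_all add: algebra_simps)
    then have "?a * ?e - ?b * ?c = 0" using nz fix0[OF x] fix1[OF x] by auto
    then show ?thesis using det[OF x] by (simp add: algebra_simps)
  qed
  have fix1': "\<phi> x $$ (1, 0) * u - (\<phi> x $$ (0, 0) - 1) * v = 0" if "x \<in> carrier G" for x
    using fix1[OF that] unfolding trace[OF that] by (simp only: mult_minus_left add_uminus_conv_diff)
  have diag: "1 + (\<phi> x $$ (0, 0) - 1) = \<phi> x $$ (0, 0)"
    "1 - (\<phi> x $$ (0, 0) - 1) = \<phi> x $$ (1, 1)" if "x \<in> carrier G" for x
    using trace[OF that] by (simp_all add: algebra_simps)
  note sum = common_kernel_trace_zero_mult[OF fix0[OF xy(1)] fix1'[OF xy(1)] fix0[OF xy(2)] fix1'[OF xy(2)] nz,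
      unfolded diag[OF xy(1)] diag[OF xy(2)]]
  have "i = 0 \<or> i = 1" "j = 0 \<or> j = 1" using ij by auto
  then show ?thesis
    unfolding prod[OF xy ij] using sum by (elim disjE) simp_all
qed

section \<open>The regular representation and affine functions\<close>

lemma elementary_abelian_vec:
  "elementary_abelian (monoid_vec TYPE('q::prime_card mod_ring) n) CARD('q)"
proof (intro elementary_abelian.intro elementary_abelian_axioms.intro)
  show "comm_group (monoid_vec TYPE('q mod_ring) n)" by (rule comm_group_vec)
  show "Factorial_Ring.prime CARD('q)" by (rule prime_card)
  show "finite (carrier (monoid_vec TYPE('q mod_ring) n))" by (simp add: monoid_vec_simps)
  fix x :: "'q mod_ring vec" assume x: "x \<in> carrier (monoid_vec TYPE('q mod_ring) n)"
  have "x [^]\<^bsub>monoid_vec TYPE('q mod_ring) n\<^esub> k = of_nat k \<cdot>\<^sub>v x" for k :: nat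
  proof (induction k)
    case 0
    show ?case using x by (auto simp: nat_pow_def monoid_vec_simps)
  next
    case (Suc k)
    then show ?case
      using x by (auto simp: nat_pow_def monoid_vec_simps algebra_simps)
  qed
  then show "x [^]\<^bsub>monoid_vec TYPE('q mod_ring) n\<^esub> CARD('q) = \<one>\<^bsub>monoid_vec TYPE('q mod_ring) n\<^esub>"
    using x by (auto simp: monoid_vec_simps)
qed

text \<open>Every scalar of the prime field is a multiple of 1, so an additive map respects scalars
  as well.\<close>

lemma additive_imp_linear:
  fixes h :: "'q::prime_card mod_ring vec \<Rightarrow> 'q mod_ring"
  assumes add: "\<And>x y. x \<in> carrier_vec n \<Longrightarrow> y \<in> carrier_vec n \<Longrightarrow> h (x + y) = h x + h y"
    and v: "v \<in> carrier_vec n"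
  shows "h v = (\<Sum>i<n. v $ i * h (unit_vec n i))"
proof -
  have "h (0\<^sub>v n + 0\<^sub>v n) = h (0\<^sub>v n) + h (0\<^sub>v n)" by (rule add) simp_all
  then have zero: "h (0\<^sub>v n) = 0" by (simp only: left_zero_vec[OF zero_carrier_vec] add_cancel_right_right)
  have "h (of_nat k \<cdot>\<^sub>v x) = of_nat k * h x" if x: "x \<in> carrier_vec n" for k x
  proof (induction k)
    case 0
    have "0 \<cdot>\<^sub>v x = 0\<^sub>v n" using x by auto
    then show ?case by (simp add: zero)
  next
    case (Suc k)
    have "of_nat (Suc k) \<cdot>\<^sub>v x = x + of_nat k \<cdot>\<^sub>v x" using x by (auto simp: algebra_simps)
    then show ?case using Suc x by (simp add: add algebra_simps)
  qed
  then have scale: "h (a \<cdot>\<^sub>v x) = a * h x" if "x \<in> carrier_vec n" for a x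
    using that surj_of_nat_mod_ring[of a] by auto
  have partial: "h (vec n (\<lambda>i. if i < m then v $ i else 0)) = (\<Sum>i<m. v $ i * h (unit_vec n i))" if "m \<le> n" for m
    using that
  proof (induction m)
    case 0
    have "vec n (\<lambda>i. if i < 0 then v $ i else 0) = 0\<^sub>v n" by auto
    then show ?case by (simp add: zero)
  next
    case (Suc m)
    have "vec n (\<lambda>i. if i < Suc m then v $ i else 0) =
        vec n (\<lambda>i. if i < m then v $ i else 0) + v $ m \<cdot>\<^sub>v unit_vec n m"
      using Suc.prems by (intro eq_vecI) (auto simp: less_Suc_eq)
    then show ?case using Suc by (simp add: add scale)
  qed
  have "vec n (\<lambda>i. if i < n then v $ i else 0) = v" using v by (intro eq_vecI) auto
  then show ?thesis using partial[of n] by simp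
qed

context
  fixes n N :: nat and e :: "nat \<Rightarrow> 'q::prime_card mod_ring vec"
  assumes e: "bij_betw e {..<N} (carrier_vec n)"
begin

text \<open>A function on the space is a column of length \<open>N\<close>: row i holds its value at
  the point \<open>e i\<close>, so the value at a point v stands in row
  \<open>ind v\<close>.\<close>

definition ind :: "'q mod_ring vec \<Rightarrow> nat" where
  "ind = inv_into {..<N} e"

lemma e_carrier: "i < N \<Longrightarrow> e i \<in> carrier_vec n"
  using e by (auto simp: bij_betw_def)

lemma ind_less: "v \<in> carrier_vec n \<Longrightarrow> ind v < N"
  using e inv_into_into[of v e "{..<N}"] by (auto simp: bij_betw_def ind_def)

lemma e_ind: "v \<in> carrier_vec n \<Longrightarrow> e (ind v) = v"
  using e f_inv_into_f[of v e "{..<N}"] by (auto simp: bij_betw_def ind_def)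

lemma ind_e: "i < N \<Longrightarrow> ind (e i) = i"
  using e inv_into_f_f[of e "{..<N}" i] by (auto simp: bij_betw_def ind_def)

text \<open>The matrix of the translation \<open>f \<mapsto> f(\<cdot> + x)\<close> of functions on \<open>carrier_vec n\<close>, in the basis of
  indicator functions.\<close>

definition translation :: "'q mod_ring vec \<Rightarrow> 'q mod_ring mat" where
  "translation x = mat N N (\<lambda>(i, j). if j = ind (e i + x) then 1 else 0)"

text \<open>The columns are the functions \<open>v \<mapsto> 1\<close> and \<open>v \<mapsto> v $ j\<close>.\<close>

definition affine_functions :: "'q mod_ring mat" where
  "affine_functions = mat N (n + 1) (\<lambda>(i, j). if j = 0 then 1 else e i $ (j - 1))"

text \<open>Reads off an affine function its value at 0 and its increments from 0 to the unit
  vectors. Applied to arbitrary functions this is a linear retraction onto the affine ones, in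
  general not compatible with translations.\<close>

definition affine_part :: "'q mod_ring mat" where
  "affine_part = mat (n + 1) N (\<lambda>(j, i).
     if j = 0 then (if i = ind (0\<^sub>v n) then 1 else 0)
     else (if i = ind (unit_vec n (j - 1)) then 1 else 0) - (if i = ind (0\<^sub>v n) then 1 else 0))"

lemma affine_carrier [simp]:
  "translation x \<in> carrier_mat N N" "affine_functions \<in> carrier_mat N (n + 1)"
  "affine_part \<in> carrier_mat (n + 1) N"
  by (simp_all add: translation_def affine_functions_def affine_part_def)

lemma mult_index_sum:
  assumes "A \<in> carrier_mat nr m" "B \<in> carrier_mat m nc" "i < nr" "k < nc"
  shows "(A * B) $$ (i, k) = (\<Sum>j<m. A $$ (i, j) * (B $$ (j, k) :: 'q mod_ring))"
  using assms by (auto simp: scalar_prod_def lessThan_atLeast0 intro!: sum.cong)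

lemma translation_mult:
  assumes B: "B \<in> carrier_mat N nc" and x: "x \<in> carrier_vec n" and ik: "i < N" "k < nc"
  shows "(translation x * B) $$ (i, k) = B $$ (ind (e i + x), k)"
proof -
  have ind: "ind (e i + x) < N" using ik x e_carrier by (intro ind_less) auto
  have "(translation x * B) $$ (i, k) = (\<Sum>j<N. if j = ind (e i + x) then B $$ (j, k) else 0)"
    unfolding mult_index_sum[OF affine_carrier(1) B ik]
    by (intro sum.cong refl) (use ik in \<open>auto simp: translation_def\<close>)
  then show ?thesis using ind by simp
qed

lemma affine_part_mult:
  assumes B: "B \<in> carrier_mat N nc" and jk: "j < n + 1" "k < nc"
  shows "(affine_part * B) $$ (j, k) = (if j = 0 then B $$ (ind (0\<^sub>v n), k)
    else B $$ (ind (unit_vec n (j - 1)), k) - B $$ (ind (0\<^sub>v n), k))"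
proof -
  have sum: "(\<Sum>i<N. (if i = ind v then 1 else 0) * B $$ (i, k)) = B $$ (ind v, k)" if "v \<in> carrier_vec n" for v
  proof -
    have "(\<Sum>i<N. (if i = ind v then 1 else 0) * B $$ (i, k)) = (\<Sum>i<N. if i = ind v then B $$ (i, k) else 0)"
      by (intro sum.cong) auto
    then show ?thesis using ind_less[OF that] by simp
  qed
  have "(affine_part * B) $$ (j, k) = (\<Sum>i<N. (if j = 0 then (if i = ind (0\<^sub>v n) then 1 else 0)
     else (if i = ind (unit_vec n (j - 1)) then 1 else 0) - (if i = ind (0\<^sub>v n) then 1 else 0)) * B $$ (i, k))"
    unfolding mult_index_sum[OF affine_carrier(3) B jk]
    by (intro sum.cong refl) (use jk in \<open>auto simp: affine_part_def\<close>)
  then show ?thesis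
    using sum[of "0\<^sub>v n"] sum[of "unit_vec n (j - 1)"]
    by (cases "j = 0") (simp_all add: left_diff_distrib sum_subtractf)
qed

lemma affine_functions_mult:
  assumes A: "A \<in> carrier_mat (n + 1) nc" and ik: "i < N" "k < nc"
  shows "(affine_functions * A) $$ (i, k) = A $$ (0, k) + (\<Sum>j<n. e i $ j * A $$ (j + 1, k))"
  unfolding mult_index_sum[OF affine_carrier(2) A ik]
  using ik by (simp add: sum.lessThan_Suc_shift affine_functions_def del: sum.lessThan_Suc)

lemma affine_part_affine_functions: "affine_part * affine_functions = 1\<^sub>m (n + 1)"
proof (rule eq_matI)
  fix j k assume "j < dim_row (1\<^sub>m (n + 1) :: 'q mod_ring mat)" "k < dim_col (1\<^sub>m (n + 1) :: 'q mod_ring mat)"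
  then have jk: "j < n + 1" "k < n + 1" by auto
  have J: "affine_functions $$ (ind v, k) = (if k = 0 then 1 else v $ (k - 1))"
    if "v \<in> carrier_vec n" "k < n + 1" for v k
    using that(2) ind_less[OF that(1)] e_ind[OF that(1)] by (simp add: affine_functions_def)
  show "(affine_part * affine_functions) $$ (j, k) = 1\<^sub>m (n + 1) $$ (j, k)"
    using jk by (auto simp: affine_part_mult[OF affine_carrier(2) jk] J)
qed (simp_all add: affine_functions_def affine_part_def)

text \<open>Translating the function c + u(v) of v by x gives (c + u(x)) + u(v), which is the basic
  representation on the pair (c, u).\<close>

lemma translation_affine_functions:
  assumes x: "x \<in> carrier_vec n"
  shows "translation x * affine_functions = affine_functions * basic_rep n x"
proof (rule eq_matI)
  have dims: "dim_row (basic_rep n x) = n + 1" "dim_col (basic_rep n x) = n + 1"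
    using x by (simp_all add: basic_rep_def)
  then have \<rho>: "basic_rep n x \<in> carrier_mat (n + 1) (n + 1)" by auto
  have entries: "basic_rep n x $$ (0, k) = (if k = 0 then 1 else x $ (k - 1))"
    "j < n \<Longrightarrow> basic_rep n x $$ (j + 1, k) = (if k = j + 1 then 1 else 0)" if "k < n + 1" for j k
    using that x by (auto simp: basic_rep_def)
  fix i k assume "i < dim_row (affine_functions * basic_rep n x)" "k < dim_col (affine_functions * basic_rep n x)"
  then have ik: "i < N" "k < n + 1" using dims by (auto simp: affine_functions_def)
  have v: "e i + x \<in> carrier_vec n" using ik x e_carrier by auto
  have "(affine_functions * basic_rep n x) $$ (i, k) =
      (if k = 0 then 1 else x $ (k - 1)) + (\<Sum>j<n. if k = j + 1 then e i $ j else 0)"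
    unfolding affine_functions_mult[OF \<rho> ik]
    by (intro arg_cong2[where f = "(+)"] sum.cong refl) (use ik entries in auto)
  also have "\<dots> = (if k = 0 then 1 else (e i + x) $ (k - 1))"
  proof (cases k)
    case (Suc l)
    then have "(\<Sum>j<n. if k = j + 1 then e i $ j else 0) = (\<Sum>j<n. if j = l then e i $ j else 0)"
      by (intro sum.cong) auto
    then show ?thesis using Suc ik x e_carrier[OF ik(1)] by simp
  qed simp
  also have "\<dots> = (translation x * affine_functions) $$ (i, k)"
    unfolding translation_mult[OF affine_carrier(2) x ik]
    using ik ind_less[OF v] e_ind[OF v] by (simp add: affine_functions_def)
  finally show "(translation x * affine_functions) $$ (i, k) = (affine_functions * basic_rep n x) $$ (i, k)" by simp
qed (use x in \<open>auto simp: basic_rep_def translation_def affine_functions_def\<close>)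

text \<open>The second differences of the functions in an invariant plane vanish.\<close>

lemma invariant_plane_affine:
  assumes B: "B \<in> carrier_mat N 2"
    and closed: "\<And>x. x \<in> carrier_vec n \<Longrightarrow> \<phi> x \<in> carrier (GL 2)"
    and mult: "\<And>x y. x \<in> carrier_vec n \<Longrightarrow> y \<in> carrier_vec n \<Longrightarrow> \<phi> (x + y) = \<phi> x * \<phi> y"
    and inv: "\<And>x. x \<in> carrier_vec n \<Longrightarrow> translation x * B = B * \<phi> x"
  shows "B = affine_functions * (affine_part * B)"
proof (rule eq_matI)
  fix i k assume "i < dim_row (affine_functions * (affine_part * B))"
    "k < dim_col (affine_functions * (affine_part * B))"
  then have ik: "i < N" "k < 2" using B by (auto simp: affine_functions_def)
  interpret elementary_abelian "monoid_vec TYPE('q mod_ring) n" "CARD('q)"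
    by (rule elementary_abelian_vec)
  let ?b = "\<lambda>v. B $$ (ind v, k)"
  let ?r = "\<lambda>l. B $$ (ind (0\<^sub>v n), l)"
  have z: "ind (0\<^sub>v n) < N" by (rule ind_less) simp
  \<comment> \<open>The value at v is the value at 0 of the translate by v, hence a linear
    combination of entries of \<open>\<phi> v\<close> with coefficients independent of v.\<close>
  have b: "?b v = ?r 0 * \<phi> v $$ (0, k) + ?r 1 * \<phi> v $$ (1, k)" if v: "v \<in> carrier_vec n" for v
  proof -
    have "?b v = (translation v * B) $$ (ind (0\<^sub>v n), k)"
      using v by (simp add: translation_mult[OF B v z ik(2)] e_ind)
    also have "\<dots> = ?r 0 * \<phi> v $$ (0, k) + ?r 1 * \<phi> v $$ (1, k)"
      unfolding inv[OF v] by (rule mat2_mult[OF B GL_carrier_mat[OF closed[OF v]] z ik(2)])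
    finally show ?thesis .
  qed
  have unip: "\<phi> (x + y) $$ (l, k) = \<phi> x $$ (l, k) + \<phi> y $$ (l, k) - (if l = k then 1 else 0)"
    if "x \<in> carrier_vec n" "y \<in> carrier_vec n" "l < 2" for x y l
    using two_dimensional_rep_unipotent[of \<phi> x y l k] closed mult that ik by (simp add: monoid_vec_simps)
  \<comment> \<open>The identity matrix subtracted in \<open>unip\<close> contributes exactly the
    value at 0.\<close>
  have "?r 0 * (if 0 = k then 1 else 0) + ?r 1 * (if 1 = k then 1 else 0) = ?r k"
    using ik by (cases "k = 0") (auto simp: less_2_cases_iff)
  then have add: "?b (x + y) - ?b (0\<^sub>v n) = (?b x - ?b (0\<^sub>v n)) + (?b y - ?b (0\<^sub>v n))"
    if "x \<in> carrier_vec n" "y \<in> carrier_vec n" for x y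
    using that by (simp add: b[of "x + y"] b[of x] b[of y] unip algebra_simps)
  have "?b v - ?b (0\<^sub>v n) = (\<Sum>j<n. v $ j * (?b (unit_vec n j) - ?b (0\<^sub>v n)))" if "v \<in> carrier_vec n" for v
    by (rule additive_imp_linear[of n "\<lambda>v. ?b v - ?b (0\<^sub>v n)", OF add that])
  from this[OF e_carrier[OF ik(1)]]
  have "B $$ (i, k) = ?b (0\<^sub>v n) + (\<Sum>j<n. e i $ j * (?b (unit_vec n j) - ?b (0\<^sub>v n)))"
    using ik by (simp add: ind_e algebra_simps)
  also have "\<dots> = (affine_functions * (affine_part * B)) $$ (i, k)"
  proof -
    have AB: "affine_part * B \<in> carrier_mat (n + 1) 2" using B by (auto simp: affine_part_def)
    show ?thesis
      unfolding affine_functions_mult[OF AB ik]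
      using affine_part_mult[OF B _ ik(2)] by simp
  qed
  finally show "B $$ (i, k) = (affine_functions * (affine_part * B)) $$ (i, k)" .
qed (use B in \<open>auto simp: affine_functions_def\<close>)

text \<open>Both sides localize to invariant planes, where the embedding of the affine functions
  makes the comparison. \<sigma> is a separate parameter since the composite through automorphisms
  of the free group is known to agree with \<open>translation\<close> only for vectors of length
  n.\<close>

lemma chi_translation:
  fixes \<alpha> :: "('q mod_ring mat list \<Rightarrow> 'q mod_ring) set"
  assumes n: "n \<ge> 1" and N: "N \<ge> 2"
    and \<alpha>: "\<alpha> \<in> carrier (cohomology (GL 2))"
    and \<sigma>: "\<sigma> \<in> hom (monoid_vec TYPE('q mod_ring) n) (GL N)"
    and \<sigma>_eq: "\<And>x. x \<in> carrier_vec n \<Longrightarrow> \<sigma> x = translation x"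
  shows "chi (monoid_vec TYPE('q mod_ring) n) N \<sigma> \<alpha> =
    chi (monoid_vec TYPE('q mod_ring) n) (n + 1) (basic_rep n) \<alpha>"
proof -
  let ?V = "monoid_vec TYPE('q mod_ring) n"
  interpret elementary_abelian ?V "CARD('q)" by (rule elementary_abelian_vec)
  obtain f0 where "f0 \<in> cocycles (GL 2)" "\<alpha> = cohomology_class (GL 2) f0"
    using \<alpha> by (auto simp: carrier_cohomology)
  then obtain f where f: "f \<in> cocycles (GL 2)" and \<alpha>f: "positive_part (GL 2) \<alpha> = cohomology_class (GL 2) f"
    using positive_part_cohomology_class[OF group_GL] by blast
  have M: "n + 1 \<ge> 2" using n by simp
  have char: "of_nat CARD('q) = (0 :: 'q mod_ring)" by simp
  have "chi ?V N \<sigma> \<alpha> = cohomology_class ?V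
      (family_sum ?V (fixed_cosets ?V N \<sigma>) (\<lambda>C x. block_multiplier N C (\<sigma> x)) f)"
    using family_sum_fixed_cosets[OF N \<sigma> f char]
    by (simp add: chi_cohomology_class[OF N \<alpha>f \<sigma> is_monoid] pullback_chi_cochain[OF N \<sigma>])
  also have "\<dots> = cohomology_class ?V
      (family_sum ?V (fixed_cosets ?V (n + 1) (basic_rep n)) (\<lambda>C x. block_multiplier (n + 1) C (basic_rep n x)) f)"
  proof (rule family_sum_fixed_cosets_comparison[OF N M \<sigma> basic_rep_hom affine_carrier(2,3)
        affine_part_affine_functions _ _ f])
    fix B :: "'q mod_ring mat" and \<phi> assume "B \<in> carrier_mat N 2"
      "\<And>x. x \<in> carrier ?V \<Longrightarrow> \<phi> x \<in> carrier (GL 2)"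
      "\<And>x y. x \<in> carrier ?V \<Longrightarrow> y \<in> carrier ?V \<Longrightarrow> \<phi> (x \<otimes>\<^bsub>?V\<^esub> y) = \<phi> x * \<phi> y"
      "\<And>x. x \<in> carrier ?V \<Longrightarrow> \<sigma> x * B = B * \<phi> x"
    then show "B = affine_functions * (affine_part * B)"
      by (intro invariant_plane_affine[of B \<phi>]) (simp_all add: monoid_vec_simps \<sigma>_eq)
  qed (simp add: monoid_vec_simps \<sigma>_eq translation_affine_functions)
  also have "\<dots> = chi ?V (n + 1) (basic_rep n) \<alpha>"
    unfolding chi_cohomology_class[OF M \<alpha>f basic_rep_hom is_monoid] pullback_chi_cochain[OF M basic_rep_hom]
    by (rule family_sum_fixed_cosets[OF M basic_rep_hom f char, symmetric])
  finally show ?thesis .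
qed

end

section \<open>Automorphisms permuting the generators\<close>

lemma of_int_mat_hom:
  "(map_mat of_int :: int mat \<Rightarrow> 'a::comm_ring_1 mat) \<in> hom (GL N) (GL N)"
proof -
  have mult: "map_mat of_int (A * B) = (map_mat of_int A * map_mat of_int B :: 'a mat)"
    if "A \<in> carrier_mat N N" "B \<in> carrier_mat N N" for A B :: "int mat"
    using of_int_hom.mat_hom_mult[OF that] .
  have "map_mat of_int A \<in> carrier (GL N :: 'a mat monoid)" if mem: "A \<in> carrier (GL N)" for A :: "int mat"
  proof -
    obtain B where A: "A \<in> carrier_mat N N" and B: "B \<in> carrier_mat N N" "B * A = 1\<^sub>m N" "A * B = 1\<^sub>m N"
      using mem by (auto simp: carrier_GL)
    have "map_mat of_int B * map_mat of_int A = (1\<^sub>m N :: 'a mat)"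
      "map_mat of_int A * map_mat of_int B = (1\<^sub>m N :: 'a mat)"
      using mult[OF B(1) A] mult[OF A B(1)] by (simp_all add: B(2,3) of_int_hom.mat_hom_one)
    then show ?thesis using A B(1) by (auto simp: carrier_GL intro!: bexI[of _ "map_mat of_int B"])
  qed
  then show ?thesis using mult by (auto simp: hom_def carrier_GL)
qed

lemma carrier_AutoGroup: "carrier (AutoGroup G) = hom G G \<inter> Bij (carrier G)"
  by (simp add: AutoGroup_def auto_def)

lemma mult_AutoGroup:
  assumes "\<phi> \<in> carrier (AutoGroup G)" "\<psi> \<in> carrier (AutoGroup G)"
  shows "\<phi> \<otimes>\<^bsub>AutoGroup G\<^esub> \<psi> = compose (carrier G) \<phi> \<psi>"
  using assms by (simp add: AutoGroup_def auto_def BijGroup_def)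

lemma single_letter: "j < m \<Longrightarrow> [(j, b)] \<in> carrier (free_group m)"
  by (simp add: free_group_def reduced_def)

lemma abelianize_single:
  "i < m \<Longrightarrow> abelianize m [(j, True)] $ i = (if i = j then 1 else 0)"
  by (simp add: abelianize_def exponent_sum_def)

lemma pi_ab_carrier [simp]: "pi_ab m \<phi> \<in> carrier_mat m m"
  unfolding pi_ab_def using mat_of_cols_carrier[of m "map (\<lambda>j. abelianize m (\<phi> [(j, True)])) [0..<m]"] by simp

lemma pi_ab_index:
  "i < m \<Longrightarrow> j < m \<Longrightarrow> pi_ab m \<phi> $$ (i, j) = abelianize m (\<phi> [(j, True)]) $ i"
  by (simp add: pi_ab_def mat_of_cols_index)

text \<open>By \<open>abelianize_natural\<close>, applying \<phi> to the image of a generator under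
  \<psi> multiplies the corresponding column by the matrix of \<phi>. Inverse automorphisms then
  give inverse matrices.\<close>

lemma pi_ab_hom: "pi_ab m \<in> hom (AutoGroup (free_group m)) (GL m)"
proof -
  let ?F = "free_group m" and ?A = "AutoGroup (free_group m)"
  interpret F: group ?F by (rule group_free_group)
  interpret A: group ?A by (rule F.AutoGroup)
  have mult: "pi_ab m (\<phi> \<otimes>\<^bsub>?A\<^esub> \<psi>) = pi_ab m \<phi> * pi_ab m \<psi>"
    if \<phi>: "\<phi> \<in> carrier ?A" and \<psi>: "\<psi> \<in> carrier ?A" for \<phi> \<psi>
  proof (rule eq_matI)
    fix i j assume "i < dim_row (pi_ab m \<phi> * pi_ab m \<psi>)" "j < dim_col (pi_ab m \<phi> * pi_ab m \<psi>)"
    then have ij: "i < m" "j < m"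
      using carrier_matD[OF pi_ab_carrier[of m \<phi>]] carrier_matD[OF pi_ab_carrier[of m \<psi>]] by auto
    have x: "[(j, True)] \<in> carrier ?F" using ij by (simp add: single_letter)
    then have \<psi>x: "\<psi> [(j, True)] \<in> carrier ?F"
      using \<psi> by (auto simp: carrier_AutoGroup hom_def)
    have "pi_ab m (\<phi> \<otimes>\<^bsub>?A\<^esub> \<psi>) $$ (i, j) = abelianize m (\<phi> (\<psi> [(j, True)])) $ i"
      using ij x by (simp add: pi_ab_index mult_AutoGroup[OF \<phi> \<psi>] compose_def)
    also have "\<dots> = (pi_ab m \<phi> *\<^sub>v abelianize m (\<psi> [(j, True)])) $ i"
      by (simp add: abelianize_natural[OF \<phi> \<psi>x])
    also have "abelianize m (\<psi> [(j, True)]) = col (pi_ab m \<psi>) j"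
    proof (rule eq_vecI)
      show "dim_vec (abelianize m (\<psi> [(j, True)])) = dim_vec (col (pi_ab m \<psi>) j)"
        using carrier_matD(1)[OF pi_ab_carrier[of m \<psi>]] by (simp add: abelianize_def)
      fix k assume "k < dim_vec (col (pi_ab m \<psi>) j)"
      then show "abelianize m (\<psi> [(j, True)]) $ k = col (pi_ab m \<psi>) j $ k"
        using carrier_matD[OF pi_ab_carrier[of m \<psi>]] ij by (simp add: pi_ab_index)
    qed
    also have "(pi_ab m \<phi> *\<^sub>v col (pi_ab m \<psi>) j) $ i = (pi_ab m \<phi> * pi_ab m \<psi>) $$ (i, j)"
      using ij carrier_matD[OF pi_ab_carrier[of m \<phi>]] carrier_matD[OF pi_ab_carrier[of m \<psi>]] by simp
    finally show "pi_ab m (\<phi> \<otimes>\<^bsub>?A\<^esub> \<psi>) $$ (i, j) = (pi_ab m \<phi> * pi_ab m \<psi>) $$ (i, j)" .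
  qed (use carrier_matD[OF pi_ab_carrier] in auto)
  have one: "pi_ab m \<one>\<^bsub>?A\<^esub> = 1\<^sub>m m"
  proof (rule eq_matI)
    fix i j assume "i < dim_row (1\<^sub>m m :: int mat)" "j < dim_col (1\<^sub>m m :: int mat)"
    then show "pi_ab m \<one>\<^bsub>?A\<^esub> $$ (i, j) = 1\<^sub>m m $$ (i, j)"
      by (simp add: pi_ab_index AutoGroup_def BijGroup_def single_letter abelianize_single)
  qed (use carrier_matD[OF pi_ab_carrier] in auto)
  have "pi_ab m \<phi> \<in> carrier (GL m)" if "\<phi> \<in> carrier ?A" for \<phi>
    unfolding carrier_GL using that
    by (intro conjI pi_ab_carrier bexI[of _ "pi_ab m (inv\<^bsub>?A\<^esub> \<phi>)"]) (simp_all add: one flip: mult)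
  then show ?thesis using mult by (simp add: hom_def)
qed

definition rename :: "(nat \<Rightarrow> nat) \<Rightarrow> letter list \<Rightarrow> letter list" where
  "rename s = map (map_prod s id)"

text \<open>Injectivity ensures that renaming creates no new cancellation between neighbouring
  letters.\<close>

lemma rename_push:
  assumes "inj s"
  shows "rename s (push x w) = push (map_prod s id x) (rename s w)"
proof -
  have "map_prod s id y = inv_letter (map_prod s id x) \<longleftrightarrow> y = inv_letter x" for y
    using assms by (cases x; cases y) (auto simp: inv_letter_def inj_eq)
  then show ?thesis by (cases w) (auto simp: rename_def)
qed

lemma rename_mult:
  assumes "inj s"
  shows "rename s (u \<otimes>\<^bsub>free_group m\<^esub> v) = rename s u \<otimes>\<^bsub>free_group m\<^esub> rename s v"
proof -
  have "rename s (foldr push u v) = foldr push (rename s u) (rename s v)"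
    using rename_push[OF assms] by (induction u) (simp_all add: rename_def)
  then show ?thesis by (simp add: free_group_def)
qed

lemma rename_carrier:
  assumes "inj s" "\<And>i. i < m \<Longrightarrow> s i < m" "w \<in> carrier (free_group m)"
  shows "rename s w \<in> carrier (free_group m)"
proof -
  have "map_prod s id y = inv_letter (map_prod s id x) \<longleftrightarrow> y = inv_letter x" for x y
    using assms(1) by (cases x; cases y) (auto simp: inv_letter_def inj_eq)
  then have "reduced (rename s w) \<longleftrightarrow> reduced w"
    by (simp add: reduced_def rename_def successively_map)
  moreover have "fst ` set (rename s w) = s ` fst ` set w"
    by (force simp: rename_def image_image)
  ultimately show ?thesis using assms(2,3) by (auto simp: free_group_def)
qed

lemma rename_AutoGroup:
  assumes inv: "\<And>i. s' (s i) = i" "\<And>i. s (s' i) = i"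
    and less: "\<And>i. i < m \<Longrightarrow> s i < m" "\<And>i. i < m \<Longrightarrow> s' i < m"
  shows "restrict (rename s) (carrier (free_group m)) \<in> carrier (AutoGroup (free_group m))"
proof -
  have inj: "inj s" "inj s'" using inv by (metis injI)+
  have comp: "rename s' (rename s w) = w" "rename s (rename s' w) = w" for w
    by (simp_all add: rename_def comp_def prod.map_comp map_prod_def inv case_prod_beta)
  note closed = rename_carrier[OF inj(1) less(1)] rename_carrier[OF inj(2) less(2)]
  have "bij_betw (rename s) (carrier (free_group m)) (carrier (free_group m))"
    by (rule bij_betw_byWitness[where f' = "rename s'"]) (auto simp: comp closed)
  then have "bij_betw (restrict (rename s) (carrier (free_group m))) (carrier (free_group m)) (carrier (free_group m))"
    by (simp cong: bij_betw_cong)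
  moreover have "restrict (rename s) (carrier (free_group m)) \<in> hom (free_group m) (free_group m)"
    using closed(1) group.is_monoid[OF group_free_group, of m]
    by (auto simp: hom_def rename_mult[OF inj(1)] monoid.m_closed)
  ultimately show ?thesis by (simp add: carrier_AutoGroup Bij_def)
qed

section \<open>Translations as automorphisms of the free group\<close>

context
  fixes n N :: nat and e :: "nat \<Rightarrow> 'q::prime_card mod_ring vec"
  assumes e: "bij_betw e {..<N} (carrier_vec n)"
begin

text \<open>The translation f \<mapsto> f(. + x) takes the indicator function of v to that of v - x,
  hence the minus sign. Indices from \<open>N\<close> on stay fixed, so that for x of length n this
  is a permutation of all natural numbers, as the renaming lemmas ask.\<close>

definition shift :: "'q mod_ring vec \<Rightarrow> nat \<Rightarrow> nat" where
  "shift x i = (if i < N then ind N e (e i - x) else i)"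

definition shift_automorphism :: "'q mod_ring vec \<Rightarrow> letter list \<Rightarrow> letter list" where
  "shift_automorphism x = restrict (rename (shift x)) (carrier (free_group N))"

lemma shift_less:
  assumes "x \<in> carrier_vec n" "i < N"
  shows "shift x i < N" "e (shift x i) = e i - x"
proof -
  have "e i - x \<in> carrier_vec n" using e_carrier[OF e assms(2)] assms(1) by simp
  then show "shift x i < N" "e (shift x i) = e i - x"
    using assms(2) ind_less[OF e] e_ind[OF e] by (simp_all add: shift_def)
qed

lemma shift_shift:
  assumes x: "x \<in> carrier_vec n" and y: "y \<in> carrier_vec n"
  shows "shift x (shift y i) = shift (x + y) i"
proof (cases "i < N")
  case True
  have "e i \<in> carrier_vec n" by (rule e_carrier[OF e True])
  then have "e i - y - x = e i - (x + y)" using x y by (intro eq_vecI) (auto simp: algebra_simps)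
  then show ?thesis
    using True shift_less[OF y True] by (simp add: shift_def[of x "shift y i"] shift_def[of "x + y"])
qed (simp add: shift_def)

lemma shift_zero: "shift (0\<^sub>v n) i = i"
proof (cases "i < N")
  case True
  have "e i - 0\<^sub>v n = e i" using e_carrier[OF e True] by auto
  then show ?thesis using True by (simp add: shift_def ind_e[OF e])
qed (simp add: shift_def)

lemma shift_automorphism_hom:
  "shift_automorphism \<in> hom (monoid_vec TYPE('q mod_ring) n) (AutoGroup (free_group N))"
proof -
  have inv: "shift (- x) (shift x i) = i" "shift x (shift (- x) i) = i" if "x \<in> carrier_vec n" for x i
  proof -
    have "- x + x = 0\<^sub>v n" "x + - x = 0\<^sub>v n" using that by auto
    then show "shift (- x) (shift x i) = i" "shift x (shift (- x) i) = i"
      using that by (simp_all add: shift_shift shift_zero)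
  qed
  have closed: "shift_automorphism x \<in> carrier (AutoGroup (free_group N))" if x: "x \<in> carrier_vec n" for x
    unfolding shift_automorphism_def
    by (rule rename_AutoGroup[of "shift (- x)"]) (use x inv[OF x] shift_less(1)[of x] shift_less(1)[of "- x"] in auto)
  have "shift_automorphism (x + y) = shift_automorphism x \<otimes>\<^bsub>AutoGroup (free_group N)\<^esub> shift_automorphism y"
    if x: "x \<in> carrier_vec n" and y: "y \<in> carrier_vec n" for x y
  proof -
    have "rename (shift (x + y)) w = rename (shift x) (rename (shift y) w)" for w
      using x y by (auto simp: rename_def shift_shift)
    moreover have "rename (shift y) w \<in> carrier (free_group N)" if "w \<in> carrier (free_group N)"
      for w
    proof -
      have "shift_automorphism y w \<in> carrier (free_group N)"
        using closed[OF y] that by (auto simp: carrier_AutoGroup hom_def)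
      then show ?thesis using that by (simp add: shift_automorphism_def)
    qed
    ultimately show ?thesis
      unfolding mult_AutoGroup[OF closed[OF x] closed[OF y]]
      by (auto simp: shift_automorphism_def compose_def fun_eq_iff)
  qed
  then show ?thesis using closed by (auto simp: hom_def monoid_vec_simps)
qed

lemma pi_ab_shift_automorphism:
  assumes x: "x \<in> carrier_vec n"
  shows "map_mat of_int (pi_ab N (shift_automorphism x)) = translation N e x"
proof (rule eq_matI)
  fix i j assume "i < dim_row (translation N e x)" "j < dim_col (translation N e x)"
  then have ij: "i < N" "j < N" by (simp_all add: translation_def[OF e])
  have v: "e i \<in> carrier_vec n" "e j \<in> carrier_vec n" using ij e_carrier[OF e] by auto
  \<comment> \<open>Columns of \<open>pi_ab\<close> record images of generators, whereas
    \<open>translation\<close> is described by rows; both amount to e j = e i + x.\<close>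
  have "i = shift x j \<longleftrightarrow> e i = e j - x"
    using ij shift_less[OF x ij(2)] ind_e[OF e] by metis
  also have "\<dots> \<longleftrightarrow> e j = e i + x"
    using v x by (auto simp: vec_eq_iff algebra_simps)
  also have "\<dots> \<longleftrightarrow> j = ind N e (e i + x)"
    using ij v x ind_e[OF e] e_ind[OF e, of "e i + x"] by (metis add_carrier_vec)
  finally have "i = shift x j \<longleftrightarrow> j = ind N e (e i + x)" .
  then show "map_mat of_int (pi_ab N (shift_automorphism x)) $$ (i, j) = translation N e x $$ (i, j)"
    using ij carrier_matD[OF pi_ab_carrier[of N "shift_automorphism x"]] single_letter[OF ij(2)]
    by (simp add: pi_ab_index translation_def[OF e] shift_automorphism_def rename_def abelianize_single)
qed (use carrier_matD[OF pi_ab_carrier] in \<open>auto simp: translation_def[OF e]\<close>)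

end

section \<open>Nonvanishing for the canonical representations\<close>

text \<open>By naturality the class over \<open>G\<close> is the pullback along \<theta> of the
  class over \<open>H\<close>, and pullback preserves zero and nilpotence; \<open>G\<close> is the
  test group.\<close>

lemma chi_nonzero_if_pullback_nonzero:
  assumes N: "N \<ge> 2" and \<alpha>: "\<alpha> \<in> carrier (cohomology (GL 2))"
    and \<rho>: "\<rho> \<in> hom H (GL N)" and H: "monoid H" and \<theta>: "\<theta> \<in> hom G H" and G: "monoid G"
    and nz: "chi G N (\<rho> \<circ> \<theta>) \<alpha> \<noteq> \<zero>\<^bsub>cohomology G\<^esub>"
  shows "chi H N \<rho> \<alpha> \<noteq> \<zero>\<^bsub>cohomology H\<^esub>"
    and "\<not> nilpotent (cohomology G) (chi G N (\<rho> \<circ> \<theta>) \<alpha>) \<Longrightarrow> \<not> nilpotent (cohomology H) (chi H N \<rho> \<alpha>)"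
proof -
  obtain f0 where "f0 \<in> cocycles (GL 2)" "\<alpha> = cohomology_class (GL 2) f0"
    using \<alpha> by (auto simp: carrier_cohomology)
  then obtain f where f: "f \<in> cocycles (GL 2)" and \<alpha>f: "positive_part (GL 2) \<alpha> = cohomology_class (GL 2) f"
    using positive_part_cohomology_class[OF group_GL] by blast
  note pull = chi_pullback[OF N \<alpha>f \<rho> H \<theta> G]
  show "chi H N \<rho> \<alpha> \<noteq> \<zero>\<^bsub>cohomology H\<^esub>"
    using nz pullback_zero[OF \<theta> G] unfolding pull by metis
  have "pullback_cochain H \<rho> (chi_cochain N f) \<in> cocycles H"
    by (rule pullback_cochain_cocycle[OF \<rho> H chi_cochain_cocycle[OF N f]])
  from nilpotent_pullback[OF \<theta> G H this]
  show "\<not> nilpotent (cohomology G) (chi G N (\<rho> \<circ> \<theta>) \<alpha>) \<Longrightarrow> \<not> nilpotent (cohomology H) (chi H N \<rho> \<alpha>)"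
    unfolding pull chi_cohomology_class[OF N \<alpha>f \<rho> H] by blast
qed

theorem theorem46:
  fixes n :: nat
    and \<alpha> :: "('p::prime_card mod_ring mat list \<Rightarrow> 'p mod_ring) set"
  assumes "n \<ge> 1"
    and "\<alpha> \<in> carrier (cohomology (GL 2))"
    and "chi (monoid_vec TYPE('p mod_ring) n) (n + 1) (basic_rep n) \<alpha>
           \<noteq> \<zero>\<^bsub>cohomology (monoid_vec TYPE('p mod_ring) n)\<^esub>"
  shows "chi (GL (CARD('p) ^ n)) (CARD('p) ^ n) rho_can \<alpha>
           \<noteq> \<zero>\<^bsub>cohomology (GL (CARD('p) ^ n) :: int mat monoid)\<^esub> \<and>
         chi (AutoGroup (free_group (CARD('p) ^ n))) (CARD('p) ^ n)
             (rho_can \<circ> pi_ab (CARD('p) ^ n)) \<alpha>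
           \<noteq> \<zero>\<^bsub>cohomology (AutoGroup (free_group (CARD('p) ^ n)))\<^esub> \<and>
         (\<not> nilpotent (cohomology (monoid_vec TYPE('p mod_ring) n))
              (chi (monoid_vec TYPE('p mod_ring) n) (n + 1) (basic_rep n) \<alpha>) \<longrightarrow>
          \<not> nilpotent (cohomology (GL (CARD('p) ^ n) :: int mat monoid))
              (chi (GL (CARD('p) ^ n)) (CARD('p) ^ n) rho_can \<alpha>) \<and>
          \<not> nilpotent (cohomology (AutoGroup (free_group (CARD('p) ^ n))))
              (chi (AutoGroup (free_group (CARD('p) ^ n))) (CARD('p) ^ n)
                 (rho_can \<circ> pi_ab (CARD('p) ^ n)) \<alpha>))"
proof -
  define N where "N = CARD('p) ^ n"
  let ?V = "monoid_vec TYPE('p mod_ring) n" and ?A = "AutoGroup (free_group N)"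
  let ?GLZ = "GL N :: int mat monoid"
  \<comment> \<open>p^n is the number of vectors; any enumeration of them orders the basis of
    indicator functions.\<close>
  obtain e :: "nat \<Rightarrow> 'p mod_ring vec" where e: "bij_betw e {..<N} (carrier_vec n)"
    using ex_bij_betw_nat_finite[of "carrier_vec n :: 'p mod_ring vec set"]
    by (auto simp: card_carrier_vec N_def lessThan_atLeast0)
  have "CARD('p) \<ge> 2" using prime_card by (rule prime_ge_2_nat)
  moreover have "CARD('p) ^ 1 \<le> CARD('p) ^ n" using assms(1) by (intro power_increasing) auto
  ultimately have N: "N \<ge> 2" by (simp add: N_def)
  let ?s = "shift_automorphism N e"
  have V: "monoid ?V" using elementary_abelian_vec elementary_abelian.axioms(1) comm_group.axioms(2) group.is_monoid by blast
  have A: "monoid ?A" by (rule group.is_monoid[OF group.AutoGroup[OF group_free_group]])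
  have Z: "monoid ?GLZ" by (rule group.is_monoid[OF group_GL])
  note s = shift_automorphism_hom[OF e]
  have rho_pi: "rho_can \<circ> pi_ab N \<in> hom ?A (GL N :: 'p mod_ring mat monoid)"
    by (rule hom_compose[OF pi_ab_hom of_int_mat_hom])
  have pi_s: "pi_ab N \<circ> ?s \<in> hom ?V ?GLZ" by (rule hom_compose[OF s pi_ab_hom])
  have "rho_can \<circ> pi_ab N \<circ> ?s \<in> hom ?V (GL N :: 'p mod_ring mat monoid)" by (rule hom_compose[OF s rho_pi])
  from chi_translation[OF e assms(1) N assms(2) this]
  have eq: "chi ?V N (rho_can \<circ> pi_ab N \<circ> ?s) \<alpha> = chi ?V (n + 1) (basic_rep n) \<alpha>"
    by (simp add: pi_ab_shift_automorphism[OF e])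
  note detect_A = chi_nonzero_if_pullback_nonzero[OF N assms(2) rho_pi A s V, unfolded eq, OF assms(3)]
  \<comment> \<open>The same homomorphism from \<open>?V\<close> is bracketed the other way:
    \<open>pi_ab N \<circ> ?s\<close> into the integral matrices, then reduction mod p.\<close>
  note detect_Z = chi_nonzero_if_pullback_nonzero[OF N assms(2) of_int_mat_hom Z pi_s V,
      folded comp_assoc, unfolded eq, OF assms(3)]
  show ?thesis using detect_A detect_Z unfolding N_def by blast
qed

end
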